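(* Let $p=(p_k)_{k\ge 0}$ be a probability distribution on $\mathbb{N}_0$ with $p_0=0$, $p_1<1$ and $m_{\mathtt{BGW}}:=\sum_{k\ge1}kp_k<\infty$, and let $\omega$ be a Bienaymé–Galton–Watson tree with offspring law $p$ (law $\mathtt{BGW}$). Let $\lambda>0$ and let $\mu=(\mu_k)_{k\ge0}$ be a probability distribution on $\mathbb{N}_0$ with $\mu_0=0$, $\mu_1<1$ and $m:=\sum_{k\ge1}k\mu_k\in(1,\infty)$. Let $(X(u),u\in\mathbb{T})$ be the $\lambda$-biased branching random walk on $\omega$ with reproduction law $\mu$, started from one particle at the root. Then for $\mathtt{BGW}$-a.e. $\omega$, $$\lim_{n\to\infty}\frac1n\max_{|u|=n}|X(u)|=v_{\lambda,m}\qquad \mathbf{P}_\omega\text{-a.s.},$$ where $v_{\lambda,m}:=\sup\{a\in[v_\lambda,1]: I_\lambda(a)\le\log m\}$ is a constant depending only on $\lambda$, $m$ and $p$.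
   Context: Notation: $\varrho$ is the root of $\omega$; for a vertex $x$, $|x|$ is its graph distance to $\varrho$, $x_-$ its parent, $\kappa_x$ its number of children. The $\lambda$-biased random walk $(S_n)_{n\ge0}$ on $\omega$ is the Markov chain started at $S_0=\varrho$ which from $\varrho$ jumps to each child of $\varrho$ with probability $1/\kappa_\varrho$, and from $x\ne\varrho$ jumps to $x_-$ with probability $\lambda/(\lambda+\kappa_x)$ and to each child of $x$ with probability $1/(\lambda+\kappa_x)$; its quenched law is $\mathrm{P}_\omega$ and its annealed law $\mathbb{P}=\int \mathrm{P}_\omega\,\mathtt{BGW}(d\omega)$. The $\lambda$-biased branching random walk: the genealogy $\mathbb{T}$ is a Bienaymé–Galton–Watson tree with offspring law $\mu$ (root $\varnothing$, $|u|$ the generation of $u$), independent of $\omega$; $X(\varnothing)=\varrho$, and given $\omega$, each child of a particle located at $x$ is placed, independently of everything else, at a position chosen according to one step of the $\lambda$-biased random walk from $x$. Its quenched law (given $\omega$) is $\mathbf{P}_\omega$. $v_\lambda\in[0,1]$ denotes the deterministic speed of the $\lambda$-biased walk, i.e. $|S_n|/n\to v_\lambda$ $\mathrm{P}_\omega$-a.s. for $\mathtt{BGW}$-a.e. $\omega$. $I_\lambda:[v_\lambda,1]\to[0,\infty)$ denotes the (continuous, convex, strictly increasing, $I_\lambda(v_\lambda)=0$) large deviation rate function of the walk: for $a\in(v_\lambda,1]$ and $b>a$, $\lim_n\frac1n\log\mathrm{P}_\omega(|S_n|/n\in[a,b))=\lim_n\frac1n\log\mathbb{P}(|S_n|/n\in[a,b))=-I_\lambda(a)$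 for $\mathtt{BGW}$-a.e. $\omega$ (this is known to exist when $\lambda<m_{\mathtt{BGW}}$). *)

theory Defs
  imports "HOL-Probability.Probability"
begin

text \<open>Rooted trees in Ulam--Harris form. A tree is encoded by a child-count
function \<kappa> :: nat list \<Rightarrow> nat; the vertices are the lists u with
u!i < \<kappa> (take i u) for all i < length u. The root is [], |x| = length x,
the parent of x is butlast x, and \<kappa> x is the number of children of x.\<close>

definition in_tree :: "(nat list \<Rightarrow> nat) \<Rightarrow> nat list \<Rightarrow> bool" where
  "in_tree \<kappa> u \<longleftrightarrow> (\<forall>i < length u. u ! i < \<kappa> (take i u))"

definition BGW :: "nat pmf \<Rightarrow> (nat list \<Rightarrow> nat) measure" where
  "BGW p = PiM UNIV (\<lambda>_::nat list. measure_pmf p)"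

definition step_pmf :: "real \<Rightarrow> (nat list \<Rightarrow> nat) \<Rightarrow> nat list \<Rightarrow> nat list pmf" where
  "step_pmf lam \<kappa> x =
     (if x = [] then map_pmf (\<lambda>i. [i]) (pmf_of_set {..<\<kappa> []})
      else bind_pmf (bernoulli_pmf (lam / (lam + real (\<kappa> x))))
             (\<lambda>b. if b then return_pmf (butlast x)
                  else map_pmf (\<lambda>i. x @ [i]) (pmf_of_set {..<\<kappa> x})))"

text \<open>Quenched law of the walk: at each time n an independent family of
transition choices c n x ~ step_pmf lam \<kappa> x (one for every possible position x);
the walk uses c n (S n).\<close>
definition walk_space :: "real \<Rightarrow> (nat list \<Rightarrow> nat) \<Rightarrow> (nat \<Rightarrow> nat list \<Rightarrow> nat list) measure" where
  "walk_space lam \<kappa> = PiM UNIV (\<lambda>_::nat. PiM UNIV (\<lambda>x::nat list. measure_pmf (step_pmf lam \<kappa> x)))"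

primrec walk_pos :: "(nat \<Rightarrow> nat list \<Rightarrow> nat list) \<Rightarrow> nat \<Rightarrow> nat list" where
  "walk_pos c 0 = []"
| "walk_pos c (Suc n) = c n (walk_pos c n)"

definition is_speed :: "nat pmf \<Rightarrow> real \<Rightarrow> real \<Rightarrow> bool" where
  "is_speed p lam v \<longleftrightarrow> v \<in> {0..1} \<and>
     (AE \<kappa> in BGW p. AE c in walk_space lam \<kappa>.
        (\<lambda>n. real (length (walk_pos c n)) / real n) \<longlonglongrightarrow> v)"

definition is_rate_fn :: "nat pmf \<Rightarrow> real \<Rightarrow> real \<Rightarrow> (real \<Rightarrow> real) \<Rightarrow> bool" where
  "is_rate_fn p lam v I \<longleftrightarrow>
     continuous_on {v..1} I \<and> convex_on {v..1} I \<and> strict_mono_on {v..1} I \<and>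
     I v = 0 \<and> (\<forall>a\<in>{v..1}. 0 \<le> I a) \<and>
     (\<forall>a b. v < a \<and> a \<le> 1 \<and> a < b \<longrightarrow>
        (AE \<kappa> in BGW p.
          (\<lambda>n. ln (measure (walk_space lam \<kappa>)
                  {c \<in> space (walk_space lam \<kappa>).
                     real (length (walk_pos c n)) / real n \<in> {a..<b}}) / real n)
          \<longlonglongrightarrow> - I a))"

text \<open>Branching random walk. Genealogy: \<nu> :: nat list \<Rightarrow> nat i.i.d. with law \<mu>
(a BGW(\<mu>) tree). Displacements: for every individual u an independent family
ch u x ~ step_pmf lam \<kappa> x; the child u@[i] of an individual at x is placed at
ch (u@[i]) x.\<close>
definition brw_pos :: "(nat list \<Rightarrow> nat list \<Rightarrow> nat list) \<Rightarrow> nat list \<Rightarrow> nat list" where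
  "brw_pos ch u = snd (foldl (\<lambda>(w, x) i. (w @ [i], ch (w @ [i]) x)) ([], []) u)"

definition BRW_quenched :: "real \<Rightarrow> nat pmf \<Rightarrow> (nat list \<Rightarrow> nat) \<Rightarrow>
    ((nat list \<Rightarrow> nat) \<times> (nat list \<Rightarrow> nat list \<Rightarrow> nat list)) measure" where
  "BRW_quenched lam mu \<kappa> =
     PiM UNIV (\<lambda>_::nat list. measure_pmf mu) \<Otimes>\<^sub>M
     PiM UNIV (\<lambda>_::nat list. PiM UNIV (\<lambda>x::nat list. measure_pmf (step_pmf lam \<kappa> x)))"

definition generation :: "(nat list \<Rightarrow> nat) \<Rightarrow> nat \<Rightarrow> nat list set" where
  "generation \<nu> n = {u. length u = n \<and> in_tree \<nu> u}"

definition max_disp :: "(nat list \<Rightarrow> nat) \<Rightarrow> (nat list \<Rightarrow> nat list \<Rightarrow> nat list) \<Rightarrow> nat \<Rightarrow> real" where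
  "max_disp \<nu> ch n = real (Max ((\<lambda>u. length (brw_pos ch u)) ` generation \<nu> n))"

end

theory Submission
  imports Defs "HOL-Real_Asymp.Real_Asymp"
begin

text \<open>Upper bound: the expected number of particles of generation n beyond a n is m^n times the
probability that the walk is beyond a n, hence exponentially small as soon as I a > log m.

Lower bound: let I \<alpha> < G and give every step weight e^G. Follow only particles that climb \<alpha> T levels
within time T without leaving the subtree in which they started. By the large deviation estimate
their expected number W exceeds 1 exponentially in T in almost every environment, so W^(-1/T) has
mean less than 1 over the environments. Iterating over independent subtrees and linearising the
branching mechanism shows, by Jensen's inequality, that E q^(-\<theta>) is bounded for a small \<theta> > 0,
where q is the probability of climbing at speed \<alpha>. The iterates of the generating function satisfy
f^j (1 - q) \<le> \<rho>^j q^(-\<theta>) with \<rho> < 1, so after letting the population grow for a short while and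
reaching a fresh subtree the failure probabilities are summable. If v = 0, growing may take a positive
fraction of the time; then G may exceed log m, and the growth pays for the excess.\<close>

section \<open>Generating functions\<close>

text \<open>The large deviation hypothesis is weak: it concerns end points of the walk only and, for
  each speed, holds in almost every environment without any rate in the environment. Three devices
  compensate. (1) A straight path is always available, so W^(-1/T) is at most 1 + \<lambda> even in
  bad environments, and it is enough that these become improbable. (2) End points are turned into
  hitting times at polynomial cost, and killing at the exit from a subtree makes successive stages
  depend on disjoint pieces of the environment. (3) Arrivals early in a stage collect too little of
  the weight e^G per step, so they must be exponentially rarer than those near time T. This holds if
  the cost per level I x / x is strictly larger beyond \<alpha> than at \<alpha>. Convexity and I v
  = 0 give it when v > 0; when v = 0, I may be linear near 0 and \<alpha> must be moved to the last
  minimiser of I x / x, possibly faster than the target speed. Hence the two cases. All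
  probabilities are recursions in a fixed environment, so Jensen's inequality reduces to a tangent
  line, linearity and monotonicity.\<close>

definition pgf :: "nat pmf \<Rightarrow> real \<Rightarrow> real" where
  "pgf \<mu> r = measure_pmf.expectation \<mu> (\<lambda>k. r ^ k)"

lemma integrable_pgf: "\<lbrakk>0 \<le> r; r \<le> 1\<rbrakk> \<Longrightarrow> integrable (measure_pmf \<mu>) (\<lambda>k. r ^ k :: real)"
  by (rule measure_pmf.integrable_const_bound[where B = 1]) (auto simp: power_le_one)

lemma pgf_nonneg: "0 \<le> r \<Longrightarrow> 0 \<le> pgf \<mu> r"
  unfolding pgf_def by (rule integral_nonneg_AE) auto

lemma pgf_mono:
  assumes "0 \<le> r" "r \<le> s" "s \<le> 1" shows "pgf \<mu> r \<le> pgf \<mu> s"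
  unfolding pgf_def
  by (intro integral_mono integrable_pgf) (use assms in \<open>auto intro: power_mono\<close>)

lemma pgf_one [simp]: "pgf \<mu> 1 = 1"
  by (simp add: pgf_def)

lemma pgf_le_one: "\<lbrakk>0 \<le> r; r \<le> 1\<rbrakk> \<Longrightarrow> pgf \<mu> r \<le> 1"
  using pgf_mono[of r 1 \<mu>] by simp

text \<open>The slope is E k r0^(k-1), finite up to r0 = 1 because the mean is. In the form of an
  affine minorant, convexity can be used under any functional that is linear and monotone; the
  functional never has to be written as an integral.\<close>

lemma pgf_tangent:
  assumes int: "integrable (measure_pmf \<mu>) real" and r0: "0 \<le> r\<^sub>0" "r\<^sub>0 \<le> 1"
  obtains s where "\<And>r. \<lbrakk>0 \<le> r; r \<le> 1\<rbrakk> \<Longrightarrow> pgf \<mu> r\<^sub>0 + s * (r - r\<^sub>0) \<le> pgf \<mu> r"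
proof -
  define d where "d k = real k * r\<^sub>0 ^ (k - 1)" for k
  have intd: "integrable (measure_pmf \<mu>) d"
  proof (rule Bochner_Integration.integrable_bound[OF int])
    show "AE k in measure_pmf \<mu>. norm (d k) \<le> norm (real k)"
      using r0 by (auto simp: d_def abs_mult power_le_one mult_left_le)
  qed simp
  have tangent: "r\<^sub>0 ^ k + d k * (r - r\<^sub>0) \<le> r ^ k" if r: "0 \<le> r" for r k
  proof (cases "r\<^sub>0 = 0")
    case True
    then show ?thesis using r by (cases k; cases "k - 1") (auto simp: d_def)
  next
    case False
    \<comment> \<open>Bernoulli's inequality at r / \<open>r\<^sub>0\<close> - 1, which is at least
      -1, gives the tangent of the k-th power at \<open>r\<^sub>0\<close>.\<close>
    have "1 + real k * (r / r\<^sub>0 - 1) \<le> (1 + (r / r\<^sub>0 - 1)) ^ k"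
      using False r r0 by (intro Bernoulli_inequality) auto
    then have "r\<^sub>0 ^ k * (1 + real k * (r / r\<^sub>0 - 1)) \<le> r\<^sub>0 ^ k * (r / r\<^sub>0) ^ k"
      using r0 by (intro mult_left_mono) auto
    also have "\<dots> = r ^ k" using False by (simp add: power_divide)
    also have "r\<^sub>0 ^ k * (1 + real k * (r / r\<^sub>0 - 1)) = r\<^sub>0 ^ k + d k * (r - r\<^sub>0)"
      using False by (cases k) (auto simp: d_def field_simps)
    finally show ?thesis .
  qed
  show ?thesis
  proof
    fix r :: real assume r: "0 \<le> r" "r \<le> 1"
    have "pgf \<mu> r\<^sub>0 + measure_pmf.expectation \<mu> d * (r - r\<^sub>0) =
        measure_pmf.expectation \<mu> (\<lambda>k. r\<^sub>0 ^ k + d k * (r - r\<^sub>0))"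
      unfolding pgf_def using r0 intd by (simp add: integrable_pgf)
    also have "\<dots> \<le> pgf \<mu> r"
      unfolding pgf_def using r r0 intd tangent
      by (intro integral_mono Bochner_Integration.integrable_add integrable_mult_left integrable_pgf) auto
    finally show "pgf \<mu> r\<^sub>0 + measure_pmf.expectation \<mu> d * (r - r\<^sub>0) \<le> pgf \<mu> r" .
  qed
qed

text \<open>Without mass at 0, r^k \<le> r^2 for every k other than 1. The bound is written as r
  times a factor to exhibit the contraction away from r = 1; the factor tends to 1 as r does, and
  there the mean has to take over.\<close>

lemma pgf_le_strict:
  assumes "pmf \<mu> 0 = 0" "0 \<le> r" "r \<le> 1"
  shows "pgf \<mu> r \<le> r * (1 - (1 - pmf \<mu> 1) * (1 - r))"
proof -
  have ind: "measure_pmf.expectation \<mu> (indicator {1}) = pmf \<mu> 1"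
    by (simp add: pmf.rep_eq)
  have int: "integrable (measure_pmf \<mu>) (indicator {1} :: nat \<Rightarrow> real)"
    by (rule measure_pmf.integrable_const_bound[where B = 1]) (auto simp: indicator_def)
  have "pgf \<mu> r \<le> measure_pmf.expectation \<mu> (\<lambda>k. r\<^sup>2 + (r - r\<^sup>2) * indicator {1} k)"
    unfolding pgf_def
  proof (rule integral_mono_AE)
    show "AE k in measure_pmf \<mu>. r ^ k \<le> r\<^sup>2 + (r - r\<^sup>2) * indicator {1} k"
    proof (rule AE_pmfI)
      fix k assume "k \<in> set_pmf \<mu>"
      then have "k \<noteq> 0" using assms(1) by (metis set_pmf_iff)
      then show "r ^ k \<le> r\<^sup>2 + (r - r\<^sup>2) * indicator {1} k"
        using power_decreasing[of 2 k r] assms by (cases "k = 1") auto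
    qed
  qed (use assms int in \<open>intro Bochner_Integration.integrable_add integrable_mult_right integrable_pgf; simp\<close>)+
  also have "\<dots> = r\<^sup>2 + (r - r\<^sup>2) * pmf \<mu> 1"
    using int ind by simp
  finally show ?thesis by (simp add: algebra_simps power2_eq_square)
qed

lemma pgf_le: "\<lbrakk>pmf \<mu> 0 = 0; 0 \<le> r; r \<le> 1\<rbrakk> \<Longrightarrow> pgf \<mu> r \<le> r"
  using pgf_le_strict[of \<mu> r] pmf_le_1[of \<mu> 1] mult_left_le[of "1 - (1 - pmf \<mu> 1) * (1 - r)" r]
  by (simp add: mult_nonneg_nonneg)

lemma one_minus_pgf_le:
  assumes "integrable (measure_pmf \<mu>) real" "0 \<le> x" "x \<le> 1"
  shows "1 - pgf \<mu> (1 - x) \<le> measure_pmf.expectation \<mu> real * x"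
proof -
  have "1 - pgf \<mu> (1 - x) = measure_pmf.expectation \<mu> (\<lambda>k. 1 - (1 - x) ^ k)"
    unfolding pgf_def using assms by (subst Bochner_Integration.integral_diff) (auto intro: integrable_pgf)
  also have "\<dots> \<le> measure_pmf.expectation \<mu> (\<lambda>k. real k * x)"
  proof (rule integral_mono)
    show "integrable (measure_pmf \<mu>) (\<lambda>k. 1 - (1 - x) ^ k)"
      using assms by (intro Bochner_Integration.integrable_diff integrable_pgf) auto
    show "1 - (1 - x) ^ k \<le> real k * x" for k
      using Bernoulli_inequality[of "-x" k] assms by (simp add: algebra_simps)
  qed (use assms in auto)
  finally show ?thesis using assms by simp
qed

text \<open>The derivative of \<open>pgf\<close> at 1 is the mean, but without a second moment there
  is no quadratic remainder. Truncating the offspring number at N keeps the mean above m' and leaves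
  a remainder of at most N^2 x^2.\<close>

lemma one_minus_pgf_ge:
  assumes int: "integrable (measure_pmf \<mu>) real" and m': "m' < measure_pmf.expectation \<mu> real"
  obtains \<delta> where "0 < \<delta>" "\<delta> \<le> 1/2" "\<And>x. \<lbrakk>0 \<le> x; x \<le> \<delta>\<rbrakk> \<Longrightarrow> m' * x \<le> 1 - pgf \<mu> (1 - x)"
proof -
  define s where "s N k = (if k \<le> N then real k else 0)" for N k :: nat
  have "(\<lambda>N. measure_pmf.expectation \<mu> (s N)) \<longlonglongrightarrow> measure_pmf.expectation \<mu> real"
  proof (rule integral_dominated_convergence[where w = real])
    show "AE k in measure_pmf \<mu>. (\<lambda>N. s N k) \<longlonglongrightarrow> real k"
    proof (rule AE_I2)
      fix k
      have "\<forall>\<^sub>F N in sequentially. s N k = real k"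
        using eventually_ge_at_top[of k] by eventually_elim (auto simp: s_def)
      then show "(\<lambda>N. s N k) \<longlonglongrightarrow> real k" by (rule tendsto_eventually)
    qed
  qed (use int in \<open>auto simp: s_def\<close>)
  from order_tendstoD(1)[OF this m'] obtain N where N: "m' < measure_pmf.expectation \<mu> (s N)"
    by (auto simp: eventually_sequentially)
  define c where "c = measure_pmf.expectation \<mu> (s N) - m'"
  have c: "c > 0" using N by (simp add: c_def)
  \<comment> \<open>c is the spare mean, so N^2 x \<le> c for x \<le> \<delta>. The summand 1 covers
    N = 0; the cap 1/2 keeps 1 - x in range and, later, \<gamma> * \<delta> below 1.\<close>
  define \<delta> where "\<delta> = min (1/2) (c / (real N ^ 2 + 1))"
  have \<delta>: "0 < \<delta>" "\<delta> \<le> 1/2" using c by (auto simp: \<delta>_def add_nonneg_pos min_def)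
  have ints: "integrable (measure_pmf \<mu>) (s N)"
    by (rule measure_pmf.integrable_const_bound[where B = "real N"]) (auto simp: s_def)
  have "m' * x \<le> 1 - pgf \<mu> (1 - x)" if x: "0 \<le> x" "x \<le> \<delta>" for x
  proof -
    have x1: "x \<le> 1" using x \<delta> by linarith
    have key: "s N k * x - (real N)\<^sup>2 * x\<^sup>2 \<le> 1 - (1 - x) ^ k" for k
    proof (cases "k \<le> N")
      case True
      have "(1 - x) ^ k \<le> 1 - real k * x + (real k)\<^sup>2 * x\<^sup>2"
      proof (induction k)
        case (Suc k)
        have "(1 - x) ^ Suc k \<le> (1 - x) * (1 - real k * x + (real k)\<^sup>2 * x\<^sup>2)"
          using Suc x1 by (auto intro: mult_left_mono)
        also have "\<dots> = 1 - real (Suc k) * x + (real k + (real k)\<^sup>2) * x\<^sup>2 - (real k)\<^sup>2 * x ^ 3"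
          by (simp add: algebra_simps power2_eq_square power3_eq_cube)
        also have "\<dots> \<le> 1 - real (Suc k) * x + (real (Suc k))\<^sup>2 * x\<^sup>2"
        proof -
          have "(real k + (real k)\<^sup>2) * x\<^sup>2 \<le> (real (Suc k))\<^sup>2 * x\<^sup>2"
            by (rule mult_right_mono) (auto simp: power2_eq_square algebra_simps)
          moreover have "0 \<le> (real k)\<^sup>2 * x ^ 3" using x by simp
          ultimately show ?thesis by linarith
        qed
        finally show ?case .
      qed simp
      moreover have "(real k)\<^sup>2 * x\<^sup>2 \<le> (real N)\<^sup>2 * x\<^sup>2"
        using True by (intro mult_right_mono power_mono) auto
      ultimately show ?thesis using True by (simp add: s_def)
    next
      case False
      have "(1 - x) ^ k \<le> 1" using x x1 by (intro power_le_one) auto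
      moreover have "0 \<le> (real N)\<^sup>2 * x\<^sup>2" by simp
      ultimately have "0 \<le> 1 - (1 - x) ^ k + (real N)\<^sup>2 * x\<^sup>2" by linarith
      then show ?thesis using False by (simp add: s_def)
    qed
    have "m' * x = measure_pmf.expectation \<mu> (s N) * x - c * x"
      by (simp add: c_def algebra_simps)
    also have "\<dots> \<le> measure_pmf.expectation \<mu> (s N) * x - (real N)\<^sup>2 * x\<^sup>2"
    proof -
      have "(real N)\<^sup>2 * x \<le> (real N ^ 2 + 1) * \<delta>" using x by (intro mult_mono) auto
      also have "\<dots> \<le> (real N ^ 2 + 1) * (c / (real N ^ 2 + 1))"
        by (intro mult_left_mono) (auto simp: \<delta>_def)
      also have "\<dots> = c" using add_nonneg_pos[of "real N ^ 2" 1] by (simp add: field_simps)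
      finally have "(real N)\<^sup>2 * x * x \<le> c * x" using x by (intro mult_right_mono) auto
      then show ?thesis by (simp add: power2_eq_square mult.assoc)
    qed
    also have "\<dots> = measure_pmf.expectation \<mu> (\<lambda>k. s N k * x - (real N)\<^sup>2 * x\<^sup>2)"
      using ints by simp
    also have "\<dots> \<le> measure_pmf.expectation \<mu> (\<lambda>k. 1 - (1 - x) ^ k)"
      using ints x x1 key
      by (intro integral_mono Bochner_Integration.integrable_diff integrable_pgf) auto
    also have "\<dots> = 1 - pgf \<mu> (1 - x)"
      unfolding pgf_def using x x1 by (subst Bochner_Integration.integral_diff) (auto intro: integrable_pgf)
    finally show ?thesis .
  qed
  with \<delta> show ?thesis using that by blast
qed

lemma funpow_pgf_in_01: "\<lbrakk>0 \<le> r; r \<le> 1\<rbrakk> \<Longrightarrow> (pgf \<mu> ^^ j) r \<in> {0..1}"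
  by (induction j) (auto simp: pgf_nonneg pgf_le_one)

lemma funpow_pgf_mono: "\<lbrakk>0 \<le> r; r \<le> s; s \<le> 1\<rbrakk> \<Longrightarrow> (pgf \<mu> ^^ k) r \<le> (pgf \<mu> ^^ k) s"
proof (induction k)
  case (Suc k)
  then show ?case using funpow_pgf_in_01[of r k \<mu>] funpow_pgf_in_01[of s k \<mu>] by (auto intro: pgf_mono)
qed simp

text \<open>The function \<zeta> r = r (1 - r)^(-\<theta>) contracts by m'^(-\<theta>) under
  \<open>pgf \<mu>\<close>: close to 1 through its second factor, as 1 - r grows by the factor m',
  and elsewhere through its first factor, by \<open>pgf_le_strict\<close>. Since r \<le> \<zeta> r
  and \<zeta> (1 - q) \<le> q^(-\<theta>), the bound holds from j = 0 on and for all q at once, so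
  it can be integrated over a random q.\<close>

lemma pgf_iterate_decay:
  assumes mu0: "pmf \<mu> 0 = 0" and mu1: "pmf \<mu> 1 < 1"
    and int: "integrable (measure_pmf \<mu>) real"
    and m': "1 < m'" "m' < measure_pmf.expectation \<mu> real"
  obtains \<theta>\<^sub>0 where "0 < \<theta>\<^sub>0"
    "\<And>\<theta> j q. \<lbrakk>0 < \<theta>; \<theta> \<le> \<theta>\<^sub>0; 0 < q; q \<le> 1\<rbrakk>
        \<Longrightarrow> (pgf \<mu> ^^ j) (1 - q) \<le> (m' powr - \<theta>) ^ j * q powr - \<theta>"
proof -
  obtain \<delta> where \<delta>: "0 < \<delta>" "\<delta> \<le> 1/2" "\<And>x. \<lbrakk>0 \<le> x; x \<le> \<delta>\<rbrakk> \<Longrightarrow> m' * x \<le> 1 - pgf \<mu> (1 - x)"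
    using one_minus_pgf_ge[OF int m'(2)] by blast
  define \<gamma> where "\<gamma> = 1 - pmf \<mu> 1"
  have \<gamma>: "0 < \<gamma>" "\<gamma> \<le> 1" using mu1 by (auto simp: \<gamma>_def)
  have \<gamma>\<delta>: "0 < \<gamma> * \<delta>" "\<gamma> * \<delta> < 1"
    using \<gamma> \<delta> mult_mono[of \<gamma> 1 \<delta> "1/2"] by auto
  \<comment> \<open>Solves m'^(-\<theta>) = 1 - \<gamma> * \<delta>, so that for smaller \<theta>
    the contraction away from 1 is at least as strong as the one close to 1.\<close>
  define \<theta>\<^sub>0 where "\<theta>\<^sub>0 = - ln (1 - \<gamma> * \<delta>) / ln m'"
  have \<theta>\<^sub>0: "\<theta>\<^sub>0 > 0" using \<gamma>\<delta> m' by (auto simp: \<theta>\<^sub>0_def ln_less_zero intro!: divide_neg_pos)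
  have "(pgf \<mu> ^^ j) (1 - q) \<le> (m' powr - \<theta>) ^ j * q powr - \<theta>"
    if \<theta>: "0 < \<theta>" "\<theta> \<le> \<theta>\<^sub>0" and q: "0 < q" "q \<le> 1" for \<theta> j q
  proof -
    define \<zeta> where "\<zeta> r = r * (1 - r) powr - \<theta>" for r
    have low: "1 - \<gamma> * \<delta> \<le> m' powr - \<theta>"
    proof -
      have "\<theta> * ln m' \<le> \<theta>\<^sub>0 * ln m'" using \<theta> m' by (intro mult_right_mono) auto
      also have "\<dots> = - ln (1 - \<gamma> * \<delta>)" using m' by (simp add: \<theta>\<^sub>0_def)
      finally have "ln (1 - \<gamma> * \<delta>) \<le> - \<theta> * ln m'" by simp
      then have "exp (ln (1 - \<gamma> * \<delta>)) \<le> exp (- \<theta> * ln m')" by simp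
      then show ?thesis using \<gamma>\<delta> m' by (simp add: powr_def)
    qed
    have step: "\<zeta> (pgf \<mu> r) \<le> m' powr - \<theta> * \<zeta> r" if r: "0 \<le> r" "r < 1" for r
    proof (cases "1 - r \<le> \<delta>")
      case True
      have "m' * (1 - r) \<le> 1 - pgf \<mu> r" using \<delta>(3)[of "1 - r"] True r by simp
      then have "(1 - pgf \<mu> r) powr - \<theta> \<le> (m' * (1 - r)) powr - \<theta>"
        using \<theta> m' r by (intro powr_mono2') auto
      also have "\<dots> = m' powr - \<theta> * (1 - r) powr - \<theta>" using m' r by (simp add: powr_mult)
      finally have "\<zeta> (pgf \<mu> r) \<le> r * (m' powr - \<theta> * (1 - r) powr - \<theta>)"
        unfolding \<zeta>_def using pgf_le[OF mu0, of r] r by (intro mult_mono) (auto simp: pgf_nonneg)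
      then show ?thesis by (simp add: \<zeta>_def algebra_simps)
    next
      case False
      have "pgf \<mu> r \<le> r * (1 - \<gamma> * (1 - r))" using pgf_le_strict[OF mu0, of r] r by (simp add: \<gamma>_def)
      also have "\<dots> \<le> r * (1 - \<gamma> * \<delta>)"
        using r False \<gamma> by (intro mult_left_mono diff_left_mono) auto
      also have "\<dots> \<le> r * m' powr - \<theta>" using low r by (intro mult_left_mono)
      finally have 1: "pgf \<mu> r \<le> r * m' powr - \<theta>" .
      have "(1 - pgf \<mu> r) powr - \<theta> \<le> (1 - r) powr - \<theta>"
        using pgf_le[OF mu0, of r] r \<theta> by (intro powr_mono2') auto
      then have "\<zeta> (pgf \<mu> r) \<le> (r * m' powr - \<theta>) * (1 - r) powr - \<theta>"
        unfolding \<zeta>_def using 1 r by (intro mult_mono) auto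
      then show ?thesis by (simp add: \<zeta>_def algebra_simps)
    qed
    have "(pgf \<mu> ^^ j) (1 - q) \<in> {0..<1} \<and> \<zeta> ((pgf \<mu> ^^ j) (1 - q)) \<le> (m' powr - \<theta>) ^ j * q powr - \<theta>"
    proof (induction j)
      case 0
      then show ?case using q by (auto simp: \<zeta>_def mult_left_le_one_le)
    next
      case (Suc j)
      let ?r = "(pgf \<mu> ^^ j) (1 - q)"
      have r: "0 \<le> ?r" "?r < 1" using Suc by auto
      have "\<zeta> (pgf \<mu> ?r) \<le> m' powr - \<theta> * \<zeta> ?r" by (rule step[OF r])
      also have "\<dots> \<le> m' powr - \<theta> * ((m' powr - \<theta>) ^ j * q powr - \<theta>)"
        using Suc by (intro mult_left_mono) auto
      finally show ?case
        using r pgf_le[OF mu0, of ?r] pgf_nonneg[of ?r \<mu>] by (auto simp: algebra_simps)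
    qed
    moreover have "r \<le> \<zeta> r" if "r \<in> {0..<1}" for r
    proof -
      have "1 \<le> (1 - r) powr - \<theta>"
        using that \<theta> by (subst powr_minus) (auto simp: one_le_inverse_iff intro!: powr_le1)
      then show ?thesis using that mult_left_mono[of 1 "(1 - r) powr - \<theta>" r] by (simp add: \<zeta>_def)
    qed
    ultimately show ?thesis by fastforce
  qed
  with \<theta>\<^sub>0 show ?thesis using that by blast
qed

section \<open>One-step means and hitting times\<close>

text \<open>The mean of g over one step of the walk from x, where a walk at the root is in addition
killed with probability e / (e + \<kappa> []); for e = 0 this is the \<lambda>-biased walk, for
e = \<lambda> the walk seen from inside the subtree of a vertex other than the root.\<close>
definition step_mean :: "real \<Rightarrow> real \<Rightarrow> (nat list \<Rightarrow> nat) \<Rightarrow> (nat list \<Rightarrow> real) \<Rightarrow> nat list \<Rightarrow> real" where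
  "step_mean lam e \<kappa> g x =
     (if x = [] then (\<Sum>i<\<kappa> []. g [i]) / (e + real (\<kappa> []))
      else (lam * g (butlast x) + (\<Sum>i<\<kappa> x. g (x @ [i]))) / (lam + real (\<kappa> x)))"

text \<open>Required at all lists, not only at vertices of the tree: the environment gives a child
  count to every list, so the property still holds almost surely, and the recursions need not keep
  track of membership in the tree.\<close>

definition leafless :: "(nat list \<Rightarrow> nat) \<Rightarrow> bool" where
  "leafless \<kappa> \<longleftrightarrow> (\<forall>x. 1 \<le> \<kappa> x)"

definition subtree :: "nat list \<Rightarrow> (nat list \<Rightarrow> nat) \<Rightarrow> nat list \<Rightarrow> nat" where
  "subtree y \<kappa> w = \<kappa> (y @ w)"

lemma leafless_subtree: "leafless \<kappa> \<Longrightarrow> leafless (subtree y \<kappa>)"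
  by (simp add: leafless_def subtree_def)

lemma leaflessD: "leafless \<kappa> \<Longrightarrow> 0 < real (\<kappa> x)"
  by (simp add: leafless_def Suc_le_eq)

lemma subtree_Nil [simp]: "subtree [] \<kappa> = \<kappa>"
  by (simp add: subtree_def fun_eq_iff)

lemma subtree_subtree [simp]: "subtree z (subtree y \<kappa>) = subtree (y @ z) \<kappa>"
  by (simp add: subtree_def fun_eq_iff)

context
  fixes lam e :: real and \<kappa> :: "nat list \<Rightarrow> nat"
  assumes lam: "0 < lam" and e: "0 \<le> e" and leafless: "leafless \<kappa>"
begin

lemma denom_pos: "0 < e + real (\<kappa> x)" "0 < lam + real (\<kappa> x)"
  using leaflessD[OF leafless, of x] lam e by auto

lemma step_mean_mono:
  assumes "x \<noteq> [] \<Longrightarrow> g (butlast x) \<le> h (butlast x)" "\<And>i. i < \<kappa> x \<Longrightarrow> g (x @ [i]) \<le> h (x @ [i])"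
  shows "step_mean lam e \<kappa> g x \<le> step_mean lam e \<kappa> h x"
proof (cases "x = []")
  case True
  have "(\<Sum>i<\<kappa> []. g [i]) \<le> (\<Sum>i<\<kappa> []. h [i])"
    using assms(2) True by (intro sum_mono) auto
  then show ?thesis using True denom_pos[of "[]"] by (simp add: step_mean_def divide_right_mono)
next
  case False
  have "lam * g (butlast x) + (\<Sum>i<\<kappa> x. g (x @ [i])) \<le> lam * h (butlast x) + (\<Sum>i<\<kappa> x. h (x @ [i]))"
    using assms False lam by (intro add_mono sum_mono mult_left_mono) auto
  then show ?thesis using False denom_pos[of x] by (simp add: step_mean_def divide_right_mono)
qed

lemma step_mean_const_le: "0 \<le> c \<Longrightarrow> step_mean lam e \<kappa> (\<lambda>_. c) x \<le> c"
  using denom_pos[of x] lam e by (auto simp: step_mean_def field_simps)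

lemma step_mean_nonneg: "(\<And>y. 0 \<le> g y) \<Longrightarrow> 0 \<le> step_mean lam e \<kappa> g x"
  using step_mean_mono[where g = "\<lambda>_. 0" and h = g and x = x] by (simp add: step_mean_def split: if_splits)

lemma step_mean_le:
  assumes "0 \<le> c" "x \<noteq> [] \<Longrightarrow> g (butlast x) \<le> c" "\<And>i. i < \<kappa> x \<Longrightarrow> g (x @ [i]) \<le> c"
  shows "step_mean lam e \<kappa> g x \<le> c"
  by (rule order_trans[OF step_mean_mono[where h = "\<lambda>_. c"] step_mean_const_le]) (use assms in auto)

end

lemma step_mean_add:
  "step_mean lam e \<kappa> (\<lambda>y. a * g y + b * h y) x = a * step_mean lam e \<kappa> g x + b * step_mean lam e \<kappa> h x"
  by (simp add: step_mean_def sum.distrib sum_distrib_left add_divide_distrib algebra_simps)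

lemma step_mean_mult: "step_mean lam e \<kappa> (\<lambda>y. a * g y) x = a * step_mean lam e \<kappa> g x"
  using step_mean_add[of lam e \<kappa> a g 0 g x] by simp

lemma step_mean_const:
  assumes "0 < lam" "leafless \<kappa>" shows "step_mean lam 0 \<kappa> (\<lambda>_. c) x = c"
  using leaflessD[OF assms(2), of x] assms(1) by (auto simp: step_mean_def field_simps)

lemma step_mean_nonroot: "x \<noteq> [] \<Longrightarrow> step_mean lam e \<kappa> g x = step_mean lam e' \<kappa> g x"
  by (simp add: step_mean_def)

lemma step_mean_killed_le:
  assumes "0 < lam" "0 \<le> e" "leafless \<kappa>" "\<And>y. 0 \<le> g y"
  shows "step_mean lam e \<kappa> g x \<le> step_mean lam 0 \<kappa> g x"
  using assms leaflessD[OF assms(3), of x] by (auto simp: step_mean_def intro!: divide_left_mono sum_nonneg)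

text \<open>The root has at least one child, so the killing probability is at most \<lambda> / (1 +
  \<lambda>) and a start from the root loses at most a constant factor.\<close>

lemma step_mean_root_le:
  assumes "0 < lam" "leafless \<kappa>" "\<And>y. 0 \<le> g y"
  shows "step_mean lam 0 \<kappa> g [] \<le> (1 + lam) * step_mean lam lam \<kappa> g []"
proof -
  let ?k = "real (\<kappa> [])"
  have k: "1 \<le> ?k" using assms(2) by (simp add: leafless_def)
  have "(1 + lam) / (lam + ?k) \<ge> 1 / ?k"
    using k assms(1) mult_left_mono[of 1 ?k lam] by (simp add: field_simps)
  from mult_right_mono[OF this, of "\<Sum>i<\<kappa> []. g [i]"] show ?thesis
    using assms(3) by (simp add: step_mean_def sum_nonneg)
qed

text \<open>From inside the subtree of y, leaving the subtree is the same as being killed.\<close>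
lemma step_mean_subtree_le:
  assumes "0 < lam" "leafless \<kappa>" "\<And>y. 0 \<le> g y"
  shows "step_mean lam lam (subtree y \<kappa>) (\<lambda>x. g (y @ x)) x \<le> step_mean lam 0 \<kappa> g (y @ x)"
proof (cases "x = []")
  case False
  then show ?thesis by (simp add: step_mean_def subtree_def butlast_append)
next
  case True
  have k: "0 < real (\<kappa> y)" using leaflessD[OF assms(2)] .
  show ?thesis
  proof (cases "y = []")
    case True
    then show ?thesis using \<open>x = []\<close> step_mean_killed_le[OF assms(1) _ assms(2), where g = g and x = "[]" and e = lam] assms by simp
  next
    case False
    have "0 \<le> lam * g (butlast y)" using assms by simp
    then show ?thesis using False \<open>x = []\<close> k assms(1)
      by (auto simp: step_mean_def subtree_def intro!: divide_right_mono)
  qed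
qed

text \<open>With k \<ge> 1 children the chance to step away from the root is k / (d + k), where d
  \<le> \<lambda>; it is smallest for a single child and d = \<lambda>.\<close>

lemma step_mean_child_ge:
  assumes "0 < lam" "0 \<le> e" "e \<le> lam" "leafless \<kappa>" "0 \<le> c" "\<And>y. 0 \<le> g y" "\<And>i. i < \<kappa> x \<Longrightarrow> c \<le> g (x @ [i])"
  shows "c / (1 + lam) \<le> step_mean lam e \<kappa> g x"
proof -
  let ?k = "real (\<kappa> x)"
  have k: "1 \<le> ?k" using assms(4) by (simp add: leafless_def)
  have s: "?k * c \<le> (\<Sum>i<\<kappa> x. g (x @ [i]))"
    using sum_mono[of "{..<\<kappa> x}" "\<lambda>_. c" "\<lambda>i. g (x @ [i])"] assms(7) by simp
  have 1: "c / (1 + lam) \<le> ?k * c / (d + ?k)" if "0 \<le> d" "d \<le> lam" for d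
  proof -
    have "1 / (1 + lam) \<le> ?k / (d + ?k)"
      using k that assms(1) mult_mono[of d lam 1 ?k] by (simp add: field_simps)
    from mult_right_mono[OF this assms(5)] show ?thesis by simp
  qed
  show ?thesis
  proof (cases "x = []")
    case True
    have "?k * c / (e + ?k) \<le> step_mean lam e \<kappa> g x"
      using s True assms(2) k by (simp add: step_mean_def divide_right_mono)
    with 1[of e] assms show ?thesis by simp
  next
    case False
    have "0 \<le> lam * g (butlast x)" using assms by simp
    then have "?k * c / (lam + ?k) \<le> step_mean lam e \<kappa> g x"
      using s False assms(1) k by (simp add: step_mean_def divide_right_mono)
    with 1[of lam] assms show ?thesis by simp
  qed
qed

text \<open>hit_mean lam e w i c b \<kappa> t r x is the mean of w^\<sigma> b (r - \<sigma>) S_\<sigma>, where \<sigma>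
is the first time at level i of the walk started at x, and of w^t c if \<sigma> > t.\<close>
primrec hit_mean :: "real \<Rightarrow> real \<Rightarrow> real \<Rightarrow> nat \<Rightarrow> real \<Rightarrow> (nat \<Rightarrow> nat list \<Rightarrow> real) \<Rightarrow>
    (nat list \<Rightarrow> nat) \<Rightarrow> nat \<Rightarrow> nat \<Rightarrow> nat list \<Rightarrow> real" where
  "hit_mean lam e w i c b \<kappa> 0 = (\<lambda>r x. if length x = i then b r x else c)"
| "hit_mean lam e w i c b \<kappa> (Suc t) =
     (\<lambda>r x. if length x = i then b r x else w * step_mean lam e \<kappa> (hit_mean lam e w i c b \<kappa> t (r - 1)) x)"

lemma hit_mean_at [simp]: "length x = i \<Longrightarrow> hit_mean lam e w i c b \<kappa> t r x = b r x"
  by (cases t) auto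

text \<open>Linearity is needed jointly in the boundary data and in the value on failure: tangent
  lines are affine, and their constant part enters both.\<close>

lemma hit_mean_add:
  "hit_mean lam e w i (a * c + a' * c') (\<lambda>r x. a * b r x + a' * b' r x) \<kappa> t r x =
     a * hit_mean lam e w i c b \<kappa> t r x + a' * hit_mean lam e w i c' b' \<kappa> t r x"
proof (induction t arbitrary: r x)
  case (Suc t)
  have "hit_mean lam e w i (a * c + a' * c') (\<lambda>r x. a * b r x + a' * b' r x) \<kappa> t (r - 1) =
     (\<lambda>x. a * hit_mean lam e w i c b \<kappa> t (r - 1) x + a' * hit_mean lam e w i c' b' \<kappa> t (r - 1) x)"
    using Suc by blast
  then show ?case by (simp add: step_mean_add algebra_simps)
qed simp

lemma hit_mean_mono:
  assumes "0 < lam" "0 \<le> e" "leafless \<kappa>" "0 \<le> w" "c \<le> c'" "\<And>r x. length x = i \<Longrightarrow> b r x \<le> b' r x"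
  shows "hit_mean lam e w i c b \<kappa> t r x \<le> hit_mean lam e w i c' b' \<kappa> t r x"
  using assms(4-)
proof (induction t arbitrary: r x)
  case (Suc t)
  then show ?case by (auto intro!: mult_left_mono step_mean_mono[OF assms(1-3)])
qed auto

lemma hit_mean_zero: "hit_mean lam e w i 0 (\<lambda>_ _. 0) \<kappa> t r x = 0"
  using hit_mean_add[of lam e w i 0 0 0 0 "\<lambda>_ _. 0" "\<lambda>_ _. 0"] by simp

lemma hit_mean_nonneg:
  assumes "0 < lam" "0 \<le> e" "leafless \<kappa>" "0 \<le> w" "0 \<le> c" "\<And>r x. length x = i \<Longrightarrow> 0 \<le> b r x"
  shows "0 \<le> hit_mean lam e w i c b \<kappa> t r x"
  using hit_mean_mono[OF assms(1-5), of i "\<lambda>_ _. 0" b t r x] assms(6) by (simp add: hit_mean_zero)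

lemma hit_mean_le:
  assumes "0 < lam" "0 \<le> e" "leafless \<kappa>" "1 \<le> w" "0 \<le> c" "c \<le> d" "\<And>r x. length x = i \<Longrightarrow> b r x \<le> d"
  shows "hit_mean lam e w i c b \<kappa> t r x \<le> w ^ t * d"
  using assms(7)
proof (induction t arbitrary: r x)
  case (Suc t)
  have d: "0 \<le> d" using assms by linarith
  show ?case
  proof (cases "length x = i")
    case True
    then show ?thesis using Suc.prems[of x r] d assms(4) one_le_power[of w "Suc t"]
      mult_right_mono[of 1 "w ^ Suc t" d] by auto
  next
    case False
    have "step_mean lam e \<kappa> (hit_mean lam e w i c b \<kappa> t (r - 1)) x \<le> w ^ t * d"
      using Suc d assms by (intro step_mean_le) auto
    from mult_left_mono[OF this, of w] show ?thesis using False assms(4) by (simp add: mult.assoc)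
  qed
qed (use assms in auto)

text \<open>A straight path to level i costs at most a factor 1 + \<lambda> per step.\<close>
lemma hit_mean_straight:
  assumes "0 < lam" "0 \<le> e" "e \<le> lam" "leafless \<kappa>" "1 \<le> w" "0 \<le> d"
    "\<And>r x. length x = i \<Longrightarrow> d \<le> b r x" "length x \<le> i" "i \<le> t + length x"
  shows "d / (1 + lam) ^ (i - length x) \<le> hit_mean lam e w i 0 b \<kappa> t r x"
  using assms(8,9)
proof (induction t arbitrary: r x)
  case (Suc t)
  show ?case
  proof (cases "length x = i")
    case False
    then have l: "length x < i" using Suc.prems by simp
    then have s: "i - length x = Suc (i - Suc (length x))" by simp
    have n: "0 \<le> d / (1 + lam) ^ (i - Suc (length x))" using assms by simp
    have "d / (1 + lam) ^ (i - Suc (length x)) / (1 + lam)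
        \<le> step_mean lam e \<kappa> (hit_mean lam e w i 0 b \<kappa> t (r - 1)) x"
    proof (rule step_mean_child_ge[OF assms(1-4) n])
      show "0 \<le> hit_mean lam e w i 0 b \<kappa> t (r - 1) y" for y
        using assms by (intro hit_mean_nonneg) (auto intro: order_trans[OF assms(6)])
      show "d / (1 + lam) ^ (i - Suc (length x)) \<le> hit_mean lam e w i 0 b \<kappa> t (r - 1) (x @ [j])" for j
        using Suc.IH[of "x @ [j]" "r - 1"] Suc.prems l by simp
    qed
    moreover have "step_mean lam e \<kappa> (hit_mean lam e w i 0 b \<kappa> t (r - 1)) x \<le>
       w * step_mean lam e \<kappa> (hit_mean lam e w i 0 b \<kappa> t (r - 1)) x"
    proof -
      have "0 \<le> step_mean lam e \<kappa> (hit_mean lam e w i 0 b \<kappa> t (r - 1)) x"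
        by (intro step_mean_nonneg hit_mean_nonneg) (use assms in \<open>auto intro: order_trans[OF assms(6)]\<close>)
      from mult_right_mono[OF assms(5) this] show ?thesis by simp
    qed
    ultimately show ?thesis using False s by (simp add: mult.commute)
  qed (use assms in auto)
qed (use assms in auto)

text \<open>Jensen's inequality for y^(-\<theta>) under a measure of total mass A: if b has integral
  B, convexity at the mean B / A bounds B^(-\<theta>) by A^(-1-\<theta>) times the integral of
  b^(-\<theta>). Killing, truncation and weights make A differ from 1. The power -1-\<theta> is what
  leaves A^(-\<theta>) once independent boundary values have been integrated out.\<close>

lemma hit_mean_Jensen:
  assumes "0 < lam" "0 \<le> e" "leafless \<kappa>" "0 \<le> w" "0 < \<theta>"
    and b: "\<And>r x. length x = i \<Longrightarrow> 0 < b r x"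
    and pos: "0 < hit_mean lam e w i 0 (\<lambda>_ _. 1) \<kappa> t r x" "0 < hit_mean lam e w i 0 b \<kappa> t r x"
  shows "hit_mean lam e w i 0 b \<kappa> t r x powr - \<theta> \<le>
    hit_mean lam e w i 0 (\<lambda>_ _. 1) \<kappa> t r x powr (- 1 - \<theta>) * hit_mean lam e w i 0 (\<lambda>r x. b r x powr - \<theta>) \<kappa> t r x"
proof -
  define A where "A = hit_mean lam e w i 0 (\<lambda>_ _. 1) \<kappa> t r x"
  define B where "B = hit_mean lam e w i 0 b \<kappa> t r x"
  define \<tau> where "\<tau> = B / A"
  have AB: "0 < A" "0 < B" "0 < \<tau>" using pos by (auto simp: A_def B_def \<tau>_def)
  \<comment> \<open>The tangent of y^(-\<theta>) at \<tau>. After scaling by \<tau> it follows from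
    exp z \<ge> 1 + z at z = -\<theta> ln u and from ln u \<le> u - 1.\<close>
  have tangent: "(1 + \<theta>) * \<tau> powr - \<theta> + (- \<theta> * \<tau> powr (- \<theta> - 1)) * y \<le> y powr - \<theta>" if y: "0 < y" for y
  proof -
    let ?u = "y / \<tau>"
    have u: "0 < ?u" using y AB by simp
    have "?u powr - \<theta> \<ge> 1 + - \<theta> * ln ?u"
      using exp_ge_add_one_self[of "- \<theta> * ln ?u"] u y AB by (simp add: powr_def)
    moreover have "ln ?u \<le> ?u - 1" using u by (rule ln_le_minus_one)
    then have "\<theta> * ln ?u \<le> \<theta> * (?u - 1)" using assms(5) by simp
    ultimately have *: "1 + \<theta> - \<theta> * ?u \<le> ?u powr - \<theta>" by (simp add: algebra_simps)
    have "\<tau> powr - \<theta> * (1 + \<theta> - \<theta> * ?u) \<le> \<tau> powr - \<theta> * ?u powr - \<theta>"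
      using * by (intro mult_left_mono) auto
    also have "\<dots> = y powr - \<theta>" using y AB by (simp add: powr_divide)
    also have "\<tau> powr - \<theta> * (1 + \<theta> - \<theta> * ?u) = (1 + \<theta>) * \<tau> powr - \<theta> + (- \<theta> * \<tau> powr (- \<theta> - 1)) * y"
      using AB by (simp add: powr_diff algebra_simps)
    finally show ?thesis .
  qed
  have "(1 + \<theta>) * \<tau> powr - \<theta> * A + (- \<theta> * \<tau> powr (- \<theta> - 1)) * B =
     hit_mean lam e w i 0 (\<lambda>r x. ((1 + \<theta>) * \<tau> powr - \<theta>) * 1 + (- \<theta> * \<tau> powr (- \<theta> - 1)) * b r x) \<kappa> t r x"
    unfolding A_def B_def hit_mean_add[symmetric] by simp
  also have "\<dots> \<le> hit_mean lam e w i 0 (\<lambda>r x. b r x powr - \<theta>) \<kappa> t r x"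
    using b tangent by (intro hit_mean_mono[OF assms(1-4)]) auto
  finally have "(1 + \<theta>) * \<tau> powr - \<theta> * A + (- \<theta> * \<tau> powr (- \<theta> - 1)) * B
     \<le> hit_mean lam e w i 0 (\<lambda>r x. b r x powr - \<theta>) \<kappa> t r x" .
  moreover have "(- \<theta> * \<tau> powr (- \<theta> - 1)) * B = - \<theta> * \<tau> powr - \<theta> * A"
    using AB by (simp add: powr_diff) (simp add: \<tau>_def)
  ultimately have "(1 + \<theta>) * \<tau> powr - \<theta> * A + (- \<theta> * \<tau> powr - \<theta> * A)
     \<le> hit_mean lam e w i 0 (\<lambda>r x. b r x powr - \<theta>) \<kappa> t r x" by (simp only:)
  then have *: "\<tau> powr - \<theta> * A \<le> hit_mean lam e w i 0 (\<lambda>r x. b r x powr - \<theta>) \<kappa> t r x"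
    by (simp add: algebra_simps)
  have "B powr - \<theta> = A powr (- 1 - \<theta>) * (\<tau> powr - \<theta> * A)"
    using AB by (simp add: \<tau>_def powr_divide powr_diff powr_minus field_simps)
  also have "\<dots> \<le> A powr (- 1 - \<theta>) * hit_mean lam e w i 0 (\<lambda>r x. b r x powr - \<theta>) \<kappa> t r x"
    using * by (intro mult_left_mono) auto
  finally show ?thesis by (simp add: A_def B_def)
qed

lemma hit_mean_indep_time:
  "hit_mean lam e w i c (\<lambda>_. b) \<kappa> t r x = hit_mean lam e w i c (\<lambda>_. b) \<kappa> t r' x"
proof (induction t arbitrary: r r' x)
  case (Suc t)
  have "hit_mean lam e w i c (\<lambda>_. b) \<kappa> t (r - 1) = hit_mean lam e w i c (\<lambda>_. b) \<kappa> t (r' - 1)"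
    using Suc by blast
  then show ?case by simp
qed simp

section \<open>Positions and hitting probabilities of the plain and the killed walk\<close>

context
  fixes lam :: real and \<kappa> :: "nat list \<Rightarrow> nat"
  assumes lam: "0 < lam" and leafless: "leafless \<kappa>"
begin

text \<open>The probabilities, for the walk and for the walk killed when it leaves the root's subtree,
that level i is reached by time t from x.\<close>
definition "reach i t x = hit_mean lam 0 1 i 0 (\<lambda>_ _. 1) \<kappa> t 0 x"
definition "reach_killed i t x = hit_mean lam lam 1 i 0 (\<lambda>_ _. 1) \<kappa> t 0 x"
definition "walk_mean n g x = ((step_mean lam 0 \<kappa>) ^^ n) g x"

lemma reach_simps:
  "reach i 0 x = (if length x = i then 1 else 0)"
  "reach i (Suc t) x = (if length x = i then 1 else step_mean lam 0 \<kappa> (reach i t) x)"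
  by (simp_all add: reach_def[abs_def])

lemma reach_killed_simps:
  "reach_killed i 0 x = (if length x = i then 1 else 0)"
  "reach_killed i (Suc t) x = (if length x = i then 1 else step_mean lam lam \<kappa> (reach_killed i t) x)"
  by (simp_all add: reach_killed_def[abs_def])

lemma reach_bounds: "0 \<le> reach i t x" "reach i t x \<le> 1" "0 \<le> reach_killed i t x" "reach_killed i t x \<le> 1"
  using hit_mean_nonneg[of lam 0 \<kappa> 1 0 i "\<lambda>_ _. 1" t 0 x] hit_mean_le[of lam 0 \<kappa> 1 0 1 i "\<lambda>_ _. 1" t 0 x]
    hit_mean_nonneg[of lam lam \<kappa> 1 0 i "\<lambda>_ _. 1" t 0 x] hit_mean_le[of lam lam \<kappa> 1 0 1 i "\<lambda>_ _. 1" t 0 x]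
    lam leafless by (auto simp: reach_def reach_killed_def)

lemma walk_mean_simps: "walk_mean 0 g x = g x" "walk_mean (Suc n) g x = step_mean lam 0 \<kappa> (walk_mean n g) x"
  by (simp_all add: walk_mean_def[abs_def])

lemma walk_mean_Suc': "walk_mean (Suc n) g x = walk_mean n (step_mean lam 0 \<kappa> g) x"
  unfolding walk_mean_def by (simp add: funpow_swap1)

lemma step_mean_mono': "(\<And>y. g y \<le> h y) \<Longrightarrow> step_mean lam 0 \<kappa> g x \<le> step_mean lam 0 \<kappa> h x"
  using lam leafless by (intro step_mean_mono) auto

lemma walk_mean_mono: "(\<And>y. g y \<le> h y) \<Longrightarrow> walk_mean n g x \<le> walk_mean n h x"
  by (induction n arbitrary: x) (auto simp: walk_mean_simps intro: step_mean_mono')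

lemma walk_mean_const: "walk_mean n (\<lambda>_. c) x = c"
proof (induction n arbitrary: x)
  case (Suc n)
  then have "walk_mean n (\<lambda>_. c) = (\<lambda>_. c)" by blast
  then show ?case using step_mean_const[OF lam leafless] by (simp add: walk_mean_simps)
qed (simp add: walk_mean_simps)

lemma walk_mean_nonneg: "(\<And>y. 0 \<le> g y) \<Longrightarrow> 0 \<le> walk_mean n g x"
  using walk_mean_mono[of "\<lambda>_. 0" g n x] by (simp add: walk_mean_const)

lemma walk_mean_add: "walk_mean n (\<lambda>y. a * g y + b * h y) x = a * walk_mean n g x + b * walk_mean n h x"
proof (induction n arbitrary: x)
  case (Suc n)
  then have "walk_mean n (\<lambda>y. a * g y + b * h y) = (\<lambda>x. a * walk_mean n g x + b * walk_mean n h x)"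
    by blast
  then show ?case by (simp add: walk_mean_simps step_mean_add)
qed (simp add: walk_mean_simps)

text \<open>From a vertex of the tree the walk stays in the tree and gains at most one level per
  step. Some comparisons below are false at other lists, which is why they are restricted in this
  way.\<close>

lemma walk_mean_mono_tree:
  assumes "in_tree \<kappa> x" "\<And>y. in_tree \<kappa> y \<Longrightarrow> length y \<le> length x + n \<Longrightarrow> g y \<le> h y"
  shows "walk_mean n g x \<le> walk_mean n h x"
  using assms
proof (induction n arbitrary: x)
  case (Suc n)
  have 1: "in_tree \<kappa> (butlast x)"
    using Suc.prems(1) by (auto simp: in_tree_def nth_butlast take_butlast)
  have 2: "in_tree \<kappa> (x @ [i])" if "i < \<kappa> x" for i
    using Suc.prems(1) that by (auto simp: in_tree_def nth_append less_Suc_eq)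
  show ?case unfolding walk_mean_simps
    using lam leafless 1 2 by (intro step_mean_mono Suc.IH) (auto intro!: Suc.prems)
qed (auto simp: walk_mean_simps)

lemma reach_mono: "t \<le> t' \<Longrightarrow> reach i t x \<le> reach i t' x"
proof (induction t arbitrary: t' x)
  case (Suc t)
  then obtain s where "t' = Suc s" "t \<le> s" by (cases t') auto
  then show ?case using Suc.IH by (auto simp: reach_simps intro: step_mean_mono')
next
  case 0
  then show ?case using reach_bounds(1)[of i t' x] by (cases t') (auto simp: reach_simps)
qed

lemma reach_killed_mono: "t \<le> t' \<Longrightarrow> reach_killed i t x \<le> reach_killed i t' x"
proof (induction t arbitrary: t' x)
  case (Suc t)
  then obtain s where "t' = Suc s" "t \<le> s" by (cases t') auto
  then show ?case using Suc.IH lam leafless by (auto simp: reach_killed_simps intro!: step_mean_mono)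
next
  case 0
  then show ?case using reach_bounds(3)[of i t' x] by (cases t') (auto simp: reach_killed_simps)
qed

lemma reach_killed_le_reach: "reach_killed i t x \<le> reach i t x"
proof (induction t arbitrary: x)
  case (Suc t)
  have "step_mean lam lam \<kappa> (reach_killed i t) x \<le> step_mean lam 0 \<kappa> (reach_killed i t) x"
    using lam leafless by (intro step_mean_killed_le) (auto simp: reach_bounds)
  also have "\<dots> \<le> step_mean lam 0 \<kappa> (reach i t) x" using Suc by (intro step_mean_mono')
  finally show ?case by (simp add: reach_simps reach_killed_simps)
qed (simp add: reach_simps reach_killed_simps)

text \<open>Decompose at the first return to the root: before it the two walks agree, after it
level i has to be reached from the root.\<close>
lemma reach_le_killed_plus: "reach i t x \<le> reach_killed i t x + reach i t []"
proof (induction t arbitrary: x)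
  case (Suc t)
  show ?case
  proof (cases "x = [] \<or> length x = i")
    case True
    then show ?thesis using reach_bounds[of i "Suc t" "[]"] reach_bounds(3)[of i "Suc t" x]
      by (auto simp: reach_simps(2) reach_killed_simps(2))
  next
    case False
    then have "reach i (Suc t) x = step_mean lam 0 \<kappa> (reach i t) x" by (simp add: reach_simps)
    also have "\<dots> \<le> step_mean lam 0 \<kappa> (\<lambda>y. 1 * reach_killed i t y + 1 * reach i t []) x"
      using Suc by (intro step_mean_mono') simp
    also have "\<dots> = reach_killed i (Suc t) x + reach i t []"
      using False step_mean_const[OF lam leafless, of "reach i t []"] step_mean_nonroot[of x lam 0 \<kappa> "reach_killed i t" lam]
      unfolding step_mean_add by (simp add: reach_killed_simps)
    also have "\<dots> \<le> reach_killed i (Suc t) x + reach i (Suc t) []"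
      using reach_mono[of t "Suc t"] by simp
    finally show ?thesis .
  qed
qed (auto simp: reach_simps reach_killed_simps)

text \<open>Within t steps there are at most t departures from the root, and one of them must lead
  to level i without a return. The killed walk makes such an excursion up to the factor 1 +
  \<lambda>; the factor t is invisible on the exponential scale.\<close>

lemma reach_root_le:
  assumes "1 \<le> i"
  shows "reach i t [] \<le> (1 + lam) * real t * reach_killed i t []"
proof (induction t)
  case 0
  then show ?case using assms by (simp add: reach_simps)
next
  case (Suc t)
  have "reach i (Suc t) [] = step_mean lam 0 \<kappa> (reach i t) []" using assms by (simp add: reach_simps)
  also have "\<dots> \<le> step_mean lam 0 \<kappa> (\<lambda>y. 1 * reach_killed i t y + 1 * reach i t []) []"
    using reach_le_killed_plus by (intro step_mean_mono') simp
  also have "\<dots> = step_mean lam 0 \<kappa> (reach_killed i t) [] + reach i t []"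
    using step_mean_const[OF lam leafless, of "reach i t []"] unfolding step_mean_add by simp
  also have "step_mean lam 0 \<kappa> (reach_killed i t) [] \<le> (1 + lam) * step_mean lam lam \<kappa> (reach_killed i t) []"
    by (intro step_mean_root_le lam leafless reach_bounds)
  also have "step_mean lam lam \<kappa> (reach_killed i t) [] = reach_killed i (Suc t) []"
    using assms by (simp add: reach_killed_simps)
  also have "reach i t [] \<le> (1 + lam) * real t * reach_killed i (Suc t) []"
    using lam by (intro order_trans[OF Suc] mult_left_mono reach_killed_mono) auto
  finally show ?case by (simp add: algebra_simps)
qed

text \<open>Arrivals later than s carry weight at least M^s. Only these are kept, and their
  probability is the difference of two hitting probabilities.\<close>

lemma hit_mean_weighted_ge:
  assumes "1 \<le> M"
  shows "M ^ s * (reach_killed i T x - reach_killed i s x) \<le> hit_mean lam lam M i 0 (\<lambda>_ _. 1) \<kappa> T r x"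
proof (induction s arbitrary: T x r)
  case 0
  have "reach_killed i T x \<le> hit_mean lam lam M i 0 (\<lambda>_ _. 1) \<kappa> T r x" for T
  proof (induction T arbitrary: x r)
    case (Suc T)
    have "step_mean lam lam \<kappa> (reach_killed i T) x \<le> step_mean lam lam \<kappa> (hit_mean lam lam M i 0 (\<lambda>_ _. 1) \<kappa> T (r - 1)) x"
      using lam leafless Suc by (intro step_mean_mono) auto
    also have "\<dots> \<le> M * \<dots>"
      using assms lam leafless mult_right_mono[OF assms, of "step_mean lam lam \<kappa> (hit_mean lam lam M i 0 (\<lambda>_ _. 1) \<kappa> T (r - 1)) x"]
      by (simp add: step_mean_nonneg hit_mean_nonneg)
    finally show ?case by (auto simp: reach_killed_simps)
  qed (auto simp: reach_killed_simps)
  from this[of T] show ?case using reach_bounds(3)[of i 0 x] by simp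
next
  case (Suc s)
  have M: "0 \<le> M ^ k" for k using assms by simp
  show ?case
  proof (cases "length x = i")
    case True
    then show ?thesis using reach_killed_simps(2)[of i _ x] reach_killed_simps(1)[of i x] by (cases T) auto
  next
    case False
    show ?thesis
    proof (cases T)
      case 0
      then have "M ^ Suc s * (reach_killed i T x - reach_killed i (Suc s) x) \<le> 0"
        using False reach_bounds(3)[of i "Suc s" x] M[of "Suc s"]
        by (intro mult_nonneg_nonpos) (auto simp: reach_killed_simps(1))
      then show ?thesis using False 0 by simp
    next
      case (Suc T')
      let ?h = "hit_mean lam lam M i 0 (\<lambda>_ _. 1) \<kappa> T' (r - 1)"
      have "M ^ Suc s * (reach_killed i T x - reach_killed i (Suc s) x) =
         M * step_mean lam lam \<kappa> (\<lambda>y. M ^ s * reach_killed i T' y + (- (M ^ s)) * reach_killed i s y) x"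
        unfolding step_mean_add using False Suc by (simp add: reach_killed_simps algebra_simps)
      also have "\<dots> \<le> M * step_mean lam lam \<kappa> ?h x"
      proof (intro mult_left_mono step_mean_mono)
        have "M ^ s * reach_killed i T' y + - (M ^ s) * reach_killed i s y \<le> ?h y" for y
          using Suc.IH[of T' y "r - 1"] by (simp add: algebra_simps)
        then show "M ^ s * reach_killed i T' (butlast x) + - (M ^ s) * reach_killed i s (butlast x) \<le> ?h (butlast x)"
          "\<And>j. M ^ s * reach_killed i T' (x @ [j]) + - (M ^ s) * reach_killed i s (x @ [j]) \<le> ?h (x @ [j])" by blast+
      qed (use assms lam leafless in auto)
      finally show ?thesis using False Suc by simp
    qed
  qed
qed

text \<open>Union bound over the hitting time, when the walk certainly has height at least
  i.\<close>

lemma reach_le_sum: "reach i s x \<le> (\<Sum>t\<le>s. walk_mean t (\<lambda>y. if i \<le> length y then 1 else 0) x)"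
proof (induction s arbitrary: x)
  case (Suc s)
  let ?f = "\<lambda>y. if i \<le> length y then 1 else (0::real)"
  have nn: "0 \<le> walk_mean t ?f x" for t x by (intro walk_mean_nonneg) auto
  show ?case
  proof (cases "length x = i")
    case True
    then have "reach i (Suc s) x = walk_mean 0 ?f x" by (simp add: reach_simps walk_mean_simps)
    also have "\<dots> \<le> (\<Sum>t\<le>Suc s. walk_mean t ?f x)"
      by (intro member_le_sum nn) auto
    finally show ?thesis .
  next
    case False
    then have "reach i (Suc s) x = step_mean lam 0 \<kappa> (reach i s) x" by (simp add: reach_simps)
    also have "\<dots> \<le> step_mean lam 0 \<kappa> (\<lambda>x. \<Sum>t\<le>s. walk_mean t ?f x) x"
      using Suc by (intro step_mean_mono')
    also have "\<dots> = (\<Sum>t\<le>s. step_mean lam 0 \<kappa> (walk_mean t ?f) x)"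
    proof (induction s)
      case (Suc s)
      then show ?case
        using step_mean_add[of lam 0 \<kappa> 1 "\<lambda>x. \<Sum>t\<le>s. walk_mean t ?f x" 1 "walk_mean (Suc s) ?f" x] by simp
    qed simp
    also have "\<dots> = (\<Sum>t\<le>s. walk_mean (Suc t) ?f x)" by (simp add: walk_mean_simps)
    also have "\<dots> \<le> (\<Sum>t\<le>Suc s. walk_mean t ?f x)"
      using nn by (subst sum.atMost_Suc_shift) simp
    finally show ?thesis .
  qed
qed (auto simp: reach_simps walk_mean_simps)

lemma walk_mean_far:
  assumes "length x + t < i" shows "walk_mean t (\<lambda>y. if i \<le> length y then 1 else 0) x = 0"
  using assms
proof (induction t arbitrary: x)
  case (Suc t)
  let ?f = "walk_mean t (\<lambda>y. if i \<le> length y then 1 else (0::real))"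
  have "?f (butlast x) = 0" using Suc.prems by (intro Suc.IH) auto
  moreover have "?f (x @ [j]) = 0" for j using Suc.prems by (intro Suc.IH) auto
  ultimately show ?case by (cases x) (auto simp: walk_mean_simps step_mean_def)
qed (auto simp: walk_mean_simps)

lemma walk_mean_le_reach:
  assumes "length x \<le> i" shows "walk_mean t (\<lambda>y. if i \<le> length y then 1 else 0) x \<le> reach i t x"
  using assms
proof (induction t arbitrary: x)
  case (Suc t)
  show ?case
  proof (cases "length x = i")
    case True
    then have "reach i (Suc t) x = 1" by (simp add: reach_simps)
    moreover have "walk_mean (Suc t) (\<lambda>y. if i \<le> length y then 1 else 0) x \<le> walk_mean (Suc t) (\<lambda>_. 1) x"
      by (intro walk_mean_mono) auto
    ultimately show ?thesis by (simp add: walk_mean_const)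
  next
    case False
    then show ?thesis using Suc lam leafless by (auto simp: reach_simps walk_mean_simps intro!: step_mean_mono)
  qed
qed (auto simp: reach_simps walk_mean_simps)

lemma hit_mean_e0_const: "hit_mean lam 0 1 i d (\<lambda>_ _. d) \<kappa> t r x = d"
proof (induction t arbitrary: r x)
  case (Suc t)
  then have "hit_mean lam 0 1 i d (\<lambda>_ _. d) \<kappa> t (r - 1) = (\<lambda>_. d)" by blast
  then show ?case using step_mean_const[OF lam leafless] by simp
qed simp

text \<open>The failure part of a \<open>hit_mean\<close> with value 1 on failure: by linearity such
  a mean is the one with value 0 on failure plus this quantity.\<close>

definition "miss_level i t x = hit_mean lam 0 1 i 1 (\<lambda>_ _. 0) \<kappa> t 0 x"

lemma miss_level_simps:
  "miss_level i 0 x = (if length x = i then 0 else 1)"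
  "miss_level i (Suc t) x = (if length x = i then 0 else step_mean lam 0 \<kappa> (miss_level i t) x)"
  by (simp_all add: miss_level_def[abs_def])

lemma miss_level_reach: "miss_level i t x + reach i t x = 1"
  using hit_mean_add[of lam 0 1 i 1 1 1 0 "\<lambda>_ _. 0" "\<lambda>_ _. 1" \<kappa> t 0 x] hit_mean_e0_const[of i 1 t 0 x]
  by (simp add: miss_level_def reach_def)

text \<open>Every i steps the walk has a chance of at least (1 + \<lambda>)^(-i) to go straight to level i.\<close>
lemma miss_level_le:
  assumes "length x \<le> i"
  shows "miss_level i (k * i) x \<le> (1 - 1 / (1 + lam) ^ i) ^ k"
  using assms
proof (induction k arbitrary: x)
  case 0
  then show ?case by (simp add: miss_level_simps)
next
  case (Suc k)
  let ?q = "1 - 1 / (1 + lam) ^ i"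
  have q: "0 \<le> ?q" using lam by simp
  \<comment> \<open>Markov property at time s: a walk that has missed level i so far is still below
    it, and from there it misses again with probability at most B.\<close>
  have mult: "miss_level i (s + t) x \<le> B * miss_level i s x"
    if "\<And>y. length y \<le> i \<Longrightarrow> miss_level i t y \<le> B" "0 \<le> B" "length x \<le> i" for s t B x
    using that(3)
  proof (induction s arbitrary: x)
    case 0
    show ?case using that(1)[OF 0] 0 by (cases t) (auto simp: miss_level_simps)
  next
    case (Suc s)
    show ?case
    proof (cases "length x = i")
      case False
      then have "miss_level i (Suc s + t) x \<le> step_mean lam 0 \<kappa> (\<lambda>y. B * miss_level i s y) x"
        using Suc lam leafless by (auto simp: miss_level_simps intro!: step_mean_mono)
      then show ?thesis using False by (simp add: step_mean_mult miss_level_simps)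
    qed (simp add: miss_level_simps)
  qed
  have "miss_level i (Suc k * i) x \<le> ?q ^ k * miss_level i i x"
    using mult[of "k * i" "?q ^ k" x i] Suc q by simp
  also have "miss_level i i x \<le> ?q"
  proof -
    have "1 / (1 + lam) ^ i \<le> 1 / (1 + lam) ^ (i - length x)"
      using lam by (intro divide_left_mono power_increasing mult_pos_pos) auto
    also have "\<dots> \<le> reach i i x"
      unfolding reach_def using lam leafless Suc.prems by (intro hit_mean_straight) auto
    finally show ?thesis using miss_level_reach[of i i x] by simp
  qed
  finally show ?case using q by (simp add: mult_left_mono mult.commute[of ?q])
qed

end

section \<open>Recursions for the branching random walk\<close>

text \<open>The probability that no descendant in generation n of a particle at x has reached level L.\<close>
primrec miss_prob :: "nat pmf \<Rightarrow> real \<Rightarrow> (nat list \<Rightarrow> nat) \<Rightarrow> nat \<Rightarrow> nat \<Rightarrow> nat list \<Rightarrow> real" where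
  "miss_prob \<mu> lam \<kappa> L 0 = (\<lambda>x. if length x < L then 1 else 0)"
| "miss_prob \<mu> lam \<kappa> L (Suc n) = (\<lambda>x. pgf \<mu> (step_mean lam 0 \<kappa> (miss_prob \<mu> lam \<kappa> L n) x))"

text \<open>A lower bound for the probability that killed particles can be followed for K stages, each
of them climbing L0 levels in at most T0 generations. The bound linearises the branching mechanism,
which is why it is capped at a small level \<delta> before each stage.\<close>
primrec stage :: "real \<Rightarrow> real \<Rightarrow> nat \<Rightarrow> nat \<Rightarrow> real \<Rightarrow> nat \<Rightarrow> nat \<Rightarrow> (nat list \<Rightarrow> nat) \<Rightarrow> real" where
  "stage lam M T0 L0 \<delta> 0 = (\<lambda>r \<kappa>. 1)"
| "stage lam M T0 L0 \<delta> (Suc K) = (\<lambda>r \<kappa>. if r < T0 then 1 else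
     hit_mean lam lam M L0 0 (\<lambda>r z. min (stage lam M T0 L0 \<delta> K r (subtree z \<kappa>)) \<delta>) \<kappa> T0 r [])"

section \<open>Upper and lower bounds for the failure probability of the branching walk\<close>

context
  fixes lam :: real and \<kappa> :: "nat list \<Rightarrow> nat" and \<mu> :: "nat pmf"
  assumes lam: "0 < lam" and leafless: "leafless \<kappa>"
    and mu0: "pmf \<mu> 0 = 0" and int: "integrable (measure_pmf \<mu>) real"
begin

lemma step_mean_01:
  assumes "\<And>y. 0 \<le> g y" "\<And>y. g y \<le> 1" "0 \<le> e"
  shows "0 \<le> step_mean lam e \<kappa> g x" "step_mean lam e \<kappa> g x \<le> 1"
  using assms lam leafless by (auto intro!: step_mean_nonneg step_mean_le)

lemma miss_prob_bounds: "0 \<le> miss_prob \<mu> lam \<kappa> L n x" "miss_prob \<mu> lam \<kappa> L n x \<le> 1"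
proof (induction n arbitrary: x)
  case (Suc n)
  { case 1 show ?case using Suc step_mean_01[of "miss_prob \<mu> lam \<kappa> L n" 0] by (simp add: pgf_nonneg) }
  { case 2 show ?case using Suc step_mean_01[of "miss_prob \<mu> lam \<kappa> L n" 0] by (simp add: pgf_le_one) }
qed auto

lemma step_mean_miss:
  "step_mean lam 0 \<kappa> (\<lambda>y. 1 - miss_prob \<mu> lam \<kappa> L n y) x = 1 - step_mean lam 0 \<kappa> (miss_prob \<mu> lam \<kappa> L n) x"
  using step_mean_add[of lam 0 \<kappa> 1 "\<lambda>_. 1" "-1" "miss_prob \<mu> lam \<kappa> L n" x] step_mean_const[OF lam leafless, of 1 x]
  by simp

text \<open>A step loses at most one level, and the population does not die out because
  \<open>pgf \<mu> 0\<close> = 0.\<close>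

lemma miss_prob_near: "L + n \<le> length x \<Longrightarrow> miss_prob \<mu> lam \<kappa> L n x = 0"
proof (induction n arbitrary: x)
  case (Suc n)
  have "miss_prob \<mu> lam \<kappa> L n (butlast x) = 0" using Suc.prems by (intro Suc.IH) auto
  moreover have "miss_prob \<mu> lam \<kappa> L n (x @ [j]) = 0" for j using Suc.prems by (intro Suc.IH) auto
  ultimately have "step_mean lam 0 \<kappa> (miss_prob \<mu> lam \<kappa> L n) x = 0"
    by (cases x) (auto simp: step_mean_def)
  then show ?case using pgf_le[OF mu0, of 0] pgf_nonneg[of 0 \<mu>] by simp
qed auto

text \<open>First moment bound: some particle is high with at most the expected number of high
  particles, given by the many-to-one formula. In the recursion it comes from the tangent of
  \<open>pgf\<close> at 1.\<close>

lemma one_minus_miss_prob_le: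
  "1 - miss_prob \<mu> lam \<kappa> L n x \<le>
     measure_pmf.expectation \<mu> real ^ n * walk_mean lam \<kappa> n (\<lambda>y. if L \<le> length y then 1 else 0) x"
proof (induction n arbitrary: x)
  case 0
  then show ?case by (simp add: walk_mean_simps[OF lam leafless])
next
  case (Suc n)
  let ?m = "measure_pmf.expectation \<mu> real"
  have m: "0 \<le> ?m" by (rule integral_nonneg_AE) auto
  let ?u = "step_mean lam 0 \<kappa> (\<lambda>y. 1 - miss_prob \<mu> lam \<kappa> L n y) x"
  have u: "0 \<le> ?u" "?u \<le> 1" using miss_prob_bounds step_mean_01[of "\<lambda>y. 1 - miss_prob \<mu> lam \<kappa> L n y" 0] by auto
  have "1 - miss_prob \<mu> lam \<kappa> L (Suc n) x = 1 - pgf \<mu> (1 - ?u)" unfolding step_mean_miss by simp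
  also have "\<dots> \<le> ?m * ?u" by (rule one_minus_pgf_le[OF int u])
  also have "\<dots> \<le> ?m * step_mean lam 0 \<kappa> (\<lambda>y. ?m ^ n * walk_mean lam \<kappa> n (\<lambda>y. if L \<le> length y then 1 else 0) y) x"
    using Suc m by (intro mult_left_mono step_mean_mono'[OF lam leafless]) auto
  finally show ?case by (simp add: step_mean_mult walk_mean_simps[OF lam leafless])
qed

text \<open>Jensen's inequality for the convex \<open>pgf\<close> under the hitting law. Without
  killing and with weight 1 this law has mass 1, and the value 1 on failure is a fixed point of
  \<open>pgf\<close>.\<close>

lemma pgf_hit_mean_le:
  assumes "\<And>r z. length z = i \<Longrightarrow> 0 \<le> b r z" "\<And>r z. length z = i \<Longrightarrow> b r z \<le> 1"
  shows "pgf \<mu> (hit_mean lam 0 1 i 1 b \<kappa> t r x) \<le> hit_mean lam 0 1 i 1 (\<lambda>r z. pgf \<mu> (b r z)) \<kappa> t r x"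
proof -
  define h where "h = hit_mean lam 0 1 i 1 b \<kappa> t r x"
  have h: "0 \<le> h" "h \<le> 1"
    using assms lam leafless hit_mean_le[of lam 0 \<kappa> 1 1 1 i b t r x]
    by (auto simp: h_def intro!: hit_mean_nonneg)
  obtain s where s: "\<And>r. \<lbrakk>0 \<le> r; r \<le> 1\<rbrakk> \<Longrightarrow> pgf \<mu> h + s * (r - h) \<le> pgf \<mu> r"
    using pgf_tangent[OF int h] by blast
  have "pgf \<mu> h = (pgf \<mu> h - s * h) * hit_mean lam 0 1 i 1 (\<lambda>_ _. 1) \<kappa> t r x + s * h"
    by (simp add: hit_mean_e0_const[OF lam leafless])
  also have "\<dots> = hit_mean lam 0 1 i ((pgf \<mu> h - s * h) * 1 + s * 1) (\<lambda>r z. (pgf \<mu> h - s * h) * 1 + s * b r z) \<kappa> t r x"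
    unfolding hit_mean_add by (simp add: h_def)
  also have "\<dots> \<le> hit_mean lam 0 1 i 1 (\<lambda>r z. pgf \<mu> (b r z)) \<kappa> t r x"
  proof (rule hit_mean_mono[OF lam _ leafless])
    show "(pgf \<mu> h - s * h) * 1 + s * 1 \<le> 1" using s[of 1] by (simp add: algebra_simps)
    show "(pgf \<mu> h - s * h) * 1 + s * b r z \<le> pgf \<mu> (b r z)" if "length z = i" for r z
      using s[of "b r z"] assms that by (simp add: algebra_simps)
  qed auto
  finally show ?thesis by (simp add: h_def)
qed

lemma pgf_step_mean_le:
  assumes "\<And>y. 0 \<le> g y" "\<And>y. g y \<le> 1"
  shows "pgf \<mu> (step_mean lam 0 \<kappa> g x) \<le> step_mean lam 0 \<kappa> (\<lambda>y. pgf \<mu> (g y)) x"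
proof -
  define h where "h = step_mean lam 0 \<kappa> g x"
  have h: "0 \<le> h" "h \<le> 1" using step_mean_01[of g 0 x] assms by (auto simp: h_def)
  obtain s where s: "\<And>r. \<lbrakk>0 \<le> r; r \<le> 1\<rbrakk> \<Longrightarrow> pgf \<mu> h + s * (r - h) \<le> pgf \<mu> r"
    using pgf_tangent[OF int h] by blast
  have "pgf \<mu> h = step_mean lam 0 \<kappa> (\<lambda>y. (pgf \<mu> h - s * h) * 1 + s * g y) x"
    unfolding step_mean_add step_mean_const[OF lam leafless] by (simp add: h_def)
  also have "\<dots> \<le> step_mean lam 0 \<kappa> (\<lambda>y. pgf \<mu> (g y)) x"
  proof (rule step_mean_mono'[OF lam leafless])
    show "(pgf \<mu> h - s * h) * 1 + s * g y \<le> pgf \<mu> (g y)" for y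
      using s[of "g y"] assms by (simp add: algebra_simps)
  qed
  finally show ?thesis by (simp add: h_def)
qed

lemma funpow_pgf_step_mean_le:
  assumes "\<And>y. 0 \<le> g y" "\<And>y. g y \<le> 1"
  shows "(pgf \<mu> ^^ k) (step_mean lam 0 \<kappa> g x) \<le> step_mean lam 0 \<kappa> (\<lambda>y. (pgf \<mu> ^^ k) (g y)) x"
proof (induction k)
  case (Suc k)
  have b: "0 \<le> (pgf \<mu> ^^ k) (g y)" "(pgf \<mu> ^^ k) (g y) \<le> 1" for y
    using funpow_pgf_in_01[of "g y" k \<mu>] assms by auto
  have c: "0 \<le> (pgf \<mu> ^^ k) (step_mean lam 0 \<kappa> g x)"
    using funpow_pgf_in_01[of "step_mean lam 0 \<kappa> g x" k \<mu>] step_mean_01[of g 0 x] assms by auto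
  have "(pgf \<mu> ^^ Suc k) (step_mean lam 0 \<kappa> g x) \<le> pgf \<mu> (step_mean lam 0 \<kappa> (\<lambda>y. (pgf \<mu> ^^ k) (g y)) x)"
    using Suc b c step_mean_01[of "\<lambda>y. (pgf \<mu> ^^ k) (g y)" 0] by (auto intro: pgf_mono)
  also have "\<dots> \<le> step_mean lam 0 \<kappa> (\<lambda>y. (pgf \<mu> ^^ Suc k) (g y)) x"
    using pgf_step_mean_le[of "\<lambda>y. (pgf \<mu> ^^ k) (g y)" x] b by simp
  finally show ?case .
qed simp

text \<open>By Jensen's inequality the j generations may first be spent on branching in place
and then on walking.\<close>
lemma miss_prob_le_walk_mean:
  "miss_prob \<mu> lam \<kappa> L (j + n) x \<le> walk_mean lam \<kappa> j (\<lambda>y. (pgf \<mu> ^^ j) (miss_prob \<mu> lam \<kappa> L n y)) x"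
proof (induction j arbitrary: n)
  case 0
  then show ?case by (simp add: walk_mean_simps[OF lam leafless])
next
  case (Suc j)
  have "miss_prob \<mu> lam \<kappa> L (Suc j + n) x \<le> walk_mean lam \<kappa> j (\<lambda>y. (pgf \<mu> ^^ j) (miss_prob \<mu> lam \<kappa> L (Suc n) y)) x"
    using Suc[of "Suc n"] by simp
  also have "\<dots> = walk_mean lam \<kappa> j (\<lambda>y. (pgf \<mu> ^^ Suc j) (step_mean lam 0 \<kappa> (miss_prob \<mu> lam \<kappa> L n) y)) x"
    by (simp add: funpow_swap1)
  also have "\<dots> \<le> walk_mean lam \<kappa> j (step_mean lam 0 \<kappa> (\<lambda>y. (pgf \<mu> ^^ Suc j) (miss_prob \<mu> lam \<kappa> L n y))) x"
    by (intro walk_mean_mono[OF lam leafless] funpow_pgf_step_mean_le miss_prob_bounds)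
  finally show ?case by (simp add: walk_mean_Suc'[OF lam leafless])
qed

text \<open>A walk from x needs at least i - |x| steps to reach level i, and the population branches
  at each of them. Jensen's inequality postpones this branching to the hitting place, at the
  entrance of a subtree not seen before. Walks that miss level i are counted as failures.\<close>

lemma miss_prob_le_hit_mean:
  assumes "length x \<le> i" "t \<le> n"
  shows "miss_prob \<mu> lam \<kappa> L n x \<le>
    hit_mean lam 0 1 i 1 (\<lambda>r z. (pgf \<mu> ^^ (i - length x)) (miss_prob \<mu> lam \<kappa> L r z)) \<kappa> t n x"
  using assms
proof (induction t arbitrary: x n)
  case 0
  then show ?case using miss_prob_bounds by simp
next
  case (Suc t)
  show ?case
  proof (cases "length x = i")
    case False
    then have l: "length x < i" using Suc.prems by simp
    obtain n' where n: "n = Suc n'" "t \<le> n'" using Suc.prems by (cases n) auto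
    let ?f = "miss_prob \<mu> lam \<kappa> L"
    let ?H = "\<lambda>k. hit_mean lam 0 1 i 1 (\<lambda>r z. (pgf \<mu> ^^ k) (?f r z)) \<kappa> t n'"
    have b: "0 \<le> (pgf \<mu> ^^ k) (?f r z)" "(pgf \<mu> ^^ k) (?f r z) \<le> 1" for k r z
      using funpow_pgf_in_01[of "?f r z" k \<mu>] miss_prob_bounds by auto
    have H: "0 \<le> ?H k y" "?H k y \<le> 1" for k y
      using hit_mean_le[of lam 0 \<kappa> 1 1 1 i "\<lambda>r z. (pgf \<mu> ^^ k) (?f r z)" t n' y] b lam leafless
      by (auto intro!: hit_mean_nonneg)
    have nbr: "pgf \<mu> (?f n' y) \<le> ?H (i - length x) y" if y: "length y \<le> Suc (length x)" for y
    proof -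
      have "pgf \<mu> (?f n' y) \<le> pgf \<mu> (?H (i - length y) y)"
        using Suc.IH[of y n'] n(2) y l miss_prob_bounds H by (intro pgf_mono) auto
      also have "\<dots> \<le> ?H (Suc (i - length y)) y"
        using pgf_hit_mean_le[of i "\<lambda>r z. (pgf \<mu> ^^ (i - length y)) (?f r z)" t n' y] b by simp
      also have "\<dots> \<le> ?H (i - length x) y"
      proof (intro hit_mean_mono[OF lam _ leafless])
        fix r z
        \<comment> \<open>A neighbour closer to the root is one level further from i and supplies
          two iterates too many. Surplus iterates may be dropped, since \<open>pgf\<close> lies
          below the identity.\<close>
        have "i - length x \<le> Suc (i - length y)" using y l by simp
        then show "(pgf \<mu> ^^ Suc (i - length y)) (?f r z) \<le> (pgf \<mu> ^^ (i - length x)) (?f r z)"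
        proof (induction rule: dec_induct)
          case (step m)
          have "(pgf \<mu> ^^ Suc m) (?f r z) \<le> (pgf \<mu> ^^ m) (?f r z)"
            using b[of m r z] pgf_le[OF mu0] by simp
          then show ?case using step by linarith
        qed simp
      qed auto
      finally show ?thesis .
    qed
    have "?f n x = pgf \<mu> (step_mean lam 0 \<kappa> (?f n') x)" by (simp add: n)
    also have "\<dots> \<le> step_mean lam 0 \<kappa> (\<lambda>y. pgf \<mu> (?f n' y)) x"
      by (intro pgf_step_mean_le miss_prob_bounds)
    also have "\<dots> \<le> step_mean lam 0 \<kappa> (?H (i - length x)) x"
      using nbr by (intro step_mean_mono[OF lam _ leafless]) auto
    finally show ?thesis using False n by simp
  qed simp
qed

lemma stage_nonneg:
  assumes "0 \<le> M" "0 \<le> \<delta>" "leafless \<kappa>'"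
  shows "0 \<le> stage lam M T0 L0 \<delta> K r \<kappa>'"
  using assms(3)
proof (induction K arbitrary: r \<kappa>')
  case (Suc K)
  have "0 \<le> stage lam M T0 L0 \<delta> K r (subtree z \<kappa>')" for r z
    using Suc leafless_subtree by blast
  then show ?case using Suc.prems assms lam by (auto intro!: hit_mean_nonneg)
qed simp

text \<open>Below \<delta>' the branching step x to 1 - pgf (1 - x) dominates multiplication by M *
  d. M is the weight per generation inside a stage; d \<le> 1 compensates where M alone exceeds what
  the branching affords, hence the factor d^n. The last hypothesis says that n generations suffice
  at speed L0 / T0; its slack T0 + L0 pays for the final incomplete stage. Each stage consumes at
  least one generation, so K \<ge> n stages never run out.\<close>

lemma stage_le_hit_prob:
  assumes M: "1 \<le> M" and d: "0 < d" "d \<le> 1" and L0: "1 \<le> L0" "L0 \<le> T0"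
    and \<delta>: "0 < \<delta>" "M ^ T0 * \<delta> \<le> \<delta>'" "\<delta>' \<le> 1"
      "\<And>x. \<lbrakk>0 \<le> x; x \<le> \<delta>'\<rbrakk> \<Longrightarrow> M * d * x \<le> 1 - pgf \<mu> (1 - x)"
    and n: "n \<le> K" "real L + real T0 + real L0 \<le> real (length y) + real n * (real L0 / real T0)"
  shows "d ^ n * stage lam M T0 L0 \<delta> K n (subtree y \<kappa>) \<le> 1 - miss_prob \<mu> lam \<kappa> L n y"
  using n
proof (induction K arbitrary: n y)
  case 0
  then have "real (L + n) \<le> real (length y)" using L0 by simp
  then have "L + n \<le> length y" by linarith
  then show ?case using 0 miss_prob_near[of L n y] by simp
next
  case (Suc K)
  note IH = Suc.IH
  let ?s = "real L0 / real T0"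
  show ?case
  proof (cases "n < T0")
    case True
    \<comment> \<open>Fewer than T0 generations remain; the slack T0 keeps even particles that lose
      a level in each of them above L.\<close>
    have "real n * ?s \<le> real T0 * ?s" using True by (intro mult_right_mono) auto
    also have "\<dots> = real L0" using L0 by simp
    finally have "real L + real T0 \<le> real (length y)" using Suc.prems by simp
    then have "L + n \<le> length y" using True by linarith
    then have "miss_prob \<mu> lam \<kappa> L n y = 0" by (rule miss_prob_near)
    then show ?thesis using True d by (simp add: power_le_one)
  next
    case False
    let ?b = "\<lambda>r z. min (stage lam M T0 L0 \<delta> K r (subtree (y @ z) \<kappa>)) \<delta>"
    let ?h = "hit_mean lam lam M L0 0 ?b (subtree y \<kappa>)"
    have b: "0 \<le> ?b r z" "?b r z \<le> \<delta>" for r z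
      using stage_nonneg[of M \<delta>] M \<delta> leafless_subtree[OF leafless] by auto
    have lfy: "leafless (subtree y \<kappa>)" by (rule leafless_subtree[OF leafless])
    \<comment> \<open>Induction over the time t left in the current stage. The difference n' - t,
      the generations left if the stage uses up its time, is constant along the walk and carries the
      speed condition. Since L0 \<ge> 1, an arrival is preceded by a step; this gives n' \<le> K
      there and makes the outer induction hypothesis applicable.\<close>
    have claim: "d ^ n' * ?h t n' x \<le> 1 - miss_prob \<mu> lam \<kappa> L n' (y @ x)"
      if "t \<le> n'" "t \<le> T0" "n' \<le> Suc K" "length x = L0 \<Longrightarrow> n' \<le> K"
        "real L + real T0 + real L0 \<le> real (length y) + real L0 + real (n' - t) * ?s" for t n' x
      using that
    proof (induction t arbitrary: n' x)
      case 0
      have hit: "d ^ n' * ?b n' x \<le> 1 - miss_prob \<mu> lam \<kappa> L n' (y @ x)" if "length x = L0"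
      proof -
        have "d ^ n' * ?b n' x \<le> d ^ n' * stage lam M T0 L0 \<delta> K n' (subtree (y @ x) \<kappa>)"
          using d by (intro mult_left_mono) auto
        also have "\<dots> \<le> 1 - miss_prob \<mu> lam \<kappa> L n' (y @ x)"
          using 0 that by (intro IH) auto
        finally show ?thesis .
      qed
      then show ?case using miss_prob_bounds(2)[of L n' "y @ x"] by simp
    next
      case (Suc t)
      show ?case
      proof (cases "length x = L0")
        case True
        have "d ^ n' * ?b n' x \<le> d ^ n' * stage lam M T0 L0 \<delta> K n' (subtree (y @ x) \<kappa>)"
          using d by (intro mult_left_mono) auto
        also have "\<dots> \<le> 1 - miss_prob \<mu> lam \<kappa> L n' (y @ x)"
        proof (rule IH)
          have "real (n' - Suc t) * ?s \<le> real n' * ?s" by (intro mult_right_mono) auto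
          then show "real L + real T0 + real L0 \<le> real (length (y @ x)) + real n' * ?s"
            using Suc.prems(5) True by simp
        qed (use Suc.prems True in auto)
        finally show ?thesis using True by simp
      next
        case False
        obtain n'' where n'': "n' = Suc n''" "t \<le> n''" using Suc.prems(1) by (cases n') auto
        let ?A = "\<lambda>z. 1 - miss_prob \<mu> lam \<kappa> L n'' z"
        define s where "s = step_mean lam lam (subtree y \<kappa>) (?h t n'') x"
        define u where "u = step_mean lam 0 \<kappa> ?A (y @ x)"
        have A: "0 \<le> ?A z" "?A z \<le> 1" for z using miss_prob_bounds by auto
        have u: "0 \<le> u" "u \<le> 1" using step_mean_01[of ?A 0 "y @ x"] A by (auto simp: u_def)
        \<comment> \<open>The cap \<delta> on the boundary values keeps every weighted mean of the
          stage in the range where the branching was linearised.\<close>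
        have "?h t n'' z \<le> M ^ t * \<delta>" for z
          using b \<delta> M lam lfy by (intro hit_mean_le) auto
        also have "M ^ t * \<delta> \<le> M ^ T0 * \<delta>"
          using M \<delta> Suc.prems by (intro mult_right_mono power_increasing) auto
        finally have "?h t n'' z \<le> \<delta>'" for z using \<delta> by (meson order_trans)
        moreover have h0: "0 \<le> ?h t n'' z" for z using b M lam lfy by (intro hit_mean_nonneg) auto
        ultimately have s: "0 \<le> s" "s \<le> \<delta>'"
          using lam lfy order_trans[of 0 "M ^ T0 * \<delta>" \<delta>'] M \<delta> by (auto simp: s_def intro!: step_mean_nonneg step_mean_le)
        have x0: "0 \<le> d ^ n'' * s" "d ^ n'' * s \<le> \<delta>'"
          using s d mult_mono[of "d ^ n''" 1 s \<delta>'] by (auto simp: power_le_one)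
        have "d ^ n'' * s = step_mean lam lam (subtree y \<kappa>) (\<lambda>z. d ^ n'' * ?h t n'' z) x"
          by (simp add: s_def step_mean_mult)
        also have "\<dots> \<le> step_mean lam lam (subtree y \<kappa>) (\<lambda>z. ?A (y @ z)) x"
        proof -
          have "d ^ n'' * ?h t n'' z \<le> ?A (y @ z)" for z
            using Suc.prems n'' by (intro Suc.IH) auto
          then show ?thesis using lam lfy by (intro step_mean_mono) auto
        qed
        also have "\<dots> \<le> u" unfolding u_def by (intro step_mean_subtree_le lam leafless A)
        finally have "d ^ n'' * s \<le> u" .
        have "d ^ n' * ?h (Suc t) n' x = M * d * (d ^ n'' * s)"
          using False n'' by (simp add: s_def)
        also have "\<dots> \<le> 1 - pgf \<mu> (1 - d ^ n'' * s)" by (rule \<delta>(4)[OF x0])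
        also have "\<dots> \<le> 1 - pgf \<mu> (1 - u)"
          using \<open>d ^ n'' * s \<le> u\<close> u x0 by (intro diff_left_mono pgf_mono) auto
        also have "\<dots> = 1 - miss_prob \<mu> lam \<kappa> L n' (y @ x)"
          unfolding u_def step_mean_miss by (simp add: n'')
        finally show ?thesis .
      qed
    qed
    have "real (n - T0) * ?s = real n * ?s - real L0"
      using False L0 by (simp add: of_nat_diff left_diff_distrib diff_divide_distrib)
    then have "d ^ n * ?h T0 n [] \<le> 1 - miss_prob \<mu> lam \<kappa> L n (y @ [])"
      using False Suc.prems L0 by (intro claim) auto
    then show ?thesis using False by simp
  qed
qed

end

section \<open>Independent subtrees of the environment\<close>

text \<open>Dependence on the coordinates in A j is expressed by agreement of values, which is
  easily checked for recursively defined functions. To apply independence of restrictions, F j is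
  composed with an extension by fixed default values outside A j, which leaves it unchanged by that
  very hypothesis.\<close>

lemma nn_integral_prod_disjoint_coordinates:
  fixes M :: "'i \<Rightarrow> 'a measure" and F :: "'j \<Rightarrow> ('i \<Rightarrow> 'a) \<Rightarrow> ennreal"
  assumes prob: "\<And>i. prob_space (M i)" and J: "finite J" "disjoint_family_on A J"
    and meas: "\<And>j. j \<in> J \<Longrightarrow> F j \<in> borel_measurable (PiM UNIV M)"
    and dep: "\<And>j \<omega> \<omega>'. \<lbrakk>j \<in> J; \<And>i. i \<in> A j \<Longrightarrow> \<omega> i = \<omega>' i\<rbrakk> \<Longrightarrow> F j \<omega> = F j \<omega>'"
  shows "(\<integral>\<^sup>+\<omega>. (\<Prod>j\<in>J. F j \<omega>) \<partial>PiM UNIV M) = (\<Prod>j\<in>J. \<integral>\<^sup>+\<omega>. F j \<omega> \<partial>PiM UNIV M)"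
proof -
  interpret P: prob_space "PiM UNIV M" by (rule prob_space_PiM[OF prob])
  have comp: "distr (PiM UNIV M) (M i) (\<lambda>\<omega>. \<omega> i) = M i" for i
    by (rule distr_PiM_component) (auto intro: prob)
  have "P.indep_vars M (\<lambda>i \<omega>. \<omega> i) UNIV"
    by (subst P.indep_vars_iff_distr_eq_PiM') (simp_all add: comp restrict_UNIV)
  then have restr: "P.indep_vars (\<lambda>j. PiM (A j) M) (\<lambda>j \<omega>. \<lambda>i\<in>A j. \<omega> i) J"
    by (rule P.indep_vars_restrict) (use J in auto)
  define d where "d i = (SOME x. x \<in> space (M i))" for i
  have d: "d i \<in> space (M i)" for i
    unfolding d_def by (rule someI_ex) (use prob_space.not_empty[OF prob] in blast)
  define g where "g j \<rho> = F j (\<lambda>i. if i \<in> A j then \<rho> i else d i)" for j \<rho>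
  have "(\<lambda>\<rho> i. if i \<in> A j then \<rho> i else d i) \<in> PiM (A j) M \<rightarrow>\<^sub>M PiM UNIV M" for j
  proof (rule measurable_PiM_single')
    show "(\<lambda>\<rho>. if i \<in> A j then \<rho> i else d i) \<in> PiM (A j) M \<rightarrow>\<^sub>M M i" for i
      by (cases "i \<in> A j") (use d in auto)
  qed (use d in \<open>auto simp: space_PiM PiE_def\<close>)
  then have "g j \<in> borel_measurable (PiM (A j) M)" if "j \<in> J" for j
    unfolding g_def by (rule measurable_compose[OF _ meas[OF that]])
  then have "P.indep_vars (\<lambda>_. borel) (\<lambda>j \<omega>. g j (\<lambda>i\<in>A j. \<omega> i)) J"
    by (intro P.indep_vars_compose2[OF restr]) auto
  from P.indep_vars_nn_integral[OF J(1) this]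
  have "(\<integral>\<^sup>+\<omega>. (\<Prod>j\<in>J. g j (\<lambda>i\<in>A j. \<omega> i)) \<partial>PiM UNIV M) = (\<Prod>j\<in>J. \<integral>\<^sup>+\<omega>. g j (\<lambda>i\<in>A j. \<omega> i) \<partial>PiM UNIV M)"
    by simp
  moreover have "g j (\<lambda>i\<in>A j. \<omega> i) = F j \<omega>" if "j \<in> J" for j \<omega>
    unfolding g_def by (intro dep[OF that]) auto
  ultimately show ?thesis by simp
qed

lemma nn_integral_mult_disjoint_coordinates:
  fixes M :: "'i \<Rightarrow> 'a measure"
  assumes prob: "\<And>i. prob_space (M i)" and "A \<inter> B = {}"
    and "f \<in> borel_measurable (PiM UNIV M)" "g \<in> borel_measurable (PiM UNIV M)"
    and "\<And>\<omega> \<omega>'. (\<And>i. i \<in> A \<Longrightarrow> \<omega> i = \<omega>' i) \<Longrightarrow> f \<omega> = (f \<omega>' :: ennreal)"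
    and "\<And>\<omega> \<omega>'. (\<And>i. i \<in> B \<Longrightarrow> \<omega> i = \<omega>' i) \<Longrightarrow> g \<omega> = (g \<omega>' :: ennreal)"
  shows "(\<integral>\<^sup>+\<omega>. f \<omega> * g \<omega> \<partial>PiM UNIV M) = (\<integral>\<^sup>+\<omega>. f \<omega> \<partial>PiM UNIV M) * (\<integral>\<^sup>+\<omega>. g \<omega> \<partial>PiM UNIV M)"
proof -
  have "(\<integral>\<^sup>+\<omega>. (\<Prod>j\<in>UNIV. (if j then f else g) \<omega>) \<partial>PiM UNIV M) =
      (\<Prod>j\<in>UNIV. \<integral>\<^sup>+\<omega>. (if j then f else g) \<omega> \<partial>PiM UNIV M)"
  proof (rule nn_integral_prod_disjoint_coordinates[OF prob, where A = "\<lambda>j. if j then A else B"])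
    show "disjoint_family_on (\<lambda>j. if j then A else B) UNIV"
      using assms(2) by (auto simp: disjoint_family_on_def)
    show "(if j then f else g) \<in> borel_measurable (PiM UNIV M)" for j
      using assms(3,4) by simp
    show "(if j then f else g) \<omega> = (if j then f else g) \<omega>'"
      if "\<And>i. i \<in> (if j then A else B) \<Longrightarrow> \<omega> i = \<omega>' i" for j \<omega> \<omega>'
      using that by (cases j) (simp_all add: assms(5)[of \<omega> \<omega>'] assms(6)[of \<omega> \<omega>'])
  qed simp
  then show ?thesis by (simp add: UNIV_bool mult.commute)
qed

text \<open>Fixing the value of a child count turns random sums and random transition probabilities
  into deterministic ones; the comparisons so obtained are glued together here.\<close>

lemma nn_integral_mono_fibres:
  fixes X :: "'a \<Rightarrow> nat"
  assumes X[measurable]: "X \<in> M \<rightarrow>\<^sub>M count_space UNIV"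
    and [measurable]: "f \<in> borel_measurable M" "g \<in> borel_measurable M"
    and le: "\<And>k. (\<integral>\<^sup>+\<omega>. f \<omega> * indicator {\<omega>. X \<omega> = k} \<omega> \<partial>M) \<le> (\<integral>\<^sup>+\<omega>. g \<omega> * indicator {\<omega>. X \<omega> = k} \<omega> \<partial>M)"
  shows "(\<integral>\<^sup>+\<omega>. f \<omega> \<partial>M) \<le> (\<integral>\<^sup>+\<omega>. g \<omega> \<partial>M)"
proof -
  have split: "(\<integral>\<^sup>+\<omega>. h \<omega> \<partial>M) = (\<Sum>k. \<integral>\<^sup>+\<omega>. h \<omega> * indicator {\<omega>. X \<omega> = k} \<omega> \<partial>M)"
    if [measurable]: "h \<in> borel_measurable M" for h :: "'a \<Rightarrow> ennreal"
  proof -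
    have "(\<Sum>k. h \<omega> * indicator {\<omega>. X \<omega> = k} \<omega>) = h \<omega>" for \<omega>
    proof -
      have "(\<Sum>k. h \<omega> * indicator {\<omega>. X \<omega> = k} \<omega>) = (\<Sum>k\<in>{X \<omega>}. h \<omega> * indicator {\<omega>. X \<omega> = k} \<omega>)"
        by (rule suminf_finite) (auto simp: indicator_def)
      then show ?thesis by simp
    qed
    then show ?thesis by (subst nn_integral_suminf[symmetric]) simp_all
  qed
  show ?thesis by (subst (1 2) split) (auto intro!: suminf_le le)
qed

section \<open>The law of the environment: measurability, shifts and independence of levels\<close>

lemma prob_space_BGW: "prob_space (BGW p)"
  unfolding BGW_def by (intro prob_space_PiM prob_space_measure_pmf)

lemma space_BGW [simp]: "space (BGW p) = UNIV"
  by (auto simp: BGW_def space_PiM PiE_def)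

lemma measurable_BGW_component [measurable]: "(\<lambda>\<kappa>. \<kappa> x) \<in> BGW p \<rightarrow>\<^sub>M count_space UNIV"
proof -
  have "(\<lambda>\<kappa>. \<kappa> x) \<in> BGW p \<rightarrow>\<^sub>M measure_pmf p"
    unfolding BGW_def by (rule measurable_component_singleton) simp
  then show ?thesis by simp
qed

lemma AE_BGW_leafless:
  assumes "pmf p 0 = 0" shows "AE \<kappa> in BGW p. leafless \<kappa>"
proof -
  have "AE \<kappa> in BGW p. 1 \<le> \<kappa> x" for x
    unfolding BGW_def
  proof (rule AE_PiM_component)
    show "AE k in measure_pmf p. 1 \<le> k"
      using assms by (auto simp: AE_measure_pmf_iff set_pmf_iff Suc_le_eq intro!: gr0I)
  qed (auto intro: prob_space_measure_pmf)
  then show ?thesis unfolding leafless_def by (subst AE_all_countable) auto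
qed

lemma measurable_subtree [measurable]: "subtree y \<in> BGW p \<rightarrow>\<^sub>M BGW p"
  unfolding BGW_def subtree_def[abs_def]
  by (rule measurable_PiM_single')
    (use measurable_BGW_component[of _ p] in \<open>auto simp: BGW_def space_PiM\<close>)

lemma distr_subtree_BGW: "distr (BGW p) (BGW p) (subtree y) = BGW p"
proof -
  have "distr (PiM UNIV (\<lambda>_. measure_pmf p)) (PiM UNIV (\<lambda>_. measure_pmf p)) (\<lambda>\<omega>. \<lambda>w\<in>UNIV. \<omega> (y @ w)) =
      PiM UNIV (\<lambda>_. measure_pmf p)"
    by (rule distr_PiM_reindex) (auto intro: prob_space_measure_pmf injI)
  then show ?thesis unfolding BGW_def subtree_def[abs_def] by (simp add: restrict_UNIV)
qed

lemma nn_integral_subtree: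
  "g \<in> borel_measurable (BGW p) \<Longrightarrow> (\<integral>\<^sup>+\<kappa>. g (subtree y \<kappa>) \<partial>BGW p) = (\<integral>\<^sup>+\<kappa>. g \<kappa> \<partial>BGW p)"
  by (subst (2) distr_subtree_BGW[of p y, symmetric]) (simp add: nn_integral_distr)

lemma measurable_step_mean:
  assumes "\<And>y. (\<lambda>\<kappa>. g \<kappa> y) \<in> borel_measurable (BGW p)"
  shows "(\<lambda>\<kappa>. step_mean lam e \<kappa> (g \<kappa>) x) \<in> borel_measurable (BGW p)"
proof -
  define F where "F k \<kappa> = (if x = [] then (\<Sum>i<k. g \<kappa> [i]) / (e + real k)
      else (lam * g \<kappa> (butlast x) + (\<Sum>i<k. g \<kappa> (x @ [i]))) / (lam + real k))" for k \<kappa>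
  have "F k \<in> borel_measurable (BGW p)" for k
    unfolding F_def using assms by (cases "x = []") simp_all
  then have "(\<lambda>\<kappa>. F (\<kappa> x) \<kappa>) \<in> borel_measurable (BGW p)"
    by (rule measurable_compose_countable) simp
  then show ?thesis by (simp add: F_def[abs_def] step_mean_def cong: if_cong)
qed

lemma measurable_hit_mean:
  assumes "\<And>r z. length z = i \<Longrightarrow> (\<lambda>\<kappa>. b \<kappa> r z) \<in> borel_measurable (BGW p)"
  shows "(\<lambda>\<kappa>. hit_mean lam e w i c (b \<kappa>) \<kappa> t r x) \<in> borel_measurable (BGW p)"
proof (induction t arbitrary: r x)
  case 0
  show ?case by (cases "length x = i") (auto simp: assms)
next
  case (Suc t)
  show ?case
  proof (cases "length x = i")
    case False
    then show ?thesis using Suc by (auto intro!: borel_measurable_times measurable_step_mean)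
  qed (auto simp: assms)
qed

lemma measurable_stage [measurable]: "stage lam M T0 L0 \<delta> K r \<in> borel_measurable (BGW p)"
proof (induction K arbitrary: r)
  case (Suc K)
  have "(\<lambda>\<kappa>. min (stage lam M T0 L0 \<delta> K r (subtree z \<kappa>)) \<delta>) \<in> borel_measurable (BGW p)" for r z
    by (intro borel_measurable_min measurable_compose[OF measurable_subtree Suc]) simp
  then show ?case by (cases "r < T0") (auto intro!: measurable_hit_mean)
qed (simp add: measurable_const[of 1, simplified])

text \<open>No condition on the environment: integrands have to be nonnegative also on the null set
  of environments with leaves, where a division by zero gives 0.\<close>

lemma step_mean_nonneg_any: "\<lbrakk>0 < lam; 0 \<le> e; \<And>y. 0 \<le> g y\<rbrakk> \<Longrightarrow> 0 \<le> step_mean lam e \<kappa> g x"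
  by (auto simp: step_mean_def intro!: divide_nonneg_nonneg add_nonneg_nonneg sum_nonneg)

lemma hit_mean_nonneg_any:
  assumes "0 < lam" "0 \<le> e" "0 \<le> w" "0 \<le> c" "\<And>r x. length x = i \<Longrightarrow> 0 \<le> b r x"
  shows "0 \<le> hit_mean lam e w i c b \<kappa> t r x"
  using assms(5)
proof (induction t arbitrary: r x)
  case (Suc t)
  then show ?case using assms(1-4) by (auto intro!: step_mean_nonneg_any mult_nonneg_nonneg)
qed (use assms in auto)

text \<open>The walk stopped at level i never consults a child count at or beyond that level. This
  is the source of independence from the subtrees at level i.\<close>

lemma hit_mean_cong_levels:
  assumes "\<And>z. length z < i \<Longrightarrow> \<kappa> z = \<kappa>' z" "length x \<le> i"
  shows "hit_mean lam e w i c b \<kappa> t r x = hit_mean lam e w i c b \<kappa>' t r x"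
  using assms(2)
proof (induction t arbitrary: r x)
  case (Suc t)
  show ?case
  proof (cases "length x = i")
    case False
    then have l: "length x < i" using Suc.prems by simp
    have "step_mean lam e \<kappa> (hit_mean lam e w i c b \<kappa> t (r - 1)) x = step_mean lam e \<kappa>' (hit_mean lam e w i c b \<kappa>' t (r - 1)) x"
      using l assms(1)[OF l] by (auto simp: step_mean_def Suc.IH)
    then show ?thesis using False by simp
  qed simp
qed simp

text \<open>The coefficients depend on \<open>\<kappa> x\<close> only, so once this number is fixed
  the integral over the environment can be taken term by term.\<close>

lemma ennreal_step_mean:
  assumes "0 < lam" "0 \<le> e" "0 \<le> w" "\<And>y. 0 \<le> h y"
  shows "ennreal (w * step_mean lam e \<kappa> h x) =
    ennreal (if x = [] then 0 else w * lam / (lam + real (\<kappa> x))) * ennreal (h (butlast x)) +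
    (\<Sum>j<\<kappa> x. ennreal (if x = [] then w / (e + real (\<kappa> x)) else w / (lam + real (\<kappa> x))) * ennreal (h (x @ [j])))"
proof -
  have "w * step_mean lam e \<kappa> h x = (if x = [] then 0 else w * lam / (lam + real (\<kappa> x))) * h (butlast x) +
    (\<Sum>j<\<kappa> x. (if x = [] then w / (e + real (\<kappa> x)) else w / (lam + real (\<kappa> x))) * h (x @ [j]))"
    by (simp add: step_mean_def add_divide_distrib sum_distrib_left[symmetric] distrib_left)
  then show ?thesis using assms
    by (simp add: ennreal_mult[symmetric] sum_ennreal sum_nonneg flip: ennreal_plus)
qed

text \<open>The subtree hanging off a vertex at level i is independent of all that happens below level i.\<close>
lemma nn_integral_hit_mean_le:
  assumes "0 < lam" "0 \<le> e" "0 \<le> w"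
    and g[measurable]: "\<And>r. g r \<in> borel_measurable (BGW p)"
    and g_nonneg: "\<And>r \<kappa>. 0 \<le> g r \<kappa>" and C: "\<And>r. (\<integral>\<^sup>+\<kappa>. ennreal (g r \<kappa>) \<partial>BGW p) \<le> C"
    and \<Phi>: "\<Phi> \<in> borel_measurable (BGW p)"
      "\<And>\<kappa> \<kappa>'. (\<And>z. length z < i \<Longrightarrow> \<kappa> z = \<kappa>' z) \<Longrightarrow> \<Phi> \<kappa> = (\<Phi> \<kappa>' :: ennreal)"
    and "length x \<le> i"
  shows "(\<integral>\<^sup>+\<kappa>. \<Phi> \<kappa> * ennreal (hit_mean lam e w i 0 (\<lambda>r z. g r (subtree z \<kappa>)) \<kappa> t r x) \<partial>BGW p) \<le>
     C * (\<integral>\<^sup>+\<kappa>. \<Phi> \<kappa> * ennreal (hit_mean lam e w i 0 (\<lambda>_ _. 1) \<kappa> t r x) \<partial>BGW p)"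
proof -
  \<comment> \<open>At level i the walk stops: \<Phi> uses lower levels only and g the subtree at x
    only, so the integral factorises.\<close>
  have hit: "(\<integral>\<^sup>+\<kappa>. \<Phi> \<kappa> * ennreal (g r (subtree x \<kappa>)) \<partial>BGW p) \<le> C * (\<integral>\<^sup>+\<kappa>. \<Phi> \<kappa> \<partial>BGW p)"
    if "length x = i" and \<Phi>: "\<Phi> \<in> borel_measurable (BGW p)"
      "\<And>\<kappa> \<kappa>'. (\<And>z. length z < i \<Longrightarrow> \<kappa> z = \<kappa>' z) \<Longrightarrow> \<Phi> \<kappa> = (\<Phi> \<kappa>' :: ennreal)" for r x \<Phi>
  proof -
    have gm0: "(\<lambda>\<kappa>. ennreal (g r \<kappa>)) \<in> borel_measurable (BGW p)"
      by (intro measurable_compose[OF g measurable_ennreal])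
    have gm: "(\<lambda>\<kappa>. ennreal (g r (subtree x \<kappa>))) \<in> borel_measurable (BGW p)"
      by (rule measurable_compose[OF measurable_subtree gm0])
    have "(\<integral>\<^sup>+\<kappa>. \<Phi> \<kappa> * ennreal (g r (subtree x \<kappa>)) \<partial>BGW p) =
       (\<integral>\<^sup>+\<kappa>. \<Phi> \<kappa> \<partial>BGW p) * (\<integral>\<^sup>+\<kappa>. ennreal (g r (subtree x \<kappa>)) \<partial>BGW p)"
      unfolding BGW_def
    proof (rule nn_integral_mult_disjoint_coordinates[where A = "{z. length z < i}" and B = "range (\<lambda>w. x @ w)"])
      show "ennreal (g r (subtree x \<kappa>)) = ennreal (g r (subtree x \<kappa>'))"
        if "\<And>z. z \<in> range ((@) x) \<Longrightarrow> \<kappa> z = \<kappa>' z" for \<kappa> \<kappa>'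
      proof -
        have "subtree x \<kappa> = subtree x \<kappa>'" using that by (auto simp: subtree_def fun_eq_iff)
        then show ?thesis by simp
      qed
      show "\<Phi> \<kappa> = \<Phi> \<kappa>'" if "\<And>z. z \<in> {z. length z < i} \<Longrightarrow> \<kappa> z = \<kappa>' z" for \<kappa> \<kappa>'
        by (rule \<Phi>(2)) (use that in blast)
      show "{z. length z < i} \<inter> range ((@) x) = {}" using \<open>length x = i\<close> by auto
      show "\<Phi> \<in> borel_measurable (PiM UNIV (\<lambda>_. measure_pmf p))" using \<Phi>(1) unfolding BGW_def .
      show "(\<lambda>\<kappa>. ennreal (g r (subtree x \<kappa>))) \<in> borel_measurable (PiM UNIV (\<lambda>_. measure_pmf p))"
        using gm unfolding BGW_def .
    qed (rule prob_space_measure_pmf)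
    also have "\<dots> \<le> (\<integral>\<^sup>+\<kappa>. \<Phi> \<kappa> \<partial>BGW p) * C"
      unfolding nn_integral_subtree[OF gm0] by (intro mult_left_mono C) simp
    finally show ?thesis by (simp only: mult.commute)
  qed
  show ?thesis using \<Phi> \<open>length x \<le> i\<close>
  proof (induction t arbitrary: \<Phi> r x)
    case 0
    show ?case using hit[OF _ 0(1,2), of x r] by (cases "length x = i") auto
  next
    case (Suc t)
    note [measurable] = Suc.prems(1)
    show ?case
    proof (cases "length x = i")
      case True
      show ?thesis
        using hit[OF True Suc.prems(1,2), of r] by (simp only: hit_mean_at[OF True] ennreal_1 mult_1_right)
    next
      case False
      then have l: "length x < i" using Suc.prems(3) by simp
      let ?H = "\<lambda>\<kappa>. hit_mean lam e w i 0 (\<lambda>r z. g r (subtree z \<kappa>)) \<kappa> t (r - 1)"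
      let ?U = "\<lambda>\<kappa>. hit_mean lam e w i 0 (\<lambda>_ _. 1) \<kappa> t (r - 1)"
      define a where "a k = ennreal (if x = [] then 0 else w * lam / (lam + real k))" for k
      define b where "b k = ennreal (if x = [] then w / (e + real k) else w / (lam + real k))" for k
      have Hm[measurable]: "(\<lambda>\<kappa>. ?H \<kappa> y) \<in> borel_measurable (BGW p)" for y
        by (rule measurable_hit_mean, rule measurable_compose[OF measurable_subtree g])
      have Um[measurable]: "(\<lambda>\<kappa>. ?U \<kappa> y) \<in> borel_measurable (BGW p)" for y
        by (rule measurable_hit_mean) simp
      have [measurable]: "(\<lambda>\<kappa>. step_mean lam e \<kappa> (?H \<kappa>) x) \<in> borel_measurable (BGW p)"
        "(\<lambda>\<kappa>. step_mean lam e \<kappa> (?U \<kappa>) x) \<in> borel_measurable (BGW p)"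
        by (rule measurable_step_mean, rule Hm, rule measurable_step_mean, rule Um)
      have Hn: "0 \<le> ?H \<kappa> y" "0 \<le> ?U \<kappa> y" for \<kappa> y
        using assms by (auto intro!: hit_mean_nonneg_any)
      \<comment> \<open>On the event \<open>\<kappa> x\<close> = k the coefficients are constants.
        Together with the indicator they are absorbed into \<Phi>, which is why the induction runs
        over all functions \<Phi> of the levels below i.\<close>
      have expand: "(\<integral>\<^sup>+\<kappa>. \<Phi> \<kappa> * ennreal (w * step_mean lam e \<kappa> (V \<kappa>) x) * indicator {\<kappa>. \<kappa> x = k} \<kappa> \<partial>BGW p) =
          (\<integral>\<^sup>+\<kappa>. (\<Phi> \<kappa> * indicator {\<kappa>. \<kappa> x = k} \<kappa> * a k) * ennreal (V \<kappa> (butlast x)) \<partial>BGW p) +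
          (\<Sum>j<k. \<integral>\<^sup>+\<kappa>. (\<Phi> \<kappa> * indicator {\<kappa>. \<kappa> x = k} \<kappa> * b k) * ennreal (V \<kappa> (x @ [j])) \<partial>BGW p)"
        if V: "\<And>y. (\<lambda>\<kappa>. V \<kappa> y) \<in> borel_measurable (BGW p)" "\<And>\<kappa> y. 0 \<le> V \<kappa> y" for V k
      proof -
        note [measurable] = V(1)
        have "\<Phi> \<kappa> * ennreal (w * step_mean lam e \<kappa> (V \<kappa>) x) * indicator {\<kappa>. \<kappa> x = k} \<kappa> =
          (\<Phi> \<kappa> * indicator {\<kappa>. \<kappa> x = k} \<kappa> * a k) * ennreal (V \<kappa> (butlast x)) +
          (\<Sum>j<k. (\<Phi> \<kappa> * indicator {\<kappa>. \<kappa> x = k} \<kappa> * b k) * ennreal (V \<kappa> (x @ [j])))" for \<kappa>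
          using V assms unfolding ennreal_step_mean[OF assms(1-3) V(2)] a_def b_def
          by (cases "\<kappa> x = k") (auto simp: distrib_left sum_distrib_left mult.assoc)
        then show ?thesis by (simp add: nn_integral_add nn_integral_sum)
      qed
      have IH: "(\<integral>\<^sup>+\<kappa>. (\<Phi> \<kappa> * indicator {\<kappa>. \<kappa> x = k} \<kappa> * d) * ennreal (?H \<kappa> y) \<partial>BGW p) \<le>
          C * (\<integral>\<^sup>+\<kappa>. (\<Phi> \<kappa> * indicator {\<kappa>. \<kappa> x = k} \<kappa> * d) * ennreal (?U \<kappa> y) \<partial>BGW p)"
        if "length y \<le> i" for k d y
      proof (rule Suc.IH)
        fix \<kappa> \<kappa>' :: "nat list \<Rightarrow> nat" assume "\<And>z. length z < i \<Longrightarrow> \<kappa> z = \<kappa>' z"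
        then show "\<Phi> \<kappa> * indicator {\<kappa>. \<kappa> x = k} \<kappa> * d = \<Phi> \<kappa>' * indicator {\<kappa>. \<kappa> x = k} \<kappa>' * d"
          using Suc.prems(2)[of \<kappa> \<kappa>'] l by (simp add: indicator_def)
      qed (use that in auto)
      have "(\<integral>\<^sup>+\<kappa>. \<Phi> \<kappa> * ennreal (w * step_mean lam e \<kappa> (?H \<kappa>) x) \<partial>BGW p) \<le>
          (\<integral>\<^sup>+\<kappa>. C * (\<Phi> \<kappa> * ennreal (w * step_mean lam e \<kappa> (?U \<kappa>) x)) \<partial>BGW p)"
      proof (rule nn_integral_mono_fibres[where X = "\<lambda>\<kappa>. \<kappa> x"])
        fix k
        have "(\<integral>\<^sup>+\<kappa>. \<Phi> \<kappa> * ennreal (w * step_mean lam e \<kappa> (?H \<kappa>) x) * indicator {\<kappa>. \<kappa> x = k} \<kappa> \<partial>BGW p) \<le>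
            C * (\<integral>\<^sup>+\<kappa>. \<Phi> \<kappa> * ennreal (w * step_mean lam e \<kappa> (?U \<kappa>) x) * indicator {\<kappa>. \<kappa> x = k} \<kappa> \<partial>BGW p)"
          unfolding expand[of ?H, OF Hm Hn(1)] expand[of ?U, OF Um Hn(2)] distrib_left sum_distrib_left
          using l by (intro add_mono sum_mono IH) auto
        then show "(\<integral>\<^sup>+\<kappa>. \<Phi> \<kappa> * ennreal (w * step_mean lam e \<kappa> (?H \<kappa>) x) * indicator {\<kappa>. \<kappa> x = k} \<kappa> \<partial>BGW p) \<le>
            (\<integral>\<^sup>+\<kappa>. C * (\<Phi> \<kappa> * ennreal (w * step_mean lam e \<kappa> (?U \<kappa>) x)) * indicator {\<kappa>. \<kappa> x = k} \<kappa> \<partial>BGW p)"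
          unfolding mult.assoc[of C] by (subst nn_integral_cmult) measurable
      qed measurable
      also have "\<dots> = C * (\<integral>\<^sup>+\<kappa>. \<Phi> \<kappa> * ennreal (w * step_mean lam e \<kappa> (?U \<kappa>) x) \<partial>BGW p)"
        by (subst nn_integral_cmult) measurable
      finally show ?thesis using False by simp
    qed
  qed
qed

section \<open>Negative moments of the stage bounds, uniform in the number of stages\<close>

lemma hit_mean_straight_root:
  assumes "0 < lam" "0 \<le> e" "e \<le> lam" "leafless \<kappa>" "1 \<le> w" "0 \<le> d"
    "\<And>r x. length x = i \<Longrightarrow> d \<le> b r x" "i \<le> t"
  shows "d / (1 + lam) ^ i \<le> hit_mean lam e w i 0 b \<kappa> t r []"
  using hit_mean_straight[of lam e \<kappa> w d i b "[]" t r] assms by simp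

text \<open>As \<open>0 powr - \<theta>\<close> is 0, a bound on negative moments is informative
  only for positive quantities. Straight paths provide positivity; this c may deteriorate with K,
  whereas the moment bound below does not.\<close>

lemma stage_lower_bound:
  assumes "0 < lam" "1 \<le> M" "1 \<le> L0" "L0 \<le> T0" "0 < \<delta>"
  obtains c where "0 < c" "\<And>r \<kappa>. leafless \<kappa> \<Longrightarrow> c \<le> stage lam M T0 L0 \<delta> K r \<kappa>"
proof (induction K arbitrary: thesis)
  case 0
  show ?case by (rule 0[of 1]) auto
next
  case (Suc K)
  then obtain c where c: "0 < c" "\<And>r \<kappa>. leafless \<kappa> \<Longrightarrow> c \<le> stage lam M T0 L0 \<delta> K r \<kappa>" by blast
  show ?case
  proof (rule Suc.prems)
    show "0 < min 1 (min c \<delta> / (1 + lam) ^ L0)" using c assms by simp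
    fix r and \<kappa> :: "nat list \<Rightarrow> nat" assume \<kappa>: "leafless \<kappa>"
    have "min c \<delta> / (1 + lam) ^ L0 \<le>
      hit_mean lam lam M L0 0 (\<lambda>r z. min (stage lam M T0 L0 \<delta> K r (subtree z \<kappa>)) \<delta>) \<kappa> T0 r []"
      using assms c \<kappa> by (intro hit_mean_straight_root) (auto simp: min_le_iff_disj leafless_subtree)
    then show "min 1 (min c \<delta> / (1 + lam) ^ L0) \<le> stage lam M T0 L0 \<delta> (Suc K) r \<kappa>" by auto
  qed
qed

text \<open>Let W be the weighted mass of one stage. Jensen's inequality over the positions at level
  L0 yields W^(-1-\<theta>) times a mean over independent subtrees; integrating these out restores
  W^(-\<theta>), whose mean is at most \<rho>. The cap adds \<delta>^(-\<theta>), so a moment x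
  becomes at most \<rho> (x + \<delta>^(-\<theta>)) after one more stage and stays bounded.\<close>

lemma stage_moment_bound:
  assumes "0 < lam" "1 \<le> M" "1 \<le> L0" "L0 \<le> T0" "0 < \<delta>" "0 < \<theta>" "pmf p 0 = 0" "0 \<le> \<rho>" "\<rho> < 1"
    and \<rho>: "(\<integral>\<^sup>+\<kappa>. ennreal (hit_mean lam lam M L0 0 (\<lambda>_ _. 1) \<kappa> T0 0 [] powr - \<theta>) \<partial>BGW p) \<le> ennreal \<rho>"
  obtains C where "0 \<le> C"
    "\<And>K r. (\<integral>\<^sup>+\<kappa>. ennreal (stage lam M T0 L0 \<delta> K r \<kappa> powr - \<theta>) \<partial>BGW p) \<le> ennreal C"
proof -
  interpret prob_space "BGW p" by (rule prob_space_BGW)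
  \<comment> \<open>The fixed point of this affine recursion, plus 1 because the stage bound equals
    1 for K = 0 or r < T0.\<close>
  define C where "C = 1 + \<rho> * \<delta> powr - \<theta> / (1 - \<rho>)"
  have C: "1 \<le> C" using assms by (simp add: C_def)
  have C': "\<rho> * (C + \<delta> powr - \<theta>) \<le> C"
  proof -
    have "\<rho> * (C + \<delta> powr - \<theta>) = \<rho> + \<rho> * \<delta> powr - \<theta> / (1 - \<rho>)"
      using assms(9) by (simp add: C_def field_simps)
    then show ?thesis using assms by (simp add: C_def)
  qed
  have "(\<integral>\<^sup>+\<kappa>. ennreal (stage lam M T0 L0 \<delta> K r \<kappa> powr - \<theta>) \<partial>BGW p) \<le> ennreal C" for K r
  proof (induction K arbitrary: r)
    case 0
    then show ?case using C by (simp add: emeasure_space_1[simplified] ennreal_leI)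
  next
    case (Suc K)
    show ?case
    proof (cases "r < T0")
      case True
      then show ?thesis using C by (simp add: emeasure_space_1[simplified] ennreal_leI)
    next
      case False
      define g where "g r \<kappa> = min (stage lam M T0 L0 \<delta> K r \<kappa>) \<delta> powr - \<theta>" for r \<kappa>
      define W where "W \<kappa> = hit_mean lam lam M L0 0 (\<lambda>_ _. 1) \<kappa> T0 r []" for \<kappa>
      have W0: "W \<kappa> = hit_mean lam lam M L0 0 (\<lambda>_ _. 1) \<kappa> T0 0 []" for \<kappa>
        unfolding W_def by (rule hit_mean_indep_time)
      have Wm[measurable]: "W \<in> borel_measurable (BGW p)"
        unfolding W_def by (rule measurable_hit_mean) simp
      have gm[measurable]: "g r \<in> borel_measurable (BGW p)" for r unfolding g_def by measurable
      obtain c where c: "0 < c" "\<And>r \<kappa>. leafless \<kappa> \<Longrightarrow> c \<le> stage lam M T0 L0 \<delta> K r \<kappa>"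
        using stage_lower_bound[OF assms(1-5)] by blast
      have Wpos: "0 < W \<kappa>" if "leafless \<kappa>" for \<kappa>
      proof -
        have "1 / (1 + lam) ^ L0 \<le> W \<kappa>"
          unfolding W_def using that assms by (intro hit_mean_straight_root) auto
        moreover have "0 < 1 / (1 + lam) ^ L0" using assms by simp
        ultimately show ?thesis by linarith
      qed
      have Eg: "(\<integral>\<^sup>+\<kappa>. ennreal (g r \<kappa>) \<partial>BGW p) \<le> ennreal (C + \<delta> powr - \<theta>)" for r
      proof -
        have "(\<integral>\<^sup>+\<kappa>. ennreal (g r \<kappa>) \<partial>BGW p) \<le>
          (\<integral>\<^sup>+\<kappa>. ennreal (stage lam M T0 L0 \<delta> K r \<kappa> powr - \<theta>) + ennreal (\<delta> powr - \<theta>) \<partial>BGW p)"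
          by (intro nn_integral_mono) (auto simp: g_def min_def intro!: ennreal_leI simp flip: ennreal_plus)
        also have "\<dots> \<le> ennreal C + ennreal (\<delta> powr - \<theta>)"
          using Suc[of r] by (simp add: nn_integral_add emeasure_space_1[simplified] add_mono)
        finally show ?thesis using C by (simp add: ennreal_plus)
      qed
      have "AE \<kappa> in BGW p. stage lam M T0 L0 \<delta> (Suc K) r \<kappa> powr - \<theta> \<le>
         W \<kappa> powr (- 1 - \<theta>) * hit_mean lam lam M L0 0 (\<lambda>r z. g r (subtree z \<kappa>)) \<kappa> T0 r []"
        using AE_BGW_leafless[OF assms(7)]
      proof eventually_elim
        case (elim \<kappa>)
        let ?b = "\<lambda>r z. min (stage lam M T0 L0 \<delta> K r (subtree z \<kappa>)) \<delta>"
        have b: "min c \<delta> \<le> ?b r z" for r z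
          using c(2)[OF leafless_subtree[OF elim], of r z] by auto
        have "min c \<delta> / (1 + lam) ^ L0 \<le> hit_mean lam lam M L0 0 ?b \<kappa> T0 r []"
          using assms c elim b by (intro hit_mean_straight_root) auto
        moreover have "0 < min c \<delta> / (1 + lam) ^ L0" using assms c by simp
        ultimately have pos: "0 < hit_mean lam lam M L0 0 ?b \<kappa> T0 r []" by linarith
        have "hit_mean lam lam M L0 0 ?b \<kappa> T0 r [] powr - \<theta> \<le> hit_mean lam lam M L0 0 (\<lambda>_ _. 1) \<kappa> T0 r [] powr (- 1 - \<theta>) *
            hit_mean lam lam M L0 0 (\<lambda>r z. ?b r z powr - \<theta>) \<kappa> T0 r []"
        proof (rule hit_mean_Jensen)
          show "0 < ?b r z" for r z using b[of r z] assms c by linarith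
        qed (use assms elim Wpos[OF elim] pos in \<open>auto simp: W_def\<close>)
        then show ?case using False by (simp add: g_def W_def)
      qed
      then have "(\<integral>\<^sup>+\<kappa>. ennreal (stage lam M T0 L0 \<delta> (Suc K) r \<kappa> powr - \<theta>) \<partial>BGW p) \<le>
         (\<integral>\<^sup>+\<kappa>. ennreal (W \<kappa> powr (- 1 - \<theta>)) * ennreal (hit_mean lam lam M L0 0 (\<lambda>r z. g r (subtree z \<kappa>)) \<kappa> T0 r []) \<partial>BGW p)"
        by (intro nn_integral_mono_AE) (auto simp: ennreal_mult'[symmetric] ennreal_leI elim!: eventually_mono)
      also have "\<dots> \<le> ennreal (C + \<delta> powr - \<theta>) * (\<integral>\<^sup>+\<kappa>. ennreal (W \<kappa> powr (- 1 - \<theta>)) * ennreal (hit_mean lam lam M L0 0 (\<lambda>_ _. 1) \<kappa> T0 r []) \<partial>BGW p)"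
      proof (rule nn_integral_hit_mean_le)
        show "ennreal (W \<kappa> powr (- 1 - \<theta>)) = ennreal (W \<kappa>' powr (- 1 - \<theta>))"
          if "\<And>z. length z < L0 \<Longrightarrow> \<kappa> z = \<kappa>' z" for \<kappa> \<kappa>'
          unfolding W_def using hit_mean_cong_levels[of L0 \<kappa> \<kappa>' "[]"] that by simp
      qed (use assms Eg in \<open>auto simp: g_def[of _ "_ :: nat list \<Rightarrow> nat"]\<close>)
      also have "(\<integral>\<^sup>+\<kappa>. ennreal (W \<kappa> powr (- 1 - \<theta>)) * ennreal (hit_mean lam lam M L0 0 (\<lambda>_ _. 1) \<kappa> T0 r []) \<partial>BGW p) =
          (\<integral>\<^sup>+\<kappa>. ennreal (W \<kappa> powr - \<theta>) \<partial>BGW p)"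
      proof (rule nn_integral_cong_AE)
        show "AE \<kappa> in BGW p. ennreal (W \<kappa> powr (- 1 - \<theta>)) * ennreal (hit_mean lam lam M L0 0 (\<lambda>_ _. 1) \<kappa> T0 r []) = ennreal (W \<kappa> powr - \<theta>)"
          using AE_BGW_leafless[OF assms(7)]
        proof eventually_elim
          case (elim \<kappa>)
          have "W \<kappa> powr (- 1 - \<theta>) * W \<kappa> = W \<kappa> powr - \<theta>"
            using Wpos[OF elim] powr_mult_base[of "W \<kappa>" "- 1 - \<theta>"] by (simp add: mult.commute)
          then show ?case using Wpos[OF elim] by (simp add: W_def[symmetric] ennreal_mult'[symmetric])
        qed
      qed
      also have "ennreal (C + \<delta> powr - \<theta>) * (\<integral>\<^sup>+\<kappa>. ennreal (W \<kappa> powr - \<theta>) \<partial>BGW p) \<le> ennreal (C + \<delta> powr - \<theta>) * ennreal \<rho>"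
        using \<rho> by (intro mult_left_mono) (auto simp: W0)
      also have "\<dots> = ennreal ((C + \<delta> powr - \<theta>) * \<rho>)" using assms C by (simp add: ennreal_mult)
      also have "\<dots> \<le> ennreal C" using C' by (intro ennreal_leI) (simp add: mult.commute)
      finally show ?thesis .
    qed
  qed
  with C show ?thesis by (intro that[of C]) auto
qed

section \<open>The branching property\<close>

lemma nn_integral_cong_fibres:
  fixes X :: "'a \<Rightarrow> 'b :: countable"
  assumes X[measurable]: "X \<in> M \<rightarrow>\<^sub>M count_space UNIV"
    and [measurable]: "f \<in> borel_measurable M" "g \<in> borel_measurable M"
    and eq: "\<And>k. (\<integral>\<^sup>+\<omega>. f \<omega> * indicator {\<omega>. X \<omega> = k} \<omega> \<partial>M) = (\<integral>\<^sup>+\<omega>. g \<omega> * indicator {\<omega>. X \<omega> = k} \<omega> \<partial>M)"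
  shows "(\<integral>\<^sup>+\<omega>. f \<omega> \<partial>M) = (\<integral>\<^sup>+\<omega>. g \<omega> \<partial>M)"
proof -
  have Y[measurable]: "(\<lambda>\<omega>. to_nat (X \<omega>)) \<in> M \<rightarrow>\<^sub>M count_space UNIV" by measurable
  have "(\<integral>\<^sup>+\<omega>. f \<omega> * indicator {\<omega>. to_nat (X \<omega>) = k} \<omega> \<partial>M) = (\<integral>\<^sup>+\<omega>. g \<omega> * indicator {\<omega>. to_nat (X \<omega>) = k} \<omega> \<partial>M)" for k
  proof (cases "k \<in> range (to_nat :: 'b \<Rightarrow> nat)")
    case True
    then obtain b :: 'b where "k = to_nat b" by blast
    then show ?thesis using eq[of b] by simp
  next
    case False
    then have "{\<omega>. to_nat (X \<omega>) = k} = {}" by auto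
    then show ?thesis by simp
  qed
  then show ?thesis
    using nn_integral_mono_fibres[OF Y assms(2,3)] nn_integral_mono_fibres[OF Y assms(3,2)] by (simp add: antisym)
qed

section \<open>The walk: its law expressed by one-step means\<close>

lemma finite_set_step_pmf: "leafless \<kappa> \<Longrightarrow> finite (set_pmf (step_pmf lam \<kappa> x))"
  by (auto simp: step_pmf_def leafless_def Suc_le_eq lessThan_empty_iff)

lemma nn_integral_step_pmf:
  assumes "0 < lam" "leafless \<kappa>" "\<And>y. 0 \<le> g y"
  shows "(\<integral>\<^sup>+y. ennreal (g y) \<partial>step_pmf lam \<kappa> x) = ennreal (step_mean lam 0 \<kappa> g x)"
proof -
  have k: "0 < real (\<kappa> x)" "{..<\<kappa> x} \<noteq> {}" using leaflessD[OF assms(2), of x] by auto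
  have unif: "(\<integral>\<^sup>+y. ennreal (g y) \<partial>map_pmf (\<lambda>i. x @ [i]) (pmf_of_set {..<\<kappa> x})) =
      ennreal ((\<Sum>i<\<kappa> x. g (x @ [i])) / real (\<kappa> x))"
    using k assms(3) by (simp add: nn_integral_pmf_of_set sum_ennreal divide_ennreal sum_nonneg ennreal_of_nat_eq_real_of_nat)
  show ?thesis
  proof (cases "x = []")
    case True
    then show ?thesis using unif by (simp add: step_pmf_def step_mean_def)
  next
    case False
    let ?q = "lam / (lam + real (\<kappa> x))"
    have q: "?q \<in> {0..1}" "1 - ?q = real (\<kappa> x) / (lam + real (\<kappa> x))" using k assms(1) by (auto simp: field_simps)
    have "(\<integral>\<^sup>+y. ennreal (g y) \<partial>step_pmf lam \<kappa> x) =
      (\<integral>\<^sup>+b. (\<integral>\<^sup>+y. ennreal (g y) \<partial>(if b then return_pmf (butlast x) else map_pmf (\<lambda>i. x @ [i]) (pmf_of_set {..<\<kappa> x}))) \<partial>bernoulli_pmf ?q)"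
      unfolding step_pmf_def using False by (simp add: nn_integral_bind_pmf)
    also have "\<dots> = ennreal (g (butlast x)) * ennreal ?q +
        ennreal ((\<Sum>i<\<kappa> x. g (x @ [i])) / real (\<kappa> x)) * ennreal (1 - ?q)"
      using q unif by (simp add: nn_integral_bernoulli_pmf)
    also have "\<dots> = ennreal (g (butlast x) * ?q + (\<Sum>i<\<kappa> x. g (x @ [i])) / real (\<kappa> x) * (1 - ?q))"
    proof -
      have "ennreal a * ennreal q + ennreal s * ennreal (1 - q) = ennreal (a * q + s * (1 - q))"
        if "0 \<le> a" "0 \<le> s" "q \<in> {0..1}" for a s q
        using that by (simp add: ennreal_mult ennreal_plus)
      then show ?thesis using q(1) assms(3) by (simp only: sum_nonneg divide_nonneg_nonneg of_nat_0_le_iff)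
    qed
    also have "g (butlast x) * ?q + (\<Sum>i<\<kappa> x. g (x @ [i])) / real (\<kappa> x) * (1 - ?q) = step_mean lam 0 \<kappa> g x"
      unfolding q(2) using False k by (simp add: step_mean_def add_divide_distrib mult.commute)
    finally show ?thesis .
  qed
qed

definition step_field :: "real \<Rightarrow> (nat list \<Rightarrow> nat) \<Rightarrow> (nat list \<Rightarrow> nat list) measure" where
  "step_field lam \<kappa> = PiM UNIV (\<lambda>x. measure_pmf (step_pmf lam \<kappa> x))"

lemma prob_space_step_field: "prob_space (step_field lam \<kappa>)"
  unfolding step_field_def by (intro prob_space_PiM prob_space_measure_pmf)

lemma measurable_step_field: "(\<lambda>s. s x) \<in> step_field lam \<kappa> \<rightarrow>\<^sub>M count_space UNIV"
proof -
  have "(\<lambda>s. s x) \<in> step_field lam \<kappa> \<rightarrow>\<^sub>M measure_pmf (step_pmf lam \<kappa> x)"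
    unfolding step_field_def by (rule measurable_component_singleton) simp
  then show ?thesis by simp
qed

lemma nn_integral_step_field:
  "(\<integral>\<^sup>+s. f (s x) \<partial>step_field lam \<kappa>) = (\<integral>\<^sup>+y. f y \<partial>step_pmf lam \<kappa> x)"
proof -
  have d: "distr (step_field lam \<kappa>) (measure_pmf (step_pmf lam \<kappa> x)) (\<lambda>s. s x) = measure_pmf (step_pmf lam \<kappa> x)"
    unfolding step_field_def by (rule distr_PiM_component) (auto intro: prob_space_measure_pmf)
  have "(\<integral>\<^sup>+y. f y \<partial>step_pmf lam \<kappa> x) = (\<integral>\<^sup>+y. f y \<partial>distr (step_field lam \<kappa>) (measure_pmf (step_pmf lam \<kappa> x)) (\<lambda>s. s x))"
    unfolding d ..
  also have "\<dots> = (\<integral>\<^sup>+s. f (s x) \<partial>step_field lam \<kappa>)"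
    using measurable_step_field[of x lam \<kappa>] by (intro nn_integral_distr) auto
  finally show ?thesis ..
qed

text \<open>The index type is left open: times for the walk, individuals for the branching random
  walk. The same measurability and independence facts serve both.\<close>

definition field_space :: "real \<Rightarrow> (nat list \<Rightarrow> nat) \<Rightarrow> ('i \<Rightarrow> nat list \<Rightarrow> nat list) measure" where
  "field_space lam \<kappa> = PiM UNIV (\<lambda>_. step_field lam \<kappa>)"

lemma walk_space_eq: "walk_space lam \<kappa> = field_space lam \<kappa>"
  by (simp add: walk_space_def field_space_def step_field_def)

lemma BRW_quenched_eq: "BRW_quenched lam mu \<kappa> = BGW mu \<Otimes>\<^sub>M field_space lam \<kappa>"
  by (simp add: BRW_quenched_def BGW_def field_space_def step_field_def)

lemma prob_space_field_space: "prob_space (field_space lam \<kappa>)"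
  unfolding field_space_def by (intro prob_space_PiM prob_space_step_field)

lemma space_field_space [simp]: "space (field_space lam \<kappa>) = UNIV"
  by (auto simp: field_space_def step_field_def space_PiM PiE_def)

lemma emeasure_field_space [simp]: "emeasure (field_space lam \<kappa>) UNIV = 1"
  using prob_space.emeasure_space_1[OF prob_space_field_space, of lam \<kappa>] by simp

lemma measurable_field_space_component: "(\<lambda>c. c i) \<in> field_space lam \<kappa> \<rightarrow>\<^sub>M step_field lam \<kappa>"
  unfolding field_space_def by (rule measurable_component_singleton) simp

lemma measurable_field_space: "(\<lambda>c. c i x) \<in> field_space lam \<kappa> \<rightarrow>\<^sub>M count_space UNIV"
  by (rule measurable_compose[OF measurable_field_space_component measurable_step_field])

lemma nn_integral_field_space:
  fixes i :: 'i
  shows "(\<integral>\<^sup>+c. f (c i x) \<partial>field_space lam \<kappa>) = (\<integral>\<^sup>+y. f y \<partial>step_pmf lam \<kappa> x)"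
proof -
  have m: "(\<lambda>s. f (s x)) \<in> borel_measurable (step_field lam \<kappa>)"
    by (rule measurable_compose[OF measurable_step_field]) simp
  have d: "distr (field_space lam \<kappa>) (step_field lam \<kappa>) (\<lambda>c. c i) = step_field lam \<kappa>"
    unfolding field_space_def by (rule distr_PiM_component) (auto intro: prob_space_step_field)
  have "(\<integral>\<^sup>+s. f (s x) \<partial>step_field lam \<kappa>) = (\<integral>\<^sup>+s. f (s x) \<partial>distr (field_space lam \<kappa>) (step_field lam \<kappa>) (\<lambda>c. c i))"
    unfolding d ..
  also have "\<dots> = (\<integral>\<^sup>+c. f (c i x) \<partial>field_space lam \<kappa>)"
    by (subst nn_integral_distr[OF measurable_field_space_component])
      (simp_all only: measurable_distr_eq1 m)
  finally show ?thesis by (simp add: nn_integral_step_field)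
qed

lemma measurable_walk_pos [measurable]: "(\<lambda>c. walk_pos c n) \<in> field_space lam \<kappa> \<rightarrow>\<^sub>M count_space UNIV"
proof (induction n)
  case (Suc n)
  have "(\<lambda>c. c n (walk_pos c n)) \<in> field_space lam \<kappa> \<rightarrow>\<^sub>M count_space UNIV"
    by (rule measurable_compose_countable[where f = "\<lambda>x c. c n x", OF measurable_field_space Suc])
  then show ?case by simp
qed simp

lemma walk_pos_cong: "(\<And>i. i < n \<Longrightarrow> c i = c' i) \<Longrightarrow> walk_pos c n = walk_pos c' n"
  by (induction n) auto

text \<open>The position at time n depends on earlier choices only and so is independent of
  \<open>c n\<close>. As \<open>c n\<close> is evaluated at this random position, the integral is
  first split according to its value.\<close>

lemma nn_integral_walk_pos:
  assumes "0 < lam" "leafless \<kappa>" "\<And>y. 0 \<le> g y"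
  shows "(\<integral>\<^sup>+c. ennreal (g (walk_pos c n)) \<partial>field_space lam \<kappa>) = ennreal (walk_mean lam \<kappa> n g [])"
  using assms(3)
proof (induction n arbitrary: g)
  case 0
  then show ?case by (simp add: walk_mean_simps[OF assms(1,2)])
next
  case (Suc n)
  have "(\<integral>\<^sup>+c. ennreal (g (walk_pos c (Suc n))) \<partial>field_space lam \<kappa>) =
      (\<integral>\<^sup>+c. ennreal (step_mean lam 0 \<kappa> g (walk_pos c n)) \<partial>field_space lam \<kappa>)"
  proof (rule nn_integral_cong_fibres[where X = "\<lambda>c. walk_pos c n"])
    fix x :: "nat list"
    let ?F = "field_space lam \<kappa> :: (nat \<Rightarrow> nat list \<Rightarrow> nat list) measure"
    have 1: "(\<integral>\<^sup>+c. indicator {c. walk_pos c n = x} c * ennreal (g (c n x)) \<partial>?F) =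
       (\<integral>\<^sup>+c. indicator {c. walk_pos c n = x} c \<partial>?F) * (\<integral>\<^sup>+c. ennreal (g (c n x)) \<partial>?F)"
      unfolding field_space_def
    proof (rule nn_integral_mult_disjoint_coordinates[where A = "{..<n}" and B = "{n}"])
      show "indicator {c. walk_pos c n = x} c = (indicator {c. walk_pos c n = x} c' :: ennreal)"
        if "\<And>i. i \<in> {..<n} \<Longrightarrow> c i = c' i" for c c'
        using walk_pos_cong[of n c c'] that by (simp add: indicator_def)
      show "(\<lambda>c. indicator {c. walk_pos c n = x} c) \<in> borel_measurable (Pi\<^sub>M UNIV (\<lambda>_. step_field lam \<kappa>))"
        unfolding field_space_def[symmetric] by measurable
      show "(\<lambda>c. ennreal (g (c n x))) \<in> borel_measurable (Pi\<^sub>M UNIV (\<lambda>_. step_field lam \<kappa>))"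
        unfolding field_space_def[symmetric] by (rule measurable_compose[OF measurable_field_space]) simp
    qed (auto intro: prob_space_step_field)
    have 2: "(\<integral>\<^sup>+c. ennreal (g (c n x)) \<partial>?F) = ennreal (step_mean lam 0 \<kappa> g x)"
      by (rule trans[OF nn_integral_field_space nn_integral_step_pmf[OF assms(1,2) Suc.prems]])
    have "(\<integral>\<^sup>+c. ennreal (g (walk_pos c (Suc n))) * indicator {c. walk_pos c n = x} c \<partial>?F) =
       (\<integral>\<^sup>+c. indicator {c. walk_pos c n = x} c * ennreal (g (c n x)) \<partial>?F)"
      by (intro nn_integral_cong) (auto simp: indicator_def)
    also have "\<dots> = (\<integral>\<^sup>+c. indicator {c. walk_pos c n = x} c * ennreal (step_mean lam 0 \<kappa> g x) \<partial>?F)"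
      unfolding 1 2 by (subst nn_integral_multc) measurable
    also have "\<dots> = (\<integral>\<^sup>+c. ennreal (step_mean lam 0 \<kappa> g (walk_pos c n)) * indicator {c. walk_pos c n = x} c \<partial>?F)"
      by (intro nn_integral_cong) (auto simp: indicator_def)
    finally show "(\<integral>\<^sup>+c. ennreal (g (walk_pos c (Suc n))) * indicator {c. walk_pos c n = x} c \<partial>?F) =
      (\<integral>\<^sup>+c. ennreal (step_mean lam 0 \<kappa> g (walk_pos c n)) * indicator {c. walk_pos c n = x} c \<partial>?F)" .
  qed (rule measurable_walk_pos, (rule measurable_compose[OF measurable_walk_pos], simp)+)
  also have "\<dots> = ennreal (walk_mean lam \<kappa> n (step_mean lam 0 \<kappa> g) [])"
    using Suc.prems assms(1) by (intro Suc.IH step_mean_nonneg_any) auto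
  finally show ?case by (simp add: walk_mean_Suc'[OF assms(1,2)])
qed

lemma measure_walk_pos:
  assumes "0 < lam" "leafless \<kappa>"
  shows "measure (walk_space lam \<kappa>) {c \<in> space (walk_space lam \<kappa>). P (walk_pos c n)} =
    walk_mean lam \<kappa> n (\<lambda>y. if P y then 1 else 0) []"
proof -
  have "emeasure (field_space lam \<kappa>) {c. P (walk_pos c n)} =
      (\<integral>\<^sup>+c. indicator {c. P (walk_pos c n)} c \<partial>field_space lam \<kappa>)"
    by (rule nn_integral_indicator[symmetric]) (use measurable_sets[OF measurable_walk_pos[of n lam \<kappa>], of "Collect P"] in \<open>auto simp: vimage_def\<close>)
  also have "\<dots> = (\<integral>\<^sup>+c. ennreal ((\<lambda>y. if P y then 1 else 0) (walk_pos c n)) \<partial>field_space lam \<kappa>)"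
    by (intro nn_integral_cong) (auto simp: indicator_def)
  also have "\<dots> = ennreal (walk_mean lam \<kappa> n (\<lambda>y. if P y then 1 else 0) [])"
    by (rule nn_integral_walk_pos[OF assms]) auto
  finally show ?thesis
    unfolding walk_space_eq measure_def by (simp add: walk_mean_nonneg[OF assms])
qed

section \<open>The branching random walk: recursion over the children of the root\<close>

primrec brw_from :: "(nat list \<Rightarrow> nat list \<Rightarrow> nat list) \<Rightarrow> nat list \<Rightarrow> nat list \<Rightarrow> nat list" where
  "brw_from ch x [] = x"
| "brw_from ch x (i # u) = brw_from (\<lambda>w. ch (i # w)) (ch [i] x) u"

text \<open>Peeling off the first ancestor, instead of appending the last individual, matches the
  branching property at the root and lets the starting point vary in inductions.\<close>

lemma brw_pos_eq: "brw_pos ch u = brw_from ch [] u"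
proof -
  have "snd (foldl (\<lambda>(w, x) i. (w @ [i], ch (w @ [i]) x)) (w, x) u) = brw_from (\<lambda>w'. ch (w @ w')) x u" for w x
    by (induction u arbitrary: w x) simp_all
  from this[of "[]" "[]"] show ?thesis by (simp add: brw_pos_def)
qed

lemma in_tree_Cons: "in_tree \<nu> (i # u) \<longleftrightarrow> i < \<nu> [] \<and> in_tree (subtree [i] \<nu>) u"
  by (auto simp: in_tree_def subtree_def All_less_Suc2)

definition all_below :: "nat \<Rightarrow> nat \<Rightarrow> nat list \<Rightarrow> (nat list \<Rightarrow> nat) \<Rightarrow> (nat list \<Rightarrow> nat list \<Rightarrow> nat list) \<Rightarrow> bool" where
  "all_below L n x \<nu> ch \<longleftrightarrow> (\<forall>u. length u = n \<and> in_tree \<nu> u \<longrightarrow> length (brw_from ch x u) < L)"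

lemma all_below_Suc:
  "all_below L (Suc n) x \<nu> ch \<longleftrightarrow> (\<forall>i<\<nu> []. all_below L n (ch [i] x) (subtree [i] \<nu>) (\<lambda>w. ch (i # w)))"
proof
  assume *: "all_below L (Suc n) x \<nu> ch"
  show "\<forall>i<\<nu> []. all_below L n (ch [i] x) (subtree [i] \<nu>) (\<lambda>w. ch (i # w))"
    unfolding all_below_def
  proof (intro allI impI, elim conjE)
    fix i u assume "i < \<nu> []" "length u = n" "in_tree (subtree [i] \<nu>) u"
    then show "length (brw_from (\<lambda>w. ch (i # w)) (ch [i] x) u) < L"
      using *[unfolded all_below_def, rule_format, of "i # u"] by (simp add: in_tree_Cons)
  qed
qed (auto simp: all_below_def in_tree_Cons length_Suc_conv)

lemma brw_from_cong: "(\<And>w. w \<noteq> [] \<Longrightarrow> ch w = ch' w) \<Longrightarrow> brw_from ch x u = brw_from ch' x u"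
proof (cases u)
  case (Cons i u')
  assume "\<And>w. w \<noteq> [] \<Longrightarrow> ch w = ch' w"
  then have "(\<lambda>w. ch (i # w)) = (\<lambda>w. ch' (i # w))" "ch [i] = ch' [i]" by auto
  then show ?thesis using Cons by simp
qed simp

lemma measurable_shift_field: "(\<lambda>c w. c (i # w)) \<in> field_space lam \<kappa> \<rightarrow>\<^sub>M field_space lam \<kappa>"
  unfolding field_space_def
proof (rule measurable_PiM_single')
  show "(\<lambda>c. c (i # w)) \<in> PiM UNIV (\<lambda>_. step_field lam \<kappa>) \<rightarrow>\<^sub>M step_field lam \<kappa>" for w
    by (rule measurable_component_singleton) simp
  show "(\<lambda>c w. c (i # w)) \<in> space (PiM UNIV (\<lambda>_. step_field lam \<kappa>)) \<rightarrow> (\<Pi>\<^sub>E w\<in>UNIV. space (step_field lam \<kappa>))"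
    by (auto simp: step_field_def space_PiM PiE_def)
qed

lemma measurable_brw_from [measurable]: "(\<lambda>ch. brw_from ch x u) \<in> field_space lam \<kappa> \<rightarrow>\<^sub>M count_space UNIV"
proof (induction u arbitrary: x)
  case (Cons i u)
  have "(\<lambda>ch. brw_from (\<lambda>w. ch (i # w)) (ch [i] x) u) \<in> field_space lam \<kappa> \<rightarrow>\<^sub>M count_space UNIV"
    by (rule measurable_compose_countable[where f = "\<lambda>y ch. brw_from (\<lambda>w. ch (i # w)) y u"])
      (rule measurable_compose[OF measurable_shift_field Cons], rule measurable_field_space)
  then show ?case by simp
qed simp

lemma measurable_in_tree [measurable]: "Measurable.pred (BGW mu) (\<lambda>\<nu>. in_tree \<nu> u)"
proof -
  have "Measurable.pred (BGW mu) (\<lambda>\<nu>. u ! i < \<nu> (take i u))" for i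
    by (rule measurable_compose[OF measurable_BGW_component]) simp
  then have "Measurable.pred (BGW mu) (\<lambda>\<nu>. i < length u \<longrightarrow> u ! i < \<nu> (take i u))" for i
    by (cases "i < length u") simp_all
  then show ?thesis unfolding in_tree_def by (rule pred_intros_countable(1))
qed

lemma measurable_all_below [measurable]:
  "Measurable.pred (BGW mu \<Otimes>\<^sub>M field_space lam \<kappa>) (\<lambda>\<omega>. all_below L n x (fst \<omega>) (snd \<omega>))"
proof -
  let ?N = "BGW mu \<Otimes>\<^sub>M (field_space lam \<kappa> :: (nat list \<Rightarrow> nat list \<Rightarrow> nat list) measure)"
  have 1: "Measurable.pred ?N (\<lambda>\<omega>. in_tree (fst \<omega>) u)" for u
    by (rule measurable_compose[OF measurable_fst measurable_in_tree])
  have 2: "(\<lambda>\<omega>. brw_from (snd \<omega>) x u) \<in> ?N \<rightarrow>\<^sub>M count_space UNIV" for u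
    by (rule measurable_compose[OF measurable_snd measurable_brw_from])
  have 3: "Measurable.pred ?N (\<lambda>\<omega>. length (brw_from (snd \<omega>) x u) < L)" for u
    by (rule measurable_compose[OF 2]) simp
  have "Measurable.pred ?N (\<lambda>\<omega>. length u = n \<and> in_tree (fst \<omega>) u \<longrightarrow> length (brw_from (snd \<omega>) x u) < L)" for u
  proof (cases "length u = n")
    case True
    show ?thesis unfolding True simp_thms by (rule pred_intros_logic(4)[OF 1 3])
  next
    case False
    then show ?thesis by (simp only: simp_thms) (rule measurable_const, simp)
  qed
  then show ?thesis unfolding all_below_def by (rule pred_intros_countable(1))
qed

lemma distr_shift_field:
  "distr (field_space lam \<kappa>) (field_space lam \<kappa>) (\<lambda>(c :: nat list \<Rightarrow> _) w. c (i # w)) = field_space lam \<kappa>"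
proof -
  have "distr (PiM UNIV (\<lambda>_. step_field lam \<kappa>)) (PiM UNIV (\<lambda>_. step_field lam \<kappa>)) (\<lambda>\<omega>. \<lambda>w\<in>UNIV. \<omega> (i # w)) =
      PiM UNIV (\<lambda>_. step_field lam \<kappa>)"
    by (rule distr_PiM_reindex) (auto intro: prob_space_step_field injI)
  then show ?thesis unfolding field_space_def by (simp add: restrict_UNIV)
qed

text \<open>Displacements are averaged for a frozen genealogy, which fixes the number of factors in
  the branching recursion; the genealogy is averaged afterwards.\<close>

definition below_prob :: "real \<Rightarrow> (nat list \<Rightarrow> nat) \<Rightarrow> nat \<Rightarrow> nat \<Rightarrow> nat list \<Rightarrow> (nat list \<Rightarrow> nat) \<Rightarrow> ennreal" where
  "below_prob lam \<kappa> L n x \<nu> = (\<integral>\<^sup>+ch. (if all_below L n x \<nu> ch then 1 else 0) \<partial>field_space lam \<kappa>)"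

lemma measurable_all_below_field:
  "Measurable.pred (field_space lam \<kappa>) (all_below L n x \<nu>)"
proof -
  have "Measurable.pred (field_space lam \<kappa>) (\<lambda>ch. length (brw_from ch x u) < L)" for u
    by (rule measurable_compose[OF measurable_brw_from]) simp
  then have "Measurable.pred (field_space lam \<kappa>) (\<lambda>ch. length u = n \<and> in_tree \<nu> u \<longrightarrow> length (brw_from ch x u) < L)" for u
    by (cases "length u = n \<and> in_tree \<nu> u") simp_all
  then show ?thesis unfolding all_below_def[abs_def] by (rule pred_intros_countable(1))
qed

lemma measurable_below_prob: "below_prob lam \<kappa> L n x \<in> borel_measurable (BGW mu)"
proof -
  interpret prob_space "field_space lam \<kappa> :: (nat list \<Rightarrow> _) measure" by (rule prob_space_field_space)
  have "(\<lambda>\<omega>. if all_below L n x (fst \<omega>) (snd \<omega>) then 1 else 0 :: ennreal) \<in>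
      borel_measurable (BGW mu \<Otimes>\<^sub>M field_space lam \<kappa>)"
    by measurable
  from borel_measurable_nn_integral_fst[OF this] show ?thesis by (simp add: below_prob_def[abs_def])
qed

lemma below_prob_0: "below_prob lam \<kappa> L 0 x \<nu> = (if length x < L then 1 else 0)"
  by (auto simp: below_prob_def all_below_def in_tree_def)

text \<open>After a shift by i the displacement of the child sits at index [] and those of its
  descendants at nonempty indices, so the two are independent.\<close>

lemma below_prob_first_step:
  assumes "leafless \<kappa>"
  shows "(\<integral>\<^sup>+ch. (if all_below L n (ch [i] x) \<nu> (\<lambda>w. ch (i # w)) then 1 else 0) \<partial>field_space lam \<kappa>) =
    (\<integral>\<^sup>+y. below_prob lam \<kappa> L n y \<nu> \<partial>step_pmf lam \<kappa> x)"
proof -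
  let ?F = "field_space lam \<kappa> :: (nat list \<Rightarrow> nat list \<Rightarrow> nat list) measure"
  have m: "(\<lambda>ch. if all_below L n (ch [] x) \<nu> ch then 1 else 0 :: ennreal) \<in> borel_measurable ?F"
    by (rule measurable_compose_countable[where f = "\<lambda>y ch. if all_below L n y \<nu> ch then 1 else 0"])
      (use measurable_all_below_field in measurable, rule measurable_field_space)
  have "(\<integral>\<^sup>+ch. (if all_below L n (ch [i] x) \<nu> (\<lambda>w. ch (i # w)) then 1 else 0) \<partial>?F) =
      (\<integral>\<^sup>+ch. (if all_below L n (ch [] x) \<nu> ch then 1 else 0) \<partial>distr ?F ?F (\<lambda>c w. c (i # w)))"
    by (subst nn_integral_distr) (use m measurable_shift_field in auto)
  also have "\<dots> = (\<integral>\<^sup>+ch. (if all_below L n (ch [] x) \<nu> ch then 1 else 0) \<partial>?F)"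
    unfolding distr_shift_field ..
  also have "\<dots> = (\<integral>\<^sup>+ch. below_prob lam \<kappa> L n (ch [] x) \<nu> \<partial>?F)"
  proof (rule nn_integral_cong_fibres[where X = "\<lambda>ch. ch [] x"])
    fix y :: "nat list"
    have "(\<lambda>ch :: nat list \<Rightarrow> nat list \<Rightarrow> nat list. indicator {y} (ch [] x)) \<in> borel_measurable ?F"
      by (rule measurable_compose[OF measurable_field_space]) simp
    also have "(\<lambda>ch :: nat list \<Rightarrow> nat list \<Rightarrow> nat list. indicator {y} (ch [] x)) = (\<lambda>ch. indicator {ch :: nat list \<Rightarrow> nat list \<Rightarrow> nat list. ch [] x = y} ch :: ennreal)"
      by (auto simp: indicator_def)
    finally have im: "(\<lambda>ch. indicator {ch :: nat list \<Rightarrow> nat list \<Rightarrow> nat list. ch [] x = y} ch :: ennreal) \<in> borel_measurable ?F" .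
    let ?a = "\<lambda>ch :: nat list \<Rightarrow> nat list \<Rightarrow> nat list. if all_below L n y \<nu> ch then 1 else 0 :: ennreal"
    have a[measurable]: "?a \<in> borel_measurable ?F" using measurable_all_below_field by measurable
    have indep: "(\<integral>\<^sup>+ch. indicator {ch :: nat list \<Rightarrow> nat list \<Rightarrow> nat list. ch [] x = y} ch * ?a ch \<partial>?F) =
        (\<integral>\<^sup>+ch. indicator {ch :: nat list \<Rightarrow> nat list \<Rightarrow> nat list. ch [] x = y} ch \<partial>?F) * (\<integral>\<^sup>+ch. ?a ch \<partial>?F)"
      unfolding field_space_def
    proof (rule nn_integral_mult_disjoint_coordinates[where A = "{[]}" and B = "- {[]}"])
      show "?a ch = ?a ch'" if "\<And>w. w \<in> - {[]} \<Longrightarrow> ch w = ch' w" for ch ch'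
      proof -
        have "brw_from ch y u = brw_from ch' y u" for u by (rule brw_from_cong) (use that in auto)
        then show ?thesis by (simp add: all_below_def)
      qed
      show "?a \<in> borel_measurable (PiM UNIV (\<lambda>_. step_field lam \<kappa>))" using a by (simp add: field_space_def)
      show "(\<lambda>ch. indicator {ch :: nat list \<Rightarrow> nat list \<Rightarrow> nat list. ch [] x = y} ch :: ennreal) \<in> borel_measurable (PiM UNIV (\<lambda>_. step_field lam \<kappa>))"
        using im unfolding field_space_def .
      show "indicator {ch :: nat list \<Rightarrow> nat list \<Rightarrow> nat list. ch [] x = y} ch = (indicator {ch :: nat list \<Rightarrow> nat list \<Rightarrow> nat list. ch [] x = y} ch' :: ennreal)"
        if "\<And>w. w \<in> {[]} \<Longrightarrow> ch w = ch' w" for ch ch' :: "nat list \<Rightarrow> nat list \<Rightarrow> nat list"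
        using that[of "[]"] by (simp add: indicator_def)
    qed (auto intro: prob_space_step_field)
    have "(\<integral>\<^sup>+ch. (if all_below L n (ch [] x) \<nu> ch then 1 else 0) * indicator {ch :: nat list \<Rightarrow> nat list \<Rightarrow> nat list. ch [] x = y} ch \<partial>?F) =
        (\<integral>\<^sup>+ch. indicator {ch :: nat list \<Rightarrow> nat list \<Rightarrow> nat list. ch [] x = y} ch * ?a ch \<partial>?F)"
      by (intro nn_integral_cong) (auto simp: indicator_def)
    also have "\<dots> = (\<integral>\<^sup>+ch. indicator {ch :: nat list \<Rightarrow> nat list \<Rightarrow> nat list. ch [] x = y} ch * below_prob lam \<kappa> L n y \<nu> \<partial>?F)"
      unfolding indep below_prob_def[symmetric] by (rule nn_integral_multc[OF im, symmetric])
    also have "\<dots> = (\<integral>\<^sup>+ch. below_prob lam \<kappa> L n (ch [] x) \<nu> * indicator {ch :: nat list \<Rightarrow> nat list \<Rightarrow> nat list. ch [] x = y} ch \<partial>?F)"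
      by (intro nn_integral_cong) (auto simp: indicator_def)
    finally show "(\<integral>\<^sup>+ch. (if all_below L n (ch [] x) \<nu> ch then 1 else 0) * indicator {ch :: nat list \<Rightarrow> nat list \<Rightarrow> nat list. ch [] x = y} ch \<partial>?F) =
        (\<integral>\<^sup>+ch. below_prob lam \<kappa> L n (ch [] x) \<nu> * indicator {ch :: nat list \<Rightarrow> nat list \<Rightarrow> nat list. ch [] x = y} ch \<partial>?F)" .
  qed (rule measurable_field_space, rule m, rule measurable_compose[OF measurable_field_space], simp)
  also have "\<dots> = (\<integral>\<^sup>+y. below_prob lam \<kappa> L n y \<nu> \<partial>step_pmf lam \<kappa> x)"
    by (rule nn_integral_field_space)
  finally show ?thesis .
qed

lemma below_prob_Suc:
  assumes "leafless \<kappa>"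
  shows "below_prob lam \<kappa> L (Suc n) x \<nu> =
    (\<Prod>i<\<nu> []. \<integral>\<^sup>+y. below_prob lam \<kappa> L n y (subtree [i] \<nu>) \<partial>step_pmf lam \<kappa> x)"
proof -
  let ?F = "field_space lam \<kappa> :: (nat list \<Rightarrow> nat list \<Rightarrow> nat list) measure"
  let ?a = "\<lambda>i (ch :: nat list \<Rightarrow> nat list \<Rightarrow> nat list). if all_below L n (ch [i] x) (subtree [i] \<nu>) (\<lambda>w. ch (i # w)) then 1 else 0 :: ennreal"
  have "below_prob lam \<kappa> L (Suc n) x \<nu> = (\<integral>\<^sup>+ch. (\<Prod>i<\<nu> []. ?a i ch) \<partial>?F)"
    unfolding below_prob_def all_below_Suc
    by (intro nn_integral_cong) (auto simp: prod_zero_iff)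
  also have "\<dots> = (\<Prod>i<\<nu> []. \<integral>\<^sup>+ch. ?a i ch \<partial>?F)"
    unfolding field_space_def
  proof (rule nn_integral_prod_disjoint_coordinates[where A = "\<lambda>i. range ((#) i)"])
    fix i
    show "?a i \<in> borel_measurable (PiM UNIV (\<lambda>_. step_field lam \<kappa>))"
      unfolding field_space_def[symmetric]
    proof (rule measurable_compose_countable[where f = "\<lambda>y ch. if all_below L n y (subtree [i] \<nu>) (\<lambda>w. ch (i # w)) then 1 else 0"])
      fix y
      have "(\<lambda>ch. if all_below L n y (subtree [i] \<nu>) ch then 1 else 0 :: ennreal) \<in> borel_measurable ?F"
        using measurable_all_below_field by measurable
      from measurable_compose[OF measurable_shift_field this]
      show "(\<lambda>ch. if all_below L n y (subtree [i] \<nu>) (\<lambda>w. ch (i # w)) then 1 else 0 :: ennreal) \<in> borel_measurable ?F" .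
    qed (rule measurable_field_space)
    show "?a i ch = ?a i ch'" if "\<And>w. w \<in> range ((#) i) \<Longrightarrow> ch w = ch' w" for ch ch'
    proof -
      have "(\<lambda>w. ch (i # w)) = (\<lambda>w. ch' (i # w))" using that by auto
      moreover from fun_cong[OF this, of "[]"] have "ch [i] = ch' [i]" by simp
      ultimately show ?thesis by simp
    qed
  qed (auto simp: disjoint_family_on_def intro: prob_space_step_field)
  finally show ?thesis unfolding below_prob_first_step[OF assms] .
qed

lemma nn_integral_step_pmf_swap:
  assumes "leafless \<kappa>" "\<And>y. f y \<in> borel_measurable M"
  shows "(\<integral>\<^sup>+\<omega>. (\<integral>\<^sup>+y. f y \<omega> \<partial>step_pmf lam \<kappa> x) \<partial>M) = (\<integral>\<^sup>+y. (\<integral>\<^sup>+\<omega>. f y \<omega> \<partial>M) \<partial>step_pmf lam \<kappa> x)"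
proof -
  let ?S = "set_pmf (step_pmf lam \<kappa> x)"
  note fin = nn_integral_measure_pmf_finite[OF finite_set_step_pmf[OF assms(1)] zero_le]
  have "(\<integral>\<^sup>+\<omega>. (\<integral>\<^sup>+y. f y \<omega> \<partial>step_pmf lam \<kappa> x) \<partial>M) =
      (\<Sum>y\<in>?S. \<integral>\<^sup>+\<omega>. f y \<omega> * ennreal (pmf (step_pmf lam \<kappa> x) y) \<partial>M)"
    unfolding fin by (rule nn_integral_sum) (use assms(2) in measurable)
  also have "\<dots> = (\<Sum>y\<in>?S. (\<integral>\<^sup>+\<omega>. f y \<omega> \<partial>M) * ennreal (pmf (step_pmf lam \<kappa> x) y))"
    by (rule sum.cong[OF refl], rule nn_integral_multc, rule assms(2))
  finally show ?thesis unfolding fin .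
qed

lemma nn_integral_branching:
  assumes F: "F \<in> borel_measurable (BGW mu)"
  shows "(\<integral>\<^sup>+\<nu>. (\<Prod>i<\<nu> []. F (subtree [i] \<nu>)) \<partial>BGW mu) = (\<integral>\<^sup>+k. (\<integral>\<^sup>+\<nu>. F \<nu> \<partial>BGW mu) ^ k \<partial>mu)"
proof -
  let ?c = "\<integral>\<^sup>+\<nu>. F \<nu> \<partial>BGW mu"
  have Fs[measurable]: "(\<lambda>\<nu>. F (subtree [i] \<nu>)) \<in> borel_measurable (BGW mu)" for i
    by (rule measurable_compose[OF measurable_subtree F])
  have m: "(\<lambda>\<nu>. \<Prod>i<\<nu> []. F (subtree [i] \<nu>)) \<in> borel_measurable (BGW mu)"
    by (rule measurable_compose_countable[where f = "\<lambda>k \<nu>. \<Prod>i<k. F (subtree [i] \<nu>)"]) measurable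
  have "(\<integral>\<^sup>+\<nu>. (\<Prod>i<\<nu> []. F (subtree [i] \<nu>)) \<partial>BGW mu) = (\<integral>\<^sup>+\<nu>. ?c ^ \<nu> [] \<partial>BGW mu)"
  proof (rule nn_integral_cong_fibres[where X = "\<lambda>\<nu>. \<nu> []"])
    fix k :: nat
    \<comment> \<open>In the product over j \<le> k the index k is spare. It carries the indicator
      that the root has k children, so that one independence statement covers it along with the k
      subtrees.\<close>
    define G where "G j = (if j = k then indicator {\<nu>. \<nu> [] = k} else (\<lambda>\<nu>. F (subtree [j] \<nu>)))" for j
    define A where "A j = (if j = k then {[]} else range ((#) j))" for j
    have Gm: "G j \<in> borel_measurable (BGW mu)" for j
      unfolding G_def using Fs by (cases "j = k") simp_all
    have "(\<integral>\<^sup>+\<nu>. (\<Prod>j\<le>k. G j \<nu>) \<partial>BGW mu) = (\<Prod>j\<le>k. \<integral>\<^sup>+\<nu>. G j \<nu> \<partial>BGW mu)"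
      unfolding BGW_def
    proof (rule nn_integral_prod_disjoint_coordinates[where A = A])
      show "G j \<in> borel_measurable (PiM UNIV (\<lambda>_. measure_pmf mu))" for j
        using Gm by (simp add: BGW_def)
      show "G j \<nu> = G j \<nu>'" if "\<And>w. w \<in> A j \<Longrightarrow> \<nu> w = \<nu>' w" for j \<nu> \<nu>'
      proof (cases "j = k")
        case True
        then show ?thesis using that by (simp add: A_def G_def indicator_def)
      next
        case False
        then have "subtree [j] \<nu> = subtree [j] \<nu>'" using that by (simp add: A_def subtree_def fun_eq_iff)
        then show ?thesis using False by (simp add: G_def)
      qed
    qed (auto simp: disjoint_family_on_def A_def intro: prob_space_measure_pmf)
    moreover have "(\<Prod>j\<le>k. G j \<nu>) = (\<Prod>i<\<nu> []. F (subtree [i] \<nu>)) * indicator {\<nu>. \<nu> [] = k} \<nu>" for \<nu>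
    proof -
      have "(\<Prod>j<k. G j \<nu>) = (\<Prod>j<k. F (subtree [j] \<nu>))" by (rule prod.cong) (auto simp: G_def)
      then have "(\<Prod>j\<le>k. G j \<nu>) = (\<Prod>j<k. F (subtree [j] \<nu>)) * indicator {\<nu>. \<nu> [] = k} \<nu>"
        by (simp add: lessThan_Suc_atMost[symmetric] G_def)
      then show ?thesis by (auto simp: indicator_def)
    qed
    moreover have "(\<Prod>j\<le>k. \<integral>\<^sup>+\<nu>. G j \<nu> \<partial>BGW mu) = ?c ^ k * (\<integral>\<^sup>+\<nu>. indicator {\<nu>. \<nu> [] = k} \<nu> \<partial>BGW mu)"
    proof -
      have "(\<Prod>j<k. \<integral>\<^sup>+\<nu>. G j \<nu> \<partial>BGW mu) = (\<Prod>j<k. ?c)"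
        by (rule prod.cong) (auto simp: G_def nn_integral_subtree[OF F])
      then show ?thesis by (simp add: lessThan_Suc_atMost[symmetric] G_def)
    qed
    moreover have "?c ^ k * (\<integral>\<^sup>+\<nu>. indicator {\<nu>. \<nu> [] = k} \<nu> \<partial>BGW mu) = (\<integral>\<^sup>+\<nu>. ?c ^ \<nu> [] * indicator {\<nu>. \<nu> [] = k} \<nu> \<partial>BGW mu)"
    proof -
      have "(\<integral>\<^sup>+\<nu>. ?c ^ \<nu> [] * indicator {\<nu>. \<nu> [] = k} \<nu> \<partial>BGW mu) = (\<integral>\<^sup>+\<nu>. ?c ^ k * indicator {\<nu>. \<nu> [] = k} \<nu> \<partial>BGW mu)"
        by (intro nn_integral_cong) (auto simp: indicator_def)
      also have "\<dots> = ?c ^ k * (\<integral>\<^sup>+\<nu>. indicator {\<nu>. \<nu> [] = k} \<nu> \<partial>BGW mu)"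
        by (subst nn_integral_cmult) measurable
      finally show ?thesis ..
    qed
    ultimately show "(\<integral>\<^sup>+\<nu>. (\<Prod>i<\<nu> []. F (subtree [i] \<nu>)) * indicator {\<nu>. \<nu> [] = k} \<nu> \<partial>BGW mu) =
        (\<integral>\<^sup>+\<nu>. ?c ^ \<nu> [] * indicator {\<nu>. \<nu> [] = k} \<nu> \<partial>BGW mu)" by simp
  qed (use m in \<open>auto intro: measurable_compose[OF measurable_BGW_component]\<close>)
  also have "\<dots> = (\<integral>\<^sup>+k. ?c ^ k \<partial>distr (BGW mu) (measure_pmf mu) (\<lambda>\<nu>. \<nu> []))"
    using measurable_BGW_component[of "[]" mu] by (subst nn_integral_distr) auto
  also have "distr (BGW mu) (measure_pmf mu) (\<lambda>\<nu>. \<nu> []) = measure_pmf mu"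
    unfolding BGW_def by (rule distr_PiM_component) (auto intro: prob_space_measure_pmf)
  finally show ?thesis .
qed

text \<open>Gives the recursion \<open>miss_prob\<close> its probabilistic meaning: independent
  displacements of siblings produce a product, and independent subtrees turn it into a power of one
  number, whose mean is \<open>pgf\<close>.\<close>

lemma nn_integral_below_prob:
  assumes "0 < lam" "leafless \<kappa>" "pmf mu 0 = 0" "integrable (measure_pmf mu) real"
  shows "(\<integral>\<^sup>+\<nu>. below_prob lam \<kappa> L n x \<nu> \<partial>BGW mu) = ennreal (miss_prob mu lam \<kappa> L n x)"
proof (induction n arbitrary: x)
  case 0
  interpret prob_space "BGW mu" by (rule prob_space_BGW)
  show ?case by (simp add: below_prob_0 emeasure_space_1[simplified])
next
  case (Suc n)
  note m = measurable_below_prob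
  define F where "F \<nu> = (\<integral>\<^sup>+y. below_prob lam \<kappa> L n y \<nu> \<partial>step_pmf lam \<kappa> x)" for \<nu>
  define r where "r = step_mean lam 0 \<kappa> (miss_prob mu lam \<kappa> L n) x"
  have r: "0 \<le> r" "r \<le> 1"
    unfolding r_def using step_mean_01[OF assms, where g = "miss_prob mu lam \<kappa> L n" and e = 0 and x = x] miss_prob_bounds[OF assms] by auto
  have Fm: "F \<in> borel_measurable (BGW mu)"
    unfolding F_def nn_integral_measure_pmf_finite[OF finite_set_step_pmf[OF assms(2)]] using m by measurable
  have "(\<integral>\<^sup>+\<nu>. F \<nu> \<partial>BGW mu) = (\<integral>\<^sup>+y. ennreal (miss_prob mu lam \<kappa> L n y) \<partial>step_pmf lam \<kappa> x)"
    unfolding F_def by (subst nn_integral_step_pmf_swap[OF assms(2) m]) (simp add: Suc)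
  also have "\<dots> = ennreal r"
    unfolding r_def using miss_prob_bounds[OF assms] by (intro nn_integral_step_pmf assms) auto
  finally have c: "(\<integral>\<^sup>+\<nu>. F \<nu> \<partial>BGW mu) = ennreal r" .
  have "(\<integral>\<^sup>+\<nu>. below_prob lam \<kappa> L (Suc n) x \<nu> \<partial>BGW mu) = (\<integral>\<^sup>+k. ennreal r ^ k \<partial>mu)"
    unfolding below_prob_Suc[OF assms(2)] F_def[symmetric] nn_integral_branching[OF Fm] c ..
  also have "\<dots> = (\<integral>\<^sup>+k. ennreal (r ^ k) \<partial>mu)" using r by (simp add: ennreal_power)
  also have "\<dots> = ennreal (pgf mu r)"
    unfolding pgf_def using r by (intro nn_integral_eq_integral integrable_pgf) auto
  finally show ?case by (simp add: r_def)
qed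

lemma emeasure_all_below:
  assumes "0 < lam" "leafless \<kappa>" "pmf mu 0 = 0" "integrable (measure_pmf mu) real"
  shows "emeasure (BRW_quenched lam mu \<kappa>) {\<omega>. all_below L n [] (fst \<omega>) (snd \<omega>)} = ennreal (miss_prob mu lam \<kappa> L n [])"
proof -
  interpret prob_space "field_space lam \<kappa> :: (nat list \<Rightarrow> _) measure" by (rule prob_space_field_space)
  let ?P = "BGW mu \<Otimes>\<^sub>M (field_space lam \<kappa> :: (nat list \<Rightarrow> _) measure)"
  have sp: "space ?P = UNIV" by (simp only: space_pair_measure space_BGW space_field_space UNIV_Times_UNIV)
  have set: "{\<omega>. all_below L n [] (fst \<omega>) (snd \<omega>)} \<in> sets ?P"
  proof -
    have "{\<omega> \<in> space ?P. all_below L n [] (fst \<omega>) (snd \<omega>)} \<in> sets ?P"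
      by (rule predE[OF measurable_all_below])
    then show ?thesis by (simp only: sp UNIV_I simp_thms)
  qed
  have "emeasure ?P {\<omega>. all_below L n [] (fst \<omega>) (snd \<omega>)} =
      (\<integral>\<^sup>+\<omega>. (if all_below L n [] (fst \<omega>) (snd \<omega>) then 1 else 0) \<partial>?P)"
    unfolding nn_integral_indicator[OF set, symmetric] by (intro nn_integral_cong) (simp add: indicator_def)
  also have "\<dots> = (\<integral>\<^sup>+\<nu>. below_prob lam \<kappa> L n [] \<nu> \<partial>BGW mu)"
  proof -
    have "(\<lambda>\<omega>. if all_below L n [] (fst \<omega>) (snd \<omega>) then 1 else 0 :: ennreal) \<in> borel_measurable ?P"
      by measurable
    from nn_integral_fst[OF this, symmetric] show ?thesis by (simp add: below_prob_def)
  qed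
  finally show ?thesis unfolding BRW_quenched_eq nn_integral_below_prob[OF assms] .
qed

section \<open>Large deviations\<close>

definition dev :: "real \<Rightarrow> (nat list \<Rightarrow> nat) \<Rightarrow> nat \<Rightarrow> real \<Rightarrow> real" where
  "dev lam \<kappa> n a = walk_mean lam \<kappa> n (\<lambda>y. if a * real n \<le> real (length y) then 1 else 0) []"

locale walk_with_rate =
  fixes p :: "nat pmf" and lam v :: real and I :: "real \<Rightarrow> real"
  assumes lam: "0 < lam" and p0: "pmf p 0 = 0" and v: "0 \<le> v" "v \<le> 1" and rate: "is_rate_fn p lam v I"
begin

lemma I_cont: "continuous_on {v..1} I" and I_convex: "convex_on {v..1} I"
  and I_mono: "strict_mono_on {v..1} I" and I_v: "I v = 0" and I_nonneg: "a \<in> {v..1} \<Longrightarrow> 0 \<le> I a"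
  using rate by (auto simp: is_rate_fn_def)

lemma I_pos: "v < a \<Longrightarrow> a \<le> 1 \<Longrightarrow> 0 < I a"
  using strict_mono_onD[OF I_mono, of v a] I_v v by auto

lemma I_le_convex:
  assumes "v < y" "y \<le> 1" "v \<le> x" "x \<le> y"
  shows "I x \<le> (x - v) / (y - v) * I y"
proof -
  let ?t = "(x - v) / (y - v)"
  have t: "0 \<le> ?t" "?t \<le> 1" using assms by (auto simp: field_simps)
  have "I ((1 - ?t) *\<^sub>R v + ?t *\<^sub>R y) \<le> (1 - ?t) * I v + ?t * I y"
    by (rule convex_onD[OF I_convex t]) (use assms in auto)
  moreover have "(1 - ?t) *\<^sub>R v + ?t *\<^sub>R y = x"
  proof -
    have "(1 - s) *\<^sub>R v + s *\<^sub>R y = v + s * (y - v)" for s by (simp add: algebra_simps)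
    from this[of ?t] show ?thesis using assms by simp
  qed
  ultimately show ?thesis by (simp add: I_v)
qed

text \<open>Convexity and I v = 0 with v \<ge> 0. I x / x is the cost of one level gained at speed
  x; any speed from b on thus costs at least I b / b per level.\<close>

lemma slope_mono:
  assumes "v < x" "x \<le> y" "y \<le> 1"
  shows "I x / x \<le> I y / y"
proof -
  have "(x - v) / (y - v) \<le> x / y" using assms v mult_left_mono[of x y v] by (simp add: field_simps)
  then have "(x - v) / (y - v) * I y \<le> x / y * I y"
    using I_nonneg[of y] assms by (intro mult_right_mono) auto
  with I_le_convex[of y x] assms have "I x \<le> x / y * I y" by simp
  then show ?thesis using assms v by (simp add: field_simps)
qed

text \<open>The interval [a, 2) replaces [a, 1], as n steps never lead beyond level n.\<close>

lemma dev_limit: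
  assumes "v < a" "a \<le> 1"
  shows "AE \<kappa> in BGW p. (\<lambda>n. ln (dev lam \<kappa> n a) / real n) \<longlonglongrightarrow> - I a"
proof -
  have "AE \<kappa> in BGW p. (\<lambda>n. ln (measure (walk_space lam \<kappa>)
                  {c \<in> space (walk_space lam \<kappa>). real (length (walk_pos c n)) / real n \<in> {a..<2}}) / real n) \<longlonglongrightarrow> - I a"
    using rate assms unfolding is_rate_fn_def by auto
  with AE_BGW_leafless[OF p0] show ?thesis
  proof eventually_elim
    case (elim \<kappa>)
    have "ln (measure (walk_space lam \<kappa>)
        {c \<in> space (walk_space lam \<kappa>). real (length (walk_pos c n)) / real n \<in> {a..<2}}) / real n =
        ln (dev lam \<kappa> n a) / real n" for n
    proof (cases "n = 0")
      case False
      have root: "in_tree \<kappa> []" by (simp add: in_tree_def)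
      have "walk_mean lam \<kappa> n (\<lambda>y. if real (length y) / real n \<in> {a..<2} then 1 else 0) [] = dev lam \<kappa> n a"
        unfolding dev_def
        by (intro antisym walk_mean_mono_tree[OF lam elim(1) root]) (use False in \<open>auto simp: field_simps\<close>)
      then show ?thesis
        unfolding measure_walk_pos[OF lam elim(1), of "\<lambda>y. real (length y) / real n \<in> {a..<2}"] by simp
    qed simp
    then show ?case using elim(2) by (simp only:)
  qed
qed

lemma dev_nonneg: "leafless \<kappa> \<Longrightarrow> 0 \<le> dev lam \<kappa> n a"
  unfolding dev_def by (rule walk_mean_nonneg[OF lam]) auto

lemma dev_bounds:
  assumes "v < a" "a \<le> 1" "0 < \<epsilon>"
  shows "AE \<kappa> in BGW p. \<forall>\<^sub>F n in sequentially.
    exp (- (I a + \<epsilon>) * real n) \<le> dev lam \<kappa> n a \<and> dev lam \<kappa> n a \<le> exp (- (I a - \<epsilon>) * real n)"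
  using AE_BGW_leafless[OF p0] dev_limit[OF assms(1,2)]
proof eventually_elim
  case (elim \<kappa>)
  \<comment> \<open>Capping the tolerance at I a makes the logarithm strictly negative
    below.\<close>
  let ?e = "min \<epsilon> (I a)"
  have e: "0 < ?e" using assms I_pos by simp
  have "\<forall>\<^sub>F n in sequentially. - I a - ?e < ln (dev lam \<kappa> n a) / real n"
    by (rule order_tendstoD(1)[OF elim(2)]) (use e in linarith)
  moreover have "\<forall>\<^sub>F n in sequentially. ln (dev lam \<kappa> n a) / real n < - I a + ?e"
    by (rule order_tendstoD(2)[OF elim(2)]) (use e in linarith)
  ultimately show ?case using eventually_gt_at_top[of 0]
  proof eventually_elim
    case (elim n)
    have ln: "- (I a + ?e) * real n < ln (dev lam \<kappa> n a)" "ln (dev lam \<kappa> n a) < - (I a - ?e) * real n"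
      using elim pos_less_divide_eq[of "real n" "- I a - ?e" "ln (dev lam \<kappa> n a)"]
        pos_divide_less_eq[of "real n" "ln (dev lam \<kappa> n a)" "- I a + ?e"] by auto
    have "- (I a - ?e) * real n \<le> 0" by (intro mult_nonpos_nonneg) auto
    then have "ln (dev lam \<kappa> n a) < 0" using ln by linarith
    \<comment> \<open>ln 0 = 0, so a negative logarithm excludes that the probability vanishes.\<close>
    then have pos: "0 < dev lam \<kappa> n a" using dev_nonneg[OF \<open>leafless \<kappa>\<close>, of n a] by (cases "dev lam \<kappa> n a = 0") auto
    have "- (I a + \<epsilon>) * real n \<le> - (I a + ?e) * real n" "- (I a - ?e) * real n \<le> - (I a - \<epsilon>) * real n"
      by (auto intro!: mult_right_mono)
    with ln have "- (I a + \<epsilon>) * real n \<le> ln (dev lam \<kappa> n a)" "ln (dev lam \<kappa> n a) \<le> - (I a - \<epsilon>) * real n" by linarith+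
    then have "exp (- (I a + \<epsilon>) * real n) \<le> exp (ln (dev lam \<kappa> n a))" "exp (ln (dev lam \<kappa> n a)) \<le> exp (- (I a - \<epsilon>) * real n)"
      by simp_all
    then show ?case using pos by simp
  qed
qed

text \<open>Early arrival at level \<alpha> T means moving at a speed x > \<alpha>, which costs
T \<alpha> (I x / x) > T I \<alpha> on the exponential scale.\<close>
lemma early_hits:
  assumes \<alpha>: "v < \<alpha>" "\<alpha> \<le> 1" and ext: "\<And>x. \<lbrakk>\<alpha> < x; x \<le> 1\<rbrakk> \<Longrightarrow> I \<alpha> / \<alpha> < I x / x"
    and \<eta>: "0 < \<eta>" "\<eta> < 1" and \<epsilon>0: "0 < \<epsilon>0"
  obtains \<epsilon> where "0 < \<epsilon>" "\<epsilon> \<le> \<epsilon>0"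
    "AE \<kappa> in BGW p. \<forall>\<^sub>F T in sequentially. \<forall>t. real t \<le> (1 - \<eta>) * real T \<longrightarrow>
      walk_mean lam \<kappa> t (\<lambda>y. if nat \<lceil>\<alpha> * real T\<rceil> \<le> length y then 1 else 0) [] \<le> exp (- (I \<alpha> + 2 * \<epsilon>) * real T)"
proof (cases "\<alpha> = 1")
  case True
  have "AE \<kappa> in BGW p. \<forall>\<^sub>F T in sequentially. \<forall>t. real t \<le> (1 - \<eta>) * real T \<longrightarrow>
      walk_mean lam \<kappa> t (\<lambda>y. if nat \<lceil>\<alpha> * real T\<rceil> \<le> length y then 1 else 0) [] \<le> exp (- (I \<alpha> + 2 * \<epsilon>0) * real T)"
    using AE_BGW_leafless[OF p0]
  proof eventually_elim
    case (elim \<kappa>)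
    show ?case using eventually_gt_at_top[of 0]
    proof eventually_elim
      case (elim T)
      show ?case
      proof (intro allI impI)
        fix t assume "real t \<le> (1 - \<eta>) * real T"
        moreover have "(1 - \<eta>) * real T < 1 * real T" using elim \<eta> by (intro mult_strict_right_mono) auto
        ultimately have "t < T" by simp
        then have "walk_mean lam \<kappa> t (\<lambda>y. if nat \<lceil>\<alpha> * real T\<rceil> \<le> length y then 1 else 0) [] = 0"
          using True by (intro walk_mean_far[OF lam \<open>leafless \<kappa>\<close>]) simp
        then show "walk_mean lam \<kappa> t (\<lambda>y. if nat \<lceil>\<alpha> * real T\<rceil> \<le> length y then 1 else 0) [] \<le> exp (- (I \<alpha> + 2 * \<epsilon>0) * real T)"
          by (simp only: exp_ge_zero)
      qed
    qed
  qed
  then show ?thesis using that \<epsilon>0 by blast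
next
  case False
  then have \<alpha>1: "\<alpha> < 1" "0 < \<alpha>" using \<alpha> v by auto
  have "\<alpha> < \<alpha> / (1 - \<eta>)" using \<eta> \<alpha>1 by (simp add: field_simps)
  \<comment> \<open>A hit by time (1 - \<eta>) T has speed at least \<alpha> / (1 - \<eta>) > b and
    so costs at least c = I b / b per level, strictly more than at speed \<alpha>. A quarter of the
    gap c * \<alpha> - I \<alpha> leaves room for the rounding error, the tolerance of the deviation
    bound and the 2 * \<epsilon> of the conclusion.\<close>
  then obtain b where b: "\<alpha> < b" "b < min 1 (\<alpha> / (1 - \<eta>))" using dense[of \<alpha> "min 1 (\<alpha> / (1 - \<eta>))"] \<alpha>1 by auto
  define c where "c = I b / b"
  have c: "I \<alpha> < c * \<alpha>" "0 < c"
    using ext[of b] b \<alpha>1 I_pos[of b] \<alpha> by (auto simp: c_def field_simps)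
  define \<epsilon> where "\<epsilon> = min \<epsilon>0 ((c * \<alpha> - I \<alpha>) / 4)"
  have "0 < \<epsilon>" unfolding \<epsilon>_def using c \<epsilon>0 by simp
  moreover have "\<epsilon> \<le> \<epsilon>0" "\<epsilon> \<le> (c * \<alpha> - I \<alpha>) / 4"
    unfolding \<epsilon>_def by (rule min.cobounded1, rule min.cobounded2)
  ultimately have \<epsilon>: "0 < \<epsilon>" "\<epsilon> \<le> \<epsilon>0" "I \<alpha> + 4 * \<epsilon> \<le> c * \<alpha>"
    by (auto simp: field_simps)
  \<comment> \<open>The deviation bound holds for one speed at a time. Rounding speeds down to
    multiples of 1 / N leaves finitely many; N is so large that rounding stays above b and costs at
    most \<epsilon>.\<close>
  obtain N :: nat where N: "1 / (\<alpha> / (1 - \<eta>) - b) < real N" "c / \<epsilon> < real N"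
    by (metis dual_order.strict_trans1 reals_Archimedean2 linorder_le_cases)
  have N0: "0 < real N" using N(2) c \<epsilon> by (meson divide_pos_pos less_trans)
  have N1: "1 / real N \<le> \<alpha> / (1 - \<eta>) - b" "c / real N \<le> \<epsilon>"
    using N N0 b \<epsilon> by (auto simp: field_simps)
  have "AE \<kappa> in BGW p. \<forall>k\<in>{k. v < real k / real N \<and> real k / real N \<le> 1}. \<forall>\<^sub>F n in sequentially.
      dev lam \<kappa> n (real k / real N) \<le> exp (- (I (real k / real N) - \<epsilon>) * real n)"
  proof (subst AE_ball_countable)
    show "\<forall>k\<in>{k. v < real k / real N \<and> real k / real N \<le> 1}. AE \<kappa> in BGW p. \<forall>\<^sub>F n in sequentially.
        dev lam \<kappa> n (real k / real N) \<le> exp (- (I (real k / real N) - \<epsilon>) * real n)"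
    proof
      fix k assume "k \<in> {k. v < real k / real N \<and> real k / real N \<le> 1}"
      then have "AE \<kappa> in BGW p. \<forall>\<^sub>F n in sequentially.
          exp (- (I (real k / real N) + \<epsilon>) * real n) \<le> dev lam \<kappa> n (real k / real N) \<and>
          dev lam \<kappa> n (real k / real N) \<le> exp (- (I (real k / real N) - \<epsilon>) * real n)"
        using \<epsilon>(1) by (intro dev_bounds) auto
      then show "AE \<kappa> in BGW p. \<forall>\<^sub>F n in sequentially.
          dev lam \<kappa> n (real k / real N) \<le> exp (- (I (real k / real N) - \<epsilon>) * real n)"
        by eventually_elim (auto elim!: eventually_mono)
    qed
  qed simp
  then have "AE \<kappa> in BGW p. \<forall>\<^sub>F T in sequentially. \<forall>t. real t \<le> (1 - \<eta>) * real T \<longrightarrow>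
      walk_mean lam \<kappa> t (\<lambda>y. if nat \<lceil>\<alpha> * real T\<rceil> \<le> length y then 1 else 0) [] \<le> exp (- (I \<alpha> + 2 * \<epsilon>) * real T)"
    using AE_BGW_leafless[OF p0]
  proof eventually_elim
    case (elim \<kappa>)
    let ?K = "{k. v < real k / real N \<and> real k / real N \<le> 1}"
    have "finite ?K" by (rule finite_subset[of _ "{..N}"]) (use N0 in \<open>auto simp: field_simps\<close>)
    then have "\<forall>\<^sub>F n in sequentially. \<forall>k\<in>?K. dev lam \<kappa> n (real k / real N) \<le> exp (- (I (real k / real N) - \<epsilon>) * real n)"
      using elim(1) by (rule eventually_ball_finite)
    then obtain n0 where n0: "\<And>n k. n0 \<le> n \<Longrightarrow> k \<in> ?K \<Longrightarrow> dev lam \<kappa> n (real k / real N) \<le> exp (- (I (real k / real N) - \<epsilon>) * real n)"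
      unfolding eventually_sequentially by blast
    show ?case using eventually_ge_at_top[of "nat \<lceil>real n0 / \<alpha>\<rceil> + 1"]
    proof eventually_elim
      case (elim T)
      have T: "real n0 / \<alpha> < real T" using elim by linarith
      show ?case
      proof (intro allI impI)
        fix t assume t: "real t \<le> (1 - \<eta>) * real T"
        let ?w = "walk_mean lam \<kappa> t (\<lambda>y. if nat \<lceil>\<alpha> * real T\<rceil> \<le> length y then 1 else 0) []"
        show "?w \<le> exp (- (I \<alpha> + 2 * \<epsilon>) * real T)"
        proof (cases "t < nat \<lceil>\<alpha> * real T\<rceil>")
          case True
          then have "?w = 0" by (intro walk_mean_far[OF lam \<open>leafless \<kappa>\<close>]) simp
          then show ?thesis by (simp only: exp_ge_zero)
        next
          case False
          \<comment> \<open>Thus t grows with T, and the eventual bounds at the grid speeds are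
            available at time t.\<close>
          then have t\<alpha>: "\<alpha> * real T \<le> real t" by linarith
          have T0: "0 < real T" using T \<alpha>1 by (meson divide_nonneg_pos le_less_trans of_nat_0_le_iff)
          have t0: "0 < real t" using t\<alpha> mult_pos_pos[OF \<alpha>1(2) T0] by linarith
          have "(1 - \<eta>) * real T \<le> 1 * real T" using \<eta> T0 by (intro mult_right_mono) auto
          with t have tT: "real t \<le> real T" by linarith
          have "real n0 < \<alpha> * real T" using T \<alpha>1 by (simp add: field_simps)
          then have tn: "n0 \<le> t" using t\<alpha> by linarith
          define x where "x = \<alpha> * real T / real t"
          have x: "x \<le> 1" "\<alpha> / (1 - \<eta>) \<le> x"
          proof -
            show "x \<le> 1" using t\<alpha> t0 by (simp add: x_def field_simps)
            have "\<alpha> * real t \<le> \<alpha> * ((1 - \<eta>) * real T)" using t \<alpha>1 by (intro mult_left_mono) auto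
            then show "\<alpha> / (1 - \<eta>) \<le> x" using t0 \<eta> by (simp add: x_def field_simps)
          qed
          define k where "k = nat \<lfloor>real N * x\<rfloor>"
          have x0: "0 \<le> x" using t0 T0 \<alpha>1 by (simp add: x_def)
          have Nx: "0 \<le> real N * x" using x0 N0 by simp
          have "real k \<le> real N * x" unfolding k_def using Nx by (rule of_nat_floor)
          moreover have "real N * x - 1 < real k" unfolding k_def using Nx by linarith
          ultimately have k: "real k \<le> real N * x" "real N * x - 1 < real k" by blast+
          have kN: "real k / real N \<le> x" "x - 1 / real N \<le> real k / real N"
          proof -
            show "real k / real N \<le> x" using k(1) N0 by (simp add: field_simps)
            have "x - 1 / real N = (real N * x - 1) / real N" using N0 by (simp add: diff_divide_distrib)
            also have "\<dots> \<le> real k / real N" using k(2) by (intro divide_right_mono) auto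
            finally show "x - 1 / real N \<le> real k / real N" .
          qed
          have bk: "b \<le> real k / real N" using kN(2) x(2) N1(1) by linarith
          have kK: "k \<in> ?K" using bk b \<alpha> kN(1) x(1) by auto
          have "?w \<le> dev lam \<kappa> t (real k / real N)"
            unfolding dev_def
          proof (rule walk_mean_mono[OF lam \<open>leafless \<kappa>\<close>])
            fix y :: "nat list"
            have "real k / real N * real t \<le> x * real t" using kN(1) t0 by (intro mult_right_mono) auto
            also have "\<dots> = \<alpha> * real T" using t0 by (simp add: x_def)
            finally show "(if nat \<lceil>\<alpha> * real T\<rceil> \<le> length y then 1 else 0) \<le>
                (if real k / real N * real t \<le> real (length y) then 1 else (0::real))"
              by (auto simp: nat_le_iff ceiling_le_iff)
          qed
          also have "\<dots> \<le> exp (- (I (real k / real N) - \<epsilon>) * real t)" by (rule n0[OF tn kK])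
          also have "\<dots> \<le> exp (- (I \<alpha> + 2 * \<epsilon>) * real T)"
          proof -
            have "c \<le> I (real k / real N) / (real k / real N)"
              unfolding c_def using bk b \<alpha> kK by (intro slope_mono) auto
            then have "c * (real k / real N) \<le> I (real k / real N)"
              using pos_le_divide_eq[of "real k / real N" c "I (real k / real N)"] bk b \<alpha>1 by linarith
            moreover have "c * (x - 1 / real N) \<le> c * (real k / real N)" using kN(2) c by (intro mult_left_mono) auto
            moreover have "c * (x - 1 / real N) = c * x - c / real N" by (simp add: algebra_simps)
            ultimately have "c * x - 2 * \<epsilon> \<le> I (real k / real N) - \<epsilon>" using N1(2) by linarith
            then have "(c * x - 2 * \<epsilon>) * real t \<le> (I (real k / real N) - \<epsilon>) * real t" using t0 by (intro mult_right_mono) auto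
            also have "(c * x - 2 * \<epsilon>) * real t = c * (x * real t) - 2 * \<epsilon> * real t" by (simp add: algebra_simps)
            also have "x * real t = \<alpha> * real T" using t0 by (simp add: x_def)
            finally have 1: "c * (\<alpha> * real T) - 2 * \<epsilon> * real t \<le> (I (real k / real N) - \<epsilon>) * real t" .
            have 2: "2 * \<epsilon> * real t \<le> 2 * \<epsilon> * real T" using tT \<epsilon> by (intro mult_left_mono) auto
            have "(I \<alpha> + 4 * \<epsilon>) * real T \<le> c * \<alpha> * real T" using \<epsilon> T0 by (intro mult_right_mono) auto
            then have "(I \<alpha> + 2 * \<epsilon>) * real T + 2 * \<epsilon> * real T \<le> c * (\<alpha> * real T)" by (simp add: algebra_simps)
            with 1 2 have "(I \<alpha> + 2 * \<epsilon>) * real T \<le> (I (real k / real N) - \<epsilon>) * real t" by linarith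
            then show ?thesis by (simp only: exp_le_cancel_iff mult_minus_left neg_le_iff_le)
          qed
          finally show ?thesis .
        qed
      qed
    qed
  qed
  then show ?thesis using that \<epsilon> by blast
qed

text \<open>Up to subexponential factors the killed walk reaches level \<alpha> T by time T with
  probability at least exp (- I \<alpha> T), and only an exponentially smaller part stems from times
  before (1 - \<eta>) T. The rest collects weight exp (G (1 - \<eta>) T), which wins as G (1 -
  \<eta>) > I \<alpha>.\<close>

lemma hit_mean_grows:
  assumes \<alpha>: "v < \<alpha>" "\<alpha> \<le> 1" and ext: "\<And>x. \<lbrakk>\<alpha> < x; x \<le> 1\<rbrakk> \<Longrightarrow> I \<alpha> / \<alpha> < I x / x"
    and G: "I \<alpha> < G"
  obtains c where "0 < c"
    "AE \<kappa> in BGW p. \<forall>\<^sub>F T in sequentially.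
       exp (c * real T) \<le> hit_mean lam lam (exp G) (nat \<lceil>\<alpha> * real T\<rceil>) 0 (\<lambda>_ _. 1) \<kappa> T 0 []"
proof -
  have G0: "0 < G" "0 < I \<alpha>" using I_pos[OF \<alpha>] G by auto
  \<comment> \<open>Makes G * (1 - \<eta>) the midpoint of I \<alpha> and G; its distance to I
    \<alpha> is then at least 4 * \<epsilon>.\<close>
  define \<eta> where "\<eta> = (G - I \<alpha>) / (2 * G)"
  have \<eta>: "0 < \<eta>" "\<eta> < 1" "G * (1 - \<eta>) = (G + I \<alpha>) / 2" using G G0 by (auto simp: \<eta>_def field_simps)
  have "0 < (G - I \<alpha>) / 8" using G by simp
  then obtain \<epsilon> where \<epsilon>: "0 < \<epsilon>" "\<epsilon> \<le> (G - I \<alpha>) / 8"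
    and early: "AE \<kappa> in BGW p. \<forall>\<^sub>F T in sequentially. \<forall>t. real t \<le> (1 - \<eta>) * real T \<longrightarrow>
      walk_mean lam \<kappa> t (\<lambda>y. if nat \<lceil>\<alpha> * real T\<rceil> \<le> length y then 1 else 0) [] \<le> exp (- (I \<alpha> + 2 * \<epsilon>) * real T)"
    using early_hits[OF \<alpha> ext \<eta>(1,2)] by blast
  have "AE \<kappa> in BGW p. \<forall>\<^sub>F T in sequentially.
       exp (\<epsilon> * real T) \<le> hit_mean lam lam (exp G) (nat \<lceil>\<alpha> * real T\<rceil>) 0 (\<lambda>_ _. 1) \<kappa> T 0 []"
    using AE_BGW_leafless[OF p0] early dev_bounds[OF \<alpha> \<epsilon>(1)]
  proof eventually_elim
    case (elim \<kappa>)
    note leafless = elim(1)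
    \<comment> \<open>The bracket bounds, relative to exp (- (I \<alpha> + \<epsilon>) T), what is
      left of the hitting probability without early arrivals; the term -G pays for rounding s
      down.\<close>
    have "\<forall>\<^sub>F x :: real in at_top. exp (\<epsilon> * x) \<le> exp (3 * \<epsilon> * x - G) * (1 / ((1 + lam) * x) - (x + 1) * exp (- \<epsilon> * x))"
      using \<epsilon>(1) lam by real_asymp
    then have asymp: "\<forall>\<^sub>F T in sequentially. exp (\<epsilon> * real T) \<le>
        exp (3 * \<epsilon> * real T - G) * (1 / ((1 + lam) * real T) - (real T + 1) * exp (- \<epsilon> * real T))"
      by (rule eventually_compose_filterlim[OF _ filterlim_real_sequentially])
    show ?case using elim(2,3) asymp eventually_gt_at_top[of 0]
    proof eventually_elim
      case (elim T)
      define L where "L = nat \<lceil>\<alpha> * real T\<rceil>"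
      define s where "s = nat \<lfloor>(1 - \<eta>) * real T\<rfloor>"
      have T: "0 < real T" using elim by simp
      have L1: "1 \<le> L" using mult_pos_pos[of \<alpha> "real T"] T \<alpha> v by (simp add: L_def Suc_le_eq)
      have s: "real s \<le> (1 - \<eta>) * real T" "(1 - \<eta>) * real T - 1 \<le> real s"
        using \<eta> T unfolding s_def by (simp, linarith)
      have sT: "s \<le> T" using s(1) \<eta> mult_right_mono[of "1 - \<eta>" 1 "real T"] by simp
      let ?U = "\<lambda>t. reach_killed lam \<kappa> L t []"
      have "dev lam \<kappa> T \<alpha> = walk_mean lam \<kappa> T (\<lambda>y. if L \<le> length y then 1 else 0) []"
        unfolding dev_def L_def by (simp add: nat_le_iff ceiling_le_iff)
      also have "\<dots> \<le> reach lam \<kappa> L T []" by (rule walk_mean_le_reach[OF lam leafless]) simp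
      also have "\<dots> \<le> (1 + lam) * real T * ?U T" by (rule reach_root_le[OF lam leafless L1])
      finally have "exp (- (I \<alpha> + \<epsilon>) * real T) \<le> (1 + lam) * real T * ?U T" using elim(2) by linarith
      then have U1: "exp (- (I \<alpha> + \<epsilon>) * real T) * (1 / ((1 + lam) * real T)) \<le> ?U T"
        using pos_divide_le_eq[of "(1 + lam) * real T" "exp (- (I \<alpha> + \<epsilon>) * real T)" "?U T"] lam T
        by (simp add: mult.commute)
      have "?U s \<le> reach lam \<kappa> L s []" by (rule reach_killed_le_reach[OF lam leafless])
      also have "\<dots> \<le> (\<Sum>t\<le>s. walk_mean lam \<kappa> t (\<lambda>y. if L \<le> length y then 1 else 0) [])"
        by (rule reach_le_sum[OF lam leafless])
      also have "\<dots> \<le> (\<Sum>t\<le>s. exp (- (I \<alpha> + 2 * \<epsilon>) * real T))"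
      proof (rule sum_mono)
        fix t assume "t \<in> {..s}"
        then have "real t \<le> (1 - \<eta>) * real T" using s(1) by auto
        then show "walk_mean lam \<kappa> t (\<lambda>y. if L \<le> length y then 1 else 0) [] \<le> exp (- (I \<alpha> + 2 * \<epsilon>) * real T)"
          using elim(1) unfolding L_def by blast
      qed
      also have "\<dots> \<le> (real T + 1) * exp (- (I \<alpha> + 2 * \<epsilon>) * real T)"
        using sT by (simp add: mult_right_mono)
      also have "exp (- (I \<alpha> + 2 * \<epsilon>) * real T) = exp (- (I \<alpha> + \<epsilon>) * real T) * exp (- \<epsilon> * real T)"
        by (simp add: exp_add[symmetric] algebra_simps)
      finally have U2: "?U s \<le> exp (- (I \<alpha> + \<epsilon>) * real T) * ((real T + 1) * exp (- \<epsilon> * real T))"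
        by (simp only: mult.left_commute)
      let ?B = "1 / ((1 + lam) * real T) - (real T + 1) * exp (- \<epsilon> * real T)"
      have B: "0 \<le> ?B"
      proof (rule ccontr)
        assume "\<not> 0 \<le> ?B"
        then have "exp (3 * \<epsilon> * real T - G) * ?B \<le> 0" by (intro mult_nonneg_nonpos) auto
        with elim(3) show False using exp_gt_zero[of "\<epsilon> * real T"] by linarith
      qed
      have "3 * \<epsilon> * real T - G + (I \<alpha> + \<epsilon>) * real T \<le> G * real s"
      proof -
        have "(4 * \<epsilon> + I \<alpha>) * real T \<le> (G * (1 - \<eta>)) * real T"
          using \<epsilon>(2) T unfolding \<eta>(3) by (intro mult_right_mono) auto
        also have "\<dots> = G * ((1 - \<eta>) * real T - 1) + G" by (simp add: algebra_simps)
        also have "\<dots> \<le> G * real s + G" using s(2) G0 by simp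
        finally show ?thesis by (simp add: algebra_simps)
      qed
      then have "exp (3 * \<epsilon> * real T - G) \<le> exp (G * real s - (I \<alpha> + \<epsilon>) * real T)" by simp
      also have "\<dots> = exp G ^ s * exp (- (I \<alpha> + \<epsilon>) * real T)"
        by (simp add: exp_of_nat_mult[symmetric] exp_add[symmetric] algebra_simps)
      finally have "exp (3 * \<epsilon> * real T - G) * ?B \<le> exp G ^ s * exp (- (I \<alpha> + \<epsilon>) * real T) * ?B"
        using B by (intro mult_right_mono)
      also have "\<dots> = exp G ^ s * (exp (- (I \<alpha> + \<epsilon>) * real T) * ?B)" by simp
      also have "\<dots> \<le> exp G ^ s * (?U T - ?U s)"
        using U1 U2 by (intro mult_left_mono) (auto simp: algebra_simps)
      also have "\<dots> \<le> hit_mean lam lam (exp G) L 0 (\<lambda>_ _. 1) \<kappa> T 0 []"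
        using G0 by (intro hit_mean_weighted_ge lam leafless) simp
      finally show ?case using elim(3) unfolding L_def by linarith
    qed
  qed
  then show ?thesis using that \<epsilon> by blast
qed

text \<open>The exponent -1/T turns the growth exp (c T) into the constant exp (- c) and the worst
  case (1 + \<lambda>)^(-T) into the constant 1 + \<lambda>. Dominated convergence then disposes of
  the exceptional environments.\<close>

lemma hit_mean_moment:
  assumes \<alpha>: "v < \<alpha>" "\<alpha> \<le> 1" and ext: "\<And>x. \<lbrakk>\<alpha> < x; x \<le> 1\<rbrakk> \<Longrightarrow> I \<alpha> / \<alpha> < I x / x"
    and G: "I \<alpha> < G"
  obtains \<rho> where "0 \<le> \<rho>" "\<rho> < 1"
    "\<forall>\<^sub>F T in sequentially. (\<integral>\<^sup>+\<kappa>. ennreal (hit_mean lam lam (exp G) (nat \<lceil>\<alpha> * real T\<rceil>) 0 (\<lambda>_ _. 1) \<kappa> T 0 [] powr - (1 / real T)) \<partial>BGW p) \<le> ennreal \<rho>"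
proof -
  interpret prob_space "BGW p" by (rule prob_space_BGW)
  have G0: "0 < G" using I_pos[OF \<alpha>] G by auto
  define W where "W T \<kappa> = hit_mean lam lam (exp G) (nat \<lceil>\<alpha> * real T\<rceil>) 0 (\<lambda>_ _. 1) \<kappa> T 0 []" for T \<kappa>
  obtain c where c: "0 < c" "AE \<kappa> in BGW p. \<forall>\<^sub>F T in sequentially. exp (c * real T) \<le> W T \<kappa>"
    unfolding W_def using hit_mean_grows[OF assms] by blast
  have Wm: "W T \<in> borel_measurable (BGW p)" for T
    unfolding W_def by (rule measurable_hit_mean) simp
  define h where "h T \<kappa> = (if exp (c * real T) \<le> W T \<kappa> then 0 else 1 :: real)" for T \<kappa>
  have hm: "h T \<in> borel_measurable (BGW p)" for T
    unfolding h_def using Wm[of T] by measurable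
  have "(\<lambda>T. \<integral>\<kappa>. h T \<kappa> \<partial>BGW p) \<longlonglongrightarrow> (\<integral>\<kappa>. 0 \<partial>BGW p)"
  proof (rule integral_dominated_convergence[where w = "\<lambda>_. 1"])
    show "AE \<kappa> in BGW p. (\<lambda>T. h T \<kappa>) \<longlonglongrightarrow> 0"
      using c(2) by eventually_elim (auto intro!: tendsto_eventually simp: h_def elim!: eventually_mono)
    show "AE \<kappa> in BGW p. norm (h T \<kappa>) \<le> 1" for T by (simp add: h_def)
  qed (use hm in simp_all)
  then have lim: "(\<lambda>T. exp (- c) + (1 + lam) * (\<integral>\<kappa>. h T \<kappa> \<partial>BGW p)) \<longlonglongrightarrow> exp (- c) + (1 + lam) * 0"
    by (intro tendsto_intros) simp
  define \<rho> where "\<rho> = (1 + exp (- c)) / 2"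
  have \<rho>: "0 \<le> \<rho>" "\<rho> < 1" "exp (- c) < \<rho>" using c(1) by (auto simp: \<rho>_def add_nonneg_nonneg)
  have "\<forall>\<^sub>F T in sequentially. exp (- c) + (1 + lam) * (\<integral>\<kappa>. h T \<kappa> \<partial>BGW p) < \<rho>"
    by (rule order_tendstoD(2)[OF lim]) (use \<rho> in simp)
  then have "\<forall>\<^sub>F T in sequentially. (\<integral>\<^sup>+\<kappa>. ennreal (W T \<kappa> powr - (1 / real T)) \<partial>BGW p) \<le> ennreal \<rho>"
    using eventually_gt_at_top[of 0]
  proof eventually_elim
    case (elim T)
    have T: "0 < real T" using elim by simp
    have le: "nat \<lceil>\<alpha> * real T\<rceil> \<le> T" using \<alpha> T by (simp add: nat_le_iff ceiling_le_iff mult_left_le_one_le v order_trans[OF v(1)])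
    have int: "integrable (BGW p) (h T)"
      by (rule integrable_const_bound[where B = 1]) (use hm in \<open>auto simp: h_def\<close>)
    have "(\<integral>\<^sup>+\<kappa>. ennreal (W T \<kappa> powr - (1 / real T)) \<partial>BGW p) \<le> (\<integral>\<^sup>+\<kappa>. ennreal (exp (- c) + (1 + lam) * h T \<kappa>) \<partial>BGW p)"
    proof (rule nn_integral_mono_AE)
      show "AE \<kappa> in BGW p. ennreal (W T \<kappa> powr - (1 / real T)) \<le> ennreal (exp (- c) + (1 + lam) * h T \<kappa>)"
        using AE_BGW_leafless[OF p0]
      proof eventually_elim
        case (elim \<kappa>)
        show ?case
        proof (rule ennreal_leI, cases "exp (c * real T) \<le> W T \<kappa>")
          case True
          then have "W T \<kappa> powr - (1 / real T) \<le> exp (c * real T) powr - (1 / real T)"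
            using T by (intro powr_mono2') auto
          then show "W T \<kappa> powr - (1 / real T) \<le> exp (- c) + (1 + lam) * h T \<kappa>"
            using True T by (simp add: h_def exp_powr_real)
        next
          case False
          have "1 / (1 + lam) ^ nat \<lceil>\<alpha> * real T\<rceil> \<le> W T \<kappa>"
            unfolding W_def using G0 lam elim le by (intro hit_mean_straight_root) auto
          moreover have "(1 + lam) powr - real T \<le> 1 / (1 + lam) ^ nat \<lceil>\<alpha> * real T\<rceil>"
            using lam le by (simp add: powr_minus_divide powr_realpow divide_left_mono power_increasing)
          ultimately have "W T \<kappa> powr - (1 / real T) \<le> ((1 + lam) powr - real T) powr - (1 / real T)"
            using T lam by (intro powr_mono2') auto
          also have "\<dots> = 1 + lam" using T lam by (simp add: powr_powr)
          finally show "W T \<kappa> powr - (1 / real T) \<le> exp (- c) + (1 + lam) * h T \<kappa>"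
            using False by (simp add: h_def add_increasing)
        qed
      qed
    qed
    also have "\<dots> = ennreal (\<integral>\<kappa>. exp (- c) + (1 + lam) * h T \<kappa> \<partial>BGW p)"
    proof (rule nn_integral_eq_integral)
      show "AE \<kappa> in BGW p. 0 \<le> exp (- c) + (1 + lam) * h T \<kappa>" using lam by (simp add: h_def add_nonneg_nonneg)
    qed (use int in simp)
    also have "(\<integral>\<kappa>. exp (- c) + (1 + lam) * h T \<kappa> \<partial>BGW p) = exp (- c) + (1 + lam) * (\<integral>\<kappa>. h T \<kappa> \<partial>BGW p)"
      using int prob_space by simp
    also have "ennreal \<dots> \<le> ennreal \<rho>" using elim by (intro ennreal_leI) simp
    finally show ?case .
  qed
  then show ?thesis using that \<rho> unfolding W_def by blast
qed

end

section \<open>From averages over environments to almost every environment\<close>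

lemma hit_mean_mono_time:
  assumes "0 < lam" "0 \<le> e" "leafless \<kappa>" "0 \<le> w" "c \<le> c'"
    and "\<And>r' x. \<lbrakk>length x = i; r \<le> r' + t\<rbrakk> \<Longrightarrow> b r' x \<le> b' r' x"
  shows "hit_mean lam e w i c b \<kappa> t r x \<le> hit_mean lam e w i c' b' \<kappa> t r x"
  using assms(6)
proof (induction t arbitrary: r x)
  case (Suc t)
  show ?case
  proof (cases "length x = i")
    case False
    have "hit_mean lam e w i c b \<kappa> t (r - 1) y \<le> hit_mean lam e w i c' b' \<kappa> t (r - 1) y" for y
      by (rule Suc.IH) (auto intro!: Suc.prems)
    then show ?thesis using False assms(1-4) by (auto intro!: mult_left_mono step_mean_mono)
  qed (use Suc.prems[of x r] in auto)
qed (use assms(5) in auto)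

text \<open>A nonnegative series with summable means has finite mean and so converges almost surely.
  This transfers moment bounds to almost every environment.\<close>

lemma AE_summable:
  fixes x :: "nat \<Rightarrow> 'a \<Rightarrow> real"
  assumes meas: "\<And>k. x k \<in> borel_measurable M" and nonneg: "\<And>k. AE \<omega> in M. 0 \<le> x k \<omega>"
    and le: "\<forall>\<^sub>F k in sequentially. (\<integral>\<^sup>+\<omega>. ennreal (x k \<omega>) \<partial>M) \<le> ennreal (y k)"
    and y: "summable y" "\<And>k. 0 \<le> y k"
  shows "AE \<omega> in M. summable (\<lambda>k. x k \<omega>)"
proof -
  obtain k0 where k0: "\<And>k. k0 \<le> k \<Longrightarrow> (\<integral>\<^sup>+\<omega>. ennreal (x k \<omega>) \<partial>M) \<le> ennreal (y k)"
    using le unfolding eventually_sequentially by blast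
  have "(\<integral>\<^sup>+\<omega>. (\<Sum>k. ennreal (x (k + k0) \<omega>)) \<partial>M) = (\<Sum>k. \<integral>\<^sup>+\<omega>. ennreal (x (k + k0) \<omega>) \<partial>M)"
    by (rule nn_integral_suminf) (intro measurable_compose[OF meas measurable_ennreal])
  also have "\<dots> \<le> (\<Sum>k. ennreal (y (k + k0)))" by (intro suminf_le k0) auto
  also have "\<dots> < \<infinity>"
    using y summable_ignore_initial_segment[OF y(1), of k0] by (simp add: suminf_ennreal2 less_top[symmetric])
  finally have "AE \<omega> in M. (\<Sum>k. ennreal (x (k + k0) \<omega>)) \<noteq> \<infinity>"
  proof (intro nn_integral_PInf_AE)
    show "(\<lambda>\<omega>. \<Sum>k. ennreal (x (k + k0) \<omega>)) \<in> borel_measurable M"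
      by (rule borel_measurable_suminf_order) (rule measurable_compose[OF meas measurable_ennreal])
  qed auto
  moreover have "AE \<omega> in M. \<forall>k. 0 \<le> x k \<omega>" using nonneg by (simp add: AE_all_countable)
  ultimately show ?thesis
  proof eventually_elim
    case (elim \<omega>)
    then have "summable (\<lambda>k. x (k + k0) \<omega>)" by (intro summable_suminf_not_top) auto
    then show ?case by (rule summable_iff_shift[THEN iffD1])
  qed
qed

text \<open>Adds g over all subtrees hanging off level l. Recursion at the root, rather than a sum
  over a random set of vertices, is the form to which independence of the subtrees applies.\<close>

primrec level_sum :: "nat \<Rightarrow> ((nat list \<Rightarrow> nat) \<Rightarrow> real) \<Rightarrow> (nat list \<Rightarrow> nat) \<Rightarrow> real" where
  "level_sum 0 g = g"
| "level_sum (Suc l) g = (\<lambda>\<kappa>. \<Sum>i<\<kappa> []. level_sum l g (subtree [i] \<kappa>))"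

lemma level_sum_nonneg: "(\<And>\<kappa>. 0 \<le> g \<kappa>) \<Longrightarrow> 0 \<le> level_sum l g \<kappa>"
  by (induction l arbitrary: \<kappa>) (auto intro: sum_nonneg)

lemma level_sum_ge:
  assumes "\<And>\<kappa>. 0 \<le> g \<kappa>" "in_tree \<kappa> y"
  shows "g (subtree y \<kappa>) \<le> level_sum (length y) g \<kappa>"
  using assms(2)
proof (induction y arbitrary: \<kappa>)
  case (Cons i y)
  have "g (subtree (i # y) \<kappa>) = g (subtree y (subtree [i] \<kappa>))" by simp
  also have "\<dots> \<le> level_sum (length y) g (subtree [i] \<kappa>)" using Cons.IH[of "subtree [i] \<kappa>"] Cons.prems by (simp add: in_tree_Cons)
  also have "\<dots> \<le> (\<Sum>j<\<kappa> []. level_sum (length y) g (subtree [j] \<kappa>))"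
    using Cons.prems level_sum_nonneg[OF assms(1)] by (intro member_le_sum) (auto simp: in_tree_Cons)
  finally show ?case by simp
qed simp

lemma measurable_level_sum: "g \<in> borel_measurable (BGW p) \<Longrightarrow> level_sum l g \<in> borel_measurable (BGW p)"
proof (induction l)
  case (Suc l)
  have "(\<lambda>\<kappa>. \<Sum>i<k. level_sum l g (subtree [i] \<kappa>)) \<in> borel_measurable (BGW p)" for k :: nat
    by (intro borel_measurable_sum measurable_compose[OF measurable_subtree Suc.IH[OF Suc.prems]])
  then have "(\<lambda>\<kappa>. \<Sum>i<\<kappa> []. level_sum l g (subtree [i] \<kappa>)) \<in> borel_measurable (BGW p)"
    by (rule measurable_compose_countable) simp
  then show ?case by simp
qed simp

lemma nn_integral_sum_children:
  assumes h: "h \<in> borel_measurable (BGW p)"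
  shows "(\<integral>\<^sup>+\<kappa>. (\<Sum>i<\<kappa> []. h (subtree [i] \<kappa>)) \<partial>BGW p) = (\<integral>\<^sup>+k. of_nat k \<partial>p) * (\<integral>\<^sup>+\<kappa>. h \<kappa> \<partial>BGW p)"
proof -
  let ?c = "\<integral>\<^sup>+\<kappa>. h \<kappa> \<partial>BGW p"
  have hs[measurable]: "(\<lambda>\<kappa>. h (subtree [i] \<kappa>)) \<in> borel_measurable (BGW p)" for i
    by (rule measurable_compose[OF measurable_subtree h])
  have "(\<integral>\<^sup>+\<kappa>. (\<Sum>i<\<kappa> []. h (subtree [i] \<kappa>)) \<partial>BGW p) = (\<integral>\<^sup>+\<kappa>. of_nat (\<kappa> []) * ?c \<partial>BGW p)"
  proof (rule nn_integral_cong_fibres[where X = "\<lambda>\<kappa>. \<kappa> []"])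
    fix k :: nat
    let ?I = "indicator {\<kappa>. \<kappa> [] = k} :: (nat list \<Rightarrow> nat) \<Rightarrow> ennreal"
    have I[measurable]: "?I \<in> borel_measurable (BGW p)" by measurable
    have indep: "(\<integral>\<^sup>+\<kappa>. ?I \<kappa> * h (subtree [i] \<kappa>) \<partial>BGW p) = (\<integral>\<^sup>+\<kappa>. ?I \<kappa> \<partial>BGW p) * ?c" for i
    proof -
      have "(\<integral>\<^sup>+\<kappa>. ?I \<kappa> * h (subtree [i] \<kappa>) \<partial>BGW p) = (\<integral>\<^sup>+\<kappa>. ?I \<kappa> \<partial>BGW p) * (\<integral>\<^sup>+\<kappa>. h (subtree [i] \<kappa>) \<partial>BGW p)"
        unfolding BGW_def
      proof (rule nn_integral_mult_disjoint_coordinates[where A = "{[]}" and B = "range ((#) i)"])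
        show "?I \<in> borel_measurable (PiM UNIV (\<lambda>_. measure_pmf p))" using I unfolding BGW_def .
        show "(\<lambda>\<kappa>. h (subtree [i] \<kappa>)) \<in> borel_measurable (PiM UNIV (\<lambda>_. measure_pmf p))" using hs unfolding BGW_def .
        show "?I \<kappa> = ?I \<kappa>'" if "\<And>w. w \<in> {[]} \<Longrightarrow> \<kappa> w = \<kappa>' w" for \<kappa> \<kappa>'
          using that[of "[]"] by (simp add: indicator_def)
        show "h (subtree [i] \<kappa>) = h (subtree [i] \<kappa>')" if "\<And>w. w \<in> range ((#) i) \<Longrightarrow> \<kappa> w = \<kappa>' w" for \<kappa> \<kappa>'
        proof -
          have "subtree [i] \<kappa> = subtree [i] \<kappa>'" using that by (simp add: subtree_def fun_eq_iff)
          then show ?thesis by simp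
        qed
      qed (auto intro: prob_space_measure_pmf)
      then show ?thesis by (simp only: nn_integral_subtree[OF h])
    qed
    have "(\<integral>\<^sup>+\<kappa>. (\<Sum>i<\<kappa> []. h (subtree [i] \<kappa>)) * ?I \<kappa> \<partial>BGW p) = (\<integral>\<^sup>+\<kappa>. (\<Sum>i<k. ?I \<kappa> * h (subtree [i] \<kappa>)) \<partial>BGW p)"
      by (intro nn_integral_cong) (auto simp: indicator_def)
    also have "\<dots> = (\<Sum>i<k. \<integral>\<^sup>+\<kappa>. ?I \<kappa> * h (subtree [i] \<kappa>) \<partial>BGW p)"
      by (rule nn_integral_sum) measurable
    also have "\<dots> = of_nat k * ?c * (\<integral>\<^sup>+\<kappa>. ?I \<kappa> \<partial>BGW p)" by (simp only: indep sum_constant card_lessThan) (simp add: ac_simps)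
    also have "\<dots> = (\<integral>\<^sup>+\<kappa>. of_nat k * ?c * ?I \<kappa> \<partial>BGW p)" by (rule nn_integral_cmult[OF I, symmetric])
    also have "\<dots> = (\<integral>\<^sup>+\<kappa>. of_nat (\<kappa> []) * ?c * ?I \<kappa> \<partial>BGW p)"
      by (intro nn_integral_cong) (auto simp: indicator_def)
    finally show "(\<integral>\<^sup>+\<kappa>. (\<Sum>i<\<kappa> []. h (subtree [i] \<kappa>)) * ?I \<kappa> \<partial>BGW p) = (\<integral>\<^sup>+\<kappa>. of_nat (\<kappa> []) * ?c * ?I \<kappa> \<partial>BGW p)" .
  next
    show "(\<lambda>\<kappa>. \<Sum>i<\<kappa> []. h (subtree [i] \<kappa>)) \<in> borel_measurable (BGW p)"
      by (rule measurable_compose_countable[where f = "\<lambda>k \<kappa>. \<Sum>i<k. h (subtree [i] \<kappa>)"]) measurable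
    show "(\<lambda>\<kappa>. of_nat (\<kappa> []) * ?c) \<in> borel_measurable (BGW p)"
      by (rule measurable_compose[OF measurable_BGW_component]) simp
  qed measurable
  also have "\<dots> = (\<integral>\<^sup>+k. of_nat k * ?c \<partial>distr (BGW p) (measure_pmf p) (\<lambda>\<kappa>. \<kappa> []))"
    using measurable_BGW_component[of "[]" p] by (subst nn_integral_distr) auto
  also have "distr (BGW p) (measure_pmf p) (\<lambda>\<kappa>. \<kappa> []) = measure_pmf p"
    unfolding BGW_def by (rule distr_PiM_component) (auto intro: prob_space_measure_pmf)
  also have "(\<integral>\<^sup>+k. of_nat k * ?c \<partial>p) = (\<integral>\<^sup>+k. of_nat k \<partial>p) * ?c" by (rule nn_integral_multc) simp
  finally show ?thesis .
qed

lemma nn_integral_level_sum: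
  assumes g: "g \<in> borel_measurable (BGW p)" "\<And>\<kappa>. 0 \<le> g \<kappa>" and int: "integrable (measure_pmf p) real"
  shows "(\<integral>\<^sup>+\<kappa>. ennreal (level_sum l g \<kappa>) \<partial>BGW p) =
    ennreal (measure_pmf.expectation p real) ^ l * (\<integral>\<^sup>+\<kappa>. ennreal (g \<kappa>) \<partial>BGW p)"
proof (induction l)
  case (Suc l)
  have "(\<integral>\<^sup>+\<kappa>. ennreal (level_sum (Suc l) g \<kappa>) \<partial>BGW p) =
      (\<integral>\<^sup>+\<kappa>. (\<Sum>i<\<kappa> []. ennreal (level_sum l g (subtree [i] \<kappa>))) \<partial>BGW p)"
    using level_sum_nonneg[OF g(2)] by (simp add: sum_ennreal)
  also have "\<dots> = (\<integral>\<^sup>+k. of_nat k \<partial>p) * (\<integral>\<^sup>+\<kappa>. ennreal (level_sum l g \<kappa>) \<partial>BGW p)"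
    by (rule nn_integral_sum_children[where h = "\<lambda>\<kappa>. ennreal (level_sum l g \<kappa>)"])
      (rule measurable_compose[OF measurable_level_sum[OF g(1)] measurable_ennreal])
  also have "(\<integral>\<^sup>+k. of_nat k \<partial>p) = (\<integral>\<^sup>+k. ennreal (real k) \<partial>p)"
    by (intro nn_integral_cong) (simp add: ennreal_of_nat_eq_real_of_nat)
  also have "\<dots> = ennreal (measure_pmf.expectation p real)"
    using int by (intro nn_integral_eq_integral) auto
  finally show ?case by (simp add: Suc mult.assoc)
qed simp

section \<open>Summable failure probabilities\<close>

context walk_with_rate
begin

text \<open>Fixes a stage length T and hides the stages behind functions Q n of the environment with
  uniformly bounded negative moments. g is the growth rate that branching affords and G the weight
  needed for the climb; a deficit is paid per generation by exp (g - G)^n. The constant B is T +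
  L0.\<close>

lemma climb_bound:
  assumes \<alpha>: "v < \<alpha>" "\<alpha> \<le> 1" and ext: "\<And>x. \<lbrakk>\<alpha> < x; x \<le> 1\<rbrakk> \<Longrightarrow> I \<alpha> / \<alpha> < I x / x"
    and G: "I \<alpha> < G" "g \<le> G"
    and mu: "pmf mu 0 = 0" "integrable (measure_pmf mu) real" and g: "exp g < measure_pmf.expectation mu real"
    and \<theta>0: "0 < \<theta>0"
  obtains Q B \<theta> C where "0 < \<theta>" "\<theta> \<le> \<theta>0" "0 \<le> C" "\<And>n. Q n \<in> borel_measurable (BGW p)"
    "\<And>n \<kappa>. leafless \<kappa> \<Longrightarrow> 0 < Q n \<kappa>"
    "\<And>n \<kappa> L y. \<lbrakk>leafless \<kappa>; real L + B \<le> real (length y) + \<alpha> * real n\<rbrakk>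
       \<Longrightarrow> exp (g - G) ^ n * Q n (subtree y \<kappa>) \<le> 1 - miss_prob mu lam \<kappa> L n y"
    "\<And>n. (\<integral>\<^sup>+\<kappa>. ennreal (Q n \<kappa> powr - \<theta>) \<partial>BGW p) \<le> ennreal C"
proof -
  obtain \<rho> where \<rho>: "0 \<le> \<rho>" "\<rho> < 1"
    "\<forall>\<^sub>F T in sequentially. (\<integral>\<^sup>+\<kappa>. ennreal (hit_mean lam lam (exp G) (nat \<lceil>\<alpha> * real T\<rceil>) 0 (\<lambda>_ _. 1) \<kappa> T 0 [] powr - (1 / real T)) \<partial>BGW p) \<le> ennreal \<rho>"
    using hit_mean_moment[OF \<alpha> ext G(1)] by blast
  have "\<forall>\<^sub>F T in sequentially. 1 / real T \<le> \<theta>0"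
    using order_tendstoD(2)[OF lim_1_over_n \<theta>0] by eventually_elim simp
  with \<rho>(3) have "\<forall>\<^sub>F T in sequentially. (\<integral>\<^sup>+\<kappa>. ennreal (hit_mean lam lam (exp G) (nat \<lceil>\<alpha> * real T\<rceil>) 0 (\<lambda>_ _. 1) \<kappa> T 0 [] powr - (1 / real T)) \<partial>BGW p) \<le> ennreal \<rho> \<and> 1 / real T \<le> \<theta>0 \<and> 0 < T"
    using eventually_gt_at_top[of 0] by eventually_elim auto
  then obtain T where T: "(\<integral>\<^sup>+\<kappa>. ennreal (hit_mean lam lam (exp G) (nat \<lceil>\<alpha> * real T\<rceil>) 0 (\<lambda>_ _. 1) \<kappa> T 0 [] powr - (1 / real T)) \<partial>BGW p) \<le> ennreal \<rho>"
    "1 / real T \<le> \<theta>0" "0 < T"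
    using eventually_happens'[OF sequentially_bot] by blast
  define L0 where "L0 = nat \<lceil>\<alpha> * real T\<rceil>"
  define \<theta> where "\<theta> = 1 / real T"
  have \<theta>: "0 < \<theta>" "\<theta> \<le> \<theta>0" using T by (auto simp: \<theta>_def)
  have L0: "1 \<le> L0" "L0 \<le> T" "\<alpha> * real T \<le> real L0"
  proof -
    have "0 < \<alpha> * real T" using \<alpha> v T(3) by simp
    then show "1 \<le> L0" by (simp add: L0_def Suc_le_eq)
    have "\<alpha> * real T \<le> real T" using \<alpha> v by (simp add: mult_left_le_one_le)
    then show "L0 \<le> T" by (simp add: L0_def nat_le_iff ceiling_le_iff)
    show "\<alpha> * real T \<le> real L0" unfolding L0_def by linarith
  qed
  have G0: "0 < G" using I_pos[OF \<alpha>] G by linarith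
  obtain \<delta>' where \<delta>': "0 < \<delta>'" "\<delta>' \<le> 1/2" "\<And>x. \<lbrakk>0 \<le> x; x \<le> \<delta>'\<rbrakk> \<Longrightarrow> exp g * x \<le> 1 - pgf mu (1 - x)"
    using one_minus_pgf_ge[OF mu(2) g] by blast
  \<comment> \<open>After T steps of weight exp G the capped values are still at most
    \<delta>'.\<close>
  define \<delta> where "\<delta> = \<delta>' / exp G ^ T"
  have \<delta>: "0 < \<delta>" "exp G ^ T * \<delta> \<le> \<delta>'" using \<delta>' by (auto simp: \<delta>_def)
  define Q where "Q n = stage lam (exp G) T L0 \<delta> n n" for n
  obtain C where C: "0 \<le> C" "\<And>K r. (\<integral>\<^sup>+\<kappa>. ennreal (stage lam (exp G) T L0 \<delta> K r \<kappa> powr - \<theta>) \<partial>BGW p) \<le> ennreal C"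
    using stage_moment_bound[OF lam _ L0(1,2) \<delta>(1) \<theta>(1) p0 \<rho>(1,2), of "exp G"] T(1) G0
    unfolding L0_def \<theta>_def by auto
  show ?thesis
  proof
    show "0 < \<theta>" "\<theta> \<le> \<theta>0" "0 \<le> C" by fact+
    show "Q n \<in> borel_measurable (BGW p)" for n unfolding Q_def by (rule measurable_stage)
    show "0 < Q n \<kappa>" if "leafless \<kappa>" for n \<kappa>
    proof -
      obtain c where "0 < c" "\<And>r \<kappa>. leafless \<kappa> \<Longrightarrow> c \<le> stage lam (exp G) T L0 \<delta> n r \<kappa>"
        using stage_lower_bound[OF lam _ L0(1,2) \<delta>(1), of "exp G" n] G0 by auto
      then show ?thesis using that unfolding Q_def by (meson less_le_trans)
    qed
    show "(\<integral>\<^sup>+\<kappa>. ennreal (Q n \<kappa> powr - \<theta>) \<partial>BGW p) \<le> ennreal C" for n unfolding Q_def by (rule C(2))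
    show "exp (g - G) ^ n * Q n (subtree y \<kappa>) \<le> 1 - miss_prob mu lam \<kappa> L n y"
      if "leafless \<kappa>" and L: "real L + real (T + L0) \<le> real (length y) + \<alpha> * real n" for n \<kappa> L y
      unfolding Q_def
    proof (rule stage_le_hit_prob[OF lam that(1) mu _ _ _ L0(1,2) \<delta>])
      show "exp G * exp (g - G) * x \<le> 1 - pgf mu (1 - x)" if "0 \<le> x" "x \<le> \<delta>'" for x
        using \<delta>'(3)[OF that] by (simp add: exp_add[symmetric])
      have "\<alpha> \<le> real L0 / real T" using L0(3) T(3) by (simp add: field_simps)
      then have "\<alpha> * real n \<le> real L0 / real T * real n" by (rule mult_right_mono) simp
      then show "real L + real T + real L0 \<le> real (length y) + real n * (real L0 / real T)"
        using L by (simp add: mult.commute)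
    qed (use G0 G(2) \<delta>' in auto)
  qed
qed

text \<open>In the first k^(N-1) * O(log k) of the k^N steps a particle finds a vertex at a level i of order
log k, and meanwhile branches i times. The subtree of that vertex is independent of the
walk so far, so the moment bound for Q applies there; the factor \<rho>^i makes the bound summable.\<close>
lemma miss_prob_summable_transient:
  assumes v0: "0 < v" and a: "v < a" "a \<le> 1" "I a < ln (measure_pmf.expectation mu real)"
    and mu: "pmf mu 0 = 0" "pmf mu 1 < 1" "integrable (measure_pmf mu) real"
    and m: "1 < measure_pmf.expectation mu real" and a': "0 \<le> a'" "a' < a"
  obtains N where "1 \<le> N"
    "AE \<kappa> in BGW p. summable (\<lambda>k. miss_prob mu lam \<kappa> (nat \<lceil>a' * real (k ^ N)\<rceil>) (k ^ N) [])"
proof -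
  let ?m = "measure_pmf.expectation mu real"
  have a0: "0 < a" using v a by linarith
  \<comment> \<open>Strict because v > 0: the chord from (v, 0) gives I a \<le> (a - v) / (x - v) *
    I x, and (a - v) / (x - v) < a / x.\<close>
  have ext: "I a / a < I x / x" if "a < x" "x \<le> 1" for x
  proof -
    have "I a \<le> (a - v) / (x - v) * I x" using that a by (intro I_le_convex) auto
    also have "\<dots> < a / x * I x"
    proof (rule mult_strict_right_mono)
      show "(a - v) / (x - v) < a / x" using that a v0 by (simp add: field_simps)
      show "0 < I x" using that a by (intro I_pos) auto
    qed
    finally show ?thesis using that a0 by (simp add: field_simps)
  qed
  obtain G where G: "I a < G" "G < ln ?m" using dense[OF a(3)] by blast
  have G0: "0 < G" using I_pos[OF a(1,2)] G by linarith
  have eG: "1 < exp G" "exp G < ?m"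
    using G0 G m exp_less_mono[of G "ln ?m"] by auto
  obtain \<theta>0 where \<theta>0: "0 < \<theta>0"
    "\<And>\<theta> j q. \<lbrakk>0 < \<theta>; \<theta> \<le> \<theta>0; 0 < q; q \<le> 1\<rbrakk> \<Longrightarrow> (pgf mu ^^ j) (1 - q) \<le> (exp G powr - \<theta>) ^ j * q powr - \<theta>"
    using pgf_iterate_decay[OF mu eG] by blast
  obtain Q B \<theta> C where \<theta>: "0 < \<theta>" "\<theta> \<le> \<theta>0" and C: "0 \<le> C"
    and Qm: "\<And>n. Q n \<in> borel_measurable (BGW p)"
    and Qpos: "\<And>n \<kappa>. leafless \<kappa> \<Longrightarrow> 0 < Q n \<kappa>"
    and Q: "\<And>n \<kappa> L y. \<lbrakk>leafless \<kappa>; real L + B \<le> real (length y) + a * real n\<rbrakk>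
       \<Longrightarrow> exp (G - G) ^ n * Q n (subtree y \<kappa>) \<le> 1 - miss_prob mu lam \<kappa> L n y"
    and EQ: "\<And>n. (\<integral>\<^sup>+\<kappa>. ennreal (Q n \<kappa> powr - \<theta>) \<partial>BGW p) \<le> ennreal C"
    apply (rule climb_bound[OF a(1,2) ext G(1) order.refl mu(1,3) eG(2) \<theta>0(1)])
     apply assumption+
    subgoal premises prems by (rule prems(1)[OF prems(2-8)])
    done
  define \<rho> where "\<rho> = exp G powr - \<theta>"
  have \<rho>: "0 < \<rho>" "\<rho> = exp (- (G * \<theta>))" by (auto simp: \<rho>_def exp_powr_real)
  \<comment> \<open>Makes \<rho>^(i k) \<le> 1 / k^2, which is summable.\<close>
  define b where "b = 2 / (G * \<theta>)"
  have b: "0 < b" using G0 \<theta> by (simp add: b_def)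
  define \<beta> where "\<beta> = ln (1 + lam)"
  have \<beta>: "0 < \<beta>" using lam by (simp add: \<beta>_def)
  \<comment> \<open>The straight-path estimate may need of order (1 + \<lambda>)^(i k) attempts,
    that is k^(b * \<beta>) up to a constant. Along all times n this could exceed the available
    time; along n = k^N there is room for k^(N-1) attempts, which beat this power with a factor k to
    spare.\<close>
  define N where "N = nat \<lceil>b * \<beta>\<rceil> + 3"
  have N: "3 \<le> N" "b * \<beta> \<le> real (N - 2)" unfolding N_def by (simp, linarith)
  define i where "i k = nat \<lceil>b * ln (real k)\<rceil>" for k :: nat
  define t where "t k = k ^ (N - 1) * i k" for k
  define n where "n k = k ^ N" for k :: nat
  have nK: "n k = k ^ (N - 1) * k" for k using N(1) power_Suc2[of k "N - 1"] by (simp add: n_def Suc_diff_Suc numeral_3_eq_3)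
  define L where "L k = nat \<lceil>a' * real (n k)\<rceil>" for k
  define x where "x k \<kappa> = hit_mean lam 0 1 (i k) 0 (\<lambda>r z. \<rho> ^ i k * Q r (subtree z \<kappa>) powr - \<theta>) \<kappa> (t k) (n k) []" for k \<kappa>
  have "\<forall>\<^sub>F k :: real in at_top. b * ln k + 1 \<le> k"
    using b by real_asymp
  then have ev1: "\<forall>\<^sub>F k in sequentially. b * ln (real k) + 1 \<le> real k"
    by (rule eventually_compose_filterlim[OF _ filterlim_real_sequentially])
  define c where "c = a - a'"
  have c: "0 < c" using a' by (simp add: c_def)
  have "\<forall>\<^sub>F k :: real in at_top. (1 + \<bar>B\<bar>) + a * (b * ln k + 1) \<le> c * k"
    using b c by real_asymp
  then have ev2: "\<forall>\<^sub>F k in sequentially. (1 + \<bar>B\<bar>) + a * (b * ln (real k) + 1) \<le> c * real k"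
    by (rule eventually_compose_filterlim[OF _ filterlim_real_sequentially])
  have i_bounds: "b * ln (real k) \<le> real (i k)" "real (i k) \<le> b * ln (real k) + 1" if "1 \<le> k" for k
  proof -
    have "0 \<le> b * ln (real k)" using that b by simp
    then show "b * ln (real k) \<le> real (i k)" "real (i k) \<le> b * ln (real k) + 1" unfolding i_def by linarith+
  qed
  have bound: "\<forall>\<^sub>F k in sequentially. \<forall>\<kappa>. leafless \<kappa> \<longrightarrow>
      miss_prob mu lam \<kappa> (L k) (n k) [] \<le> x k \<kappa> + exp (- (1 / (1 + lam))) ^ k"
    using ev1 ev2 eventually_ge_at_top[of 1]
  proof eventually_elim
    case (elim k)
    let ?K = "real (k ^ (N - 1))"
    have K: "1 \<le> ?K" using elim(3) by simp
    have ik: "real (i k) \<le> real k" using elim(1) i_bounds(2)[OF elim(3)] by linarith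
    then have tn: "t k \<le> n k" unfolding t_def nK by simp
    \<comment> \<open>The search for level i k takes the fraction i k / k of the time, which the gap
      between a' and a absorbs together with B.\<close>
    have reach_time: "real (L k) + B \<le> a * real (n k - t k)"
    proof -
      have "0 \<le> a' * real (n k)" using a' by simp
      then have "real (L k) \<le> a' * real (n k) + 1" unfolding L_def by linarith
      moreover have "a' * real (n k) + (1 + B) \<le> a * real (n k) - a * real (t k)"
      proof -
        have "(1 + B) + a * real (t k) \<le> ?K * (1 + \<bar>B\<bar>) + a * real (t k)"
          using mult_right_mono[OF K, of "1 + \<bar>B\<bar>"] by simp
        also have "a * real (t k) \<le> ?K * (a * (b * ln (real k) + 1))"
          using mult_left_mono[OF i_bounds(2)[OF elim(3)], of "a * ?K"] a0 by (simp add: t_def algebra_simps)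
        also have "?K * (1 + \<bar>B\<bar>) + ?K * (a * (b * ln (real k) + 1)) = ?K * ((1 + \<bar>B\<bar>) + a * (b * ln (real k) + 1))"
          by (simp add: algebra_simps)
        also have "\<dots> \<le> ?K * (c * real k)" using elim(2) by (intro mult_left_mono) auto
        also have "\<dots> = c * real (n k)" by (simp add: nK)
        finally show ?thesis by (simp add: c_def algebra_simps)
      qed
      ultimately show ?thesis using tn by (simp add: of_nat_diff algebra_simps)
    qed
    show ?case
    proof (intro allI impI)
      fix \<kappa> :: "nat list \<Rightarrow> nat" assume \<kappa>: "leafless \<kappa>"
      let ?b = "\<lambda>r z. \<rho> ^ i k * Q r (subtree z \<kappa>) powr - \<theta>"
      have "miss_prob mu lam \<kappa> (L k) (n k) [] \<le>
          hit_mean lam 0 1 (i k) 1 (\<lambda>r z. (pgf mu ^^ i k) (miss_prob mu lam \<kappa> (L k) r z)) \<kappa> (t k) (n k) []"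
        using miss_prob_le_hit_mean[OF lam \<kappa> mu(1,3), of "[]" "i k" "t k" "n k" "L k"] tn by simp
      also have "\<dots> \<le> hit_mean lam 0 1 (i k) 1 ?b \<kappa> (t k) (n k) []"
      proof (rule hit_mean_mono_time[OF lam _ \<kappa>])
        fix r and z :: "nat list" assume z: "length z = i k" and r: "n k \<le> r + t k"
        have "a * real (n k - t k) \<le> a * real r" using r a0 by (intro mult_left_mono) auto
        then have "real (L k) + B \<le> real (length z) + a * real r" using reach_time by linarith
        from Q[OF \<kappa> this] have q: "Q r (subtree z \<kappa>) \<le> 1 - miss_prob mu lam \<kappa> (L k) r z" by simp
        have q0: "0 < Q r (subtree z \<kappa>)" by (rule Qpos[OF leafless_subtree[OF \<kappa>]])
        have mp: "0 \<le> miss_prob mu lam \<kappa> (L k) r z" by (rule miss_prob_bounds[OF lam \<kappa> mu(1,3)])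
        have "(pgf mu ^^ i k) (miss_prob mu lam \<kappa> (L k) r z) \<le> (pgf mu ^^ i k) (1 - Q r (subtree z \<kappa>))"
          using q q0 mp by (intro funpow_pgf_mono) auto
        also have "\<dots> \<le> ?b r z" unfolding \<rho>_def using q q0 mp by (intro \<theta>0(2) \<theta>) auto
        finally show "(pgf mu ^^ i k) (miss_prob mu lam \<kappa> (L k) r z) \<le> ?b r z" by simp
      qed auto
      \<comment> \<open>Either level i k is reached in time, or it is missed despite all straight
        attempts.\<close>
      also have "\<dots> = x k \<kappa> + miss_level lam \<kappa> (i k) (t k) []"
        using hit_mean_add[of lam 0 1 "i k" 1 0 1 1 ?b "\<lambda>_ _. 0" \<kappa> "t k" "n k" "[]"]
          hit_mean_indep_time[of lam 0 1 "i k" 1 "\<lambda>_. 0" \<kappa> "t k" "n k" "[]" 0]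
        by (simp add: x_def miss_level_def[OF lam \<kappa>])
      also have "miss_level lam \<kappa> (i k) (t k) [] \<le> exp (- (1 / (1 + lam))) ^ k"
      proof -
        let ?p = "1 / (1 + lam) ^ i k"
        have "miss_level lam \<kappa> (i k) (t k) [] \<le> (1 - ?p) ^ (k ^ (N - 1))"
          unfolding t_def by (rule miss_level_le[OF lam \<kappa>]) simp
        also have "\<dots> \<le> exp (- ?p) ^ (k ^ (N - 1))"
          using exp_ge_add_one_self[of "- ?p"] lam by (intro power_mono) auto
        also have "\<dots> = exp (- (?K * ?p))" by (simp add: exp_of_nat_mult[symmetric])
        also have "\<dots> \<le> exp (- (real k / (1 + lam)))"
        proof -
          have k1: "1 \<le> real k" using elim(3) by simp
          have "(1 + lam) ^ i k = exp (\<beta> * real (i k))"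
            using lam by (simp add: \<beta>_def mult.commute[of "ln (1 + lam)"] exp_of_nat_mult)
          also have "\<dots> \<le> exp (\<beta> * (b * ln (real k) + 1))"
            using i_bounds(2)[OF elim(3)] \<beta> by (simp add: mult_left_mono)
          also have "\<dots> = (1 + lam) * exp (b * \<beta> * ln (real k))"
            using lam by (simp add: \<beta>_def exp_add algebra_simps)
          also have "exp (b * \<beta> * ln (real k)) \<le> exp (real (N - 2) * ln (real k))"
            using N(2) k1 by (simp add: mult_right_mono)
          also have "exp (real (N - 2) * ln (real k)) = real k ^ (N - 2)"
            using k1 by (simp add: exp_of_nat_mult)
          finally have e: "(1 + lam) ^ i k \<le> (1 + lam) * real k ^ (N - 2)" using lam by simp
          have KN: "?K = real k * real k ^ (N - 2)"
            using N(1) power_Suc[of "real k" "N - 2"] by (simp add: Suc_diff_le numeral_3_eq_3 numeral_2_eq_2 Suc_diff_Suc)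
          have "real k / (1 + lam) = ?K / ((1 + lam) * real k ^ (N - 2))"
            unfolding KN using k1 lam by simp
          also have "\<dots> \<le> ?K / (1 + lam) ^ i k"
            using e lam k1 by (intro divide_left_mono) auto
          finally show ?thesis by simp
        qed
        also have "\<dots> = exp (- (1 / (1 + lam))) ^ k" by (simp add: exp_of_nat_mult[symmetric])
        finally show ?thesis .
      qed
      finally show "miss_prob mu lam \<kappa> (L k) (n k) [] \<le> x k \<kappa> + exp (- (1 / (1 + lam))) ^ k" by simp
    qed
  qed
  have xm: "x k \<in> borel_measurable (BGW p)" for k
    unfolding x_def
  proof (rule measurable_hit_mean)
    fix r z
    have [measurable]: "(\<lambda>\<kappa>. Q r (subtree z \<kappa>)) \<in> borel_measurable (BGW p)"
      by (rule measurable_compose[OF measurable_subtree Qm])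
    show "(\<lambda>\<kappa>. \<rho> ^ i k * Q r (subtree z \<kappa>) powr - \<theta>) \<in> borel_measurable (BGW p)" by measurable
  qed
  have x0: "0 \<le> x k \<kappa>" for k \<kappa>
    unfolding x_def using \<rho> lam by (intro hit_mean_nonneg_any) auto
  \<comment> \<open>Q is evaluated on the subtree at the hitting place, so its moment factors out
    although that place depends on the lower levels of the environment.\<close>
  have Ex: "(\<integral>\<^sup>+\<kappa>. ennreal (x k \<kappa>) \<partial>BGW p) \<le> ennreal (C * (1 / real k ^ 2))" if "1 \<le> k" for k
  proof -
    have "(\<integral>\<^sup>+\<kappa>. 1 * ennreal (x k \<kappa>) \<partial>BGW p) \<le>
        ennreal (\<rho> ^ i k * C) * (\<integral>\<^sup>+\<kappa>. 1 * ennreal (hit_mean lam 0 1 (i k) 0 (\<lambda>_ _. 1) \<kappa> (t k) (n k) []) \<partial>BGW p)"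
      unfolding x_def
    proof (rule nn_integral_hit_mean_le[where g = "\<lambda>r \<kappa>. \<rho> ^ i k * Q r \<kappa> powr - \<theta>"])
      fix r
      note [measurable] = Qm
      show "(\<lambda>\<kappa>. \<rho> ^ i k * Q r \<kappa> powr - \<theta>) \<in> borel_measurable (BGW p)" by measurable
      have "(\<integral>\<^sup>+\<kappa>. ennreal (\<rho> ^ i k * Q r \<kappa> powr - \<theta>) \<partial>BGW p) = ennreal (\<rho> ^ i k) * (\<integral>\<^sup>+\<kappa>. ennreal (Q r \<kappa> powr - \<theta>) \<partial>BGW p)"
        using \<rho> by (subst nn_integral_cmult[symmetric]) (simp_all add: ennreal_mult)
      also have "\<dots> \<le> ennreal (\<rho> ^ i k) * ennreal C" by (intro mult_left_mono EQ) simp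
      finally show "(\<integral>\<^sup>+\<kappa>. ennreal (\<rho> ^ i k * Q r \<kappa> powr - \<theta>) \<partial>BGW p) \<le> ennreal (\<rho> ^ i k * C)"
        using \<rho> C by (simp add: ennreal_mult)
    qed (use lam \<rho> in auto)
    also have "(\<integral>\<^sup>+\<kappa>. 1 * ennreal (hit_mean lam 0 1 (i k) 0 (\<lambda>_ _. 1) \<kappa> (t k) (n k) []) \<partial>BGW p) \<le> (\<integral>\<^sup>+\<kappa>. 1 \<partial>BGW p)"
    proof (rule nn_integral_mono_AE)
      show "AE \<kappa> in BGW p. 1 * ennreal (hit_mean lam 0 1 (i k) 0 (\<lambda>_ _. 1) \<kappa> (t k) (n k) []) \<le> 1"
        using AE_BGW_leafless[OF p0]
      proof eventually_elim
        case (elim \<kappa>)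
        have "hit_mean lam 0 1 (i k) 0 (\<lambda>_ _. 1) \<kappa> (t k) (n k) [] \<le> 1 ^ t k * 1"
          using lam elim by (intro hit_mean_le) auto
        then show ?case by (simp add: ennreal_le_1)
      qed
    qed
    also have "\<dots> = 1" using prob_space.emeasure_space_1[OF prob_space_BGW, of p] by simp
    finally have "(\<integral>\<^sup>+\<kappa>. ennreal (x k \<kappa>) \<partial>BGW p) \<le> ennreal (\<rho> ^ i k * C)"
      by (simp add: mult_left_mono)
    also have "\<rho> ^ i k * C \<le> C * (1 / real k ^ 2)"
    proof -
      have "\<rho> ^ i k = exp (- (G * \<theta>) * real (i k))" unfolding \<rho>(2) by (simp add: exp_of_nat2_mult[symmetric])
      also have "\<dots> \<le> exp (- (G * \<theta>) * (b * ln (real k)))"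
        using i_bounds(1)[OF that] G0 \<theta> by (simp add: mult_left_mono)
      also have "- (G * \<theta>) * (b * ln (real k)) = - (2 * ln (real k))" using G0 \<theta> by (simp add: b_def)
      also have "exp (- (2 * ln (real k))) = 1 / real k ^ 2"
        using that by (simp add: exp_minus exp_of_nat_mult[of 2, simplified] inverse_eq_divide)
      finally have "\<rho> ^ i k \<le> 1 / real k ^ 2" .
      from mult_left_mono[OF this C] show ?thesis by (simp only: mult.commute[of "\<rho> ^ i k"])
    qed
    finally show ?thesis by (simp add: ennreal_leI)
  qed
  have "AE \<kappa> in BGW p. summable (\<lambda>k. x k \<kappa>)"
  proof (rule AE_summable[where y = "\<lambda>k. C * (1 / real k ^ 2)"])
    show "\<forall>\<^sub>F k in sequentially. (\<integral>\<^sup>+\<kappa>. ennreal (x k \<kappa>) \<partial>BGW p) \<le> ennreal (C * (1 / real k ^ 2))"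
      using eventually_ge_at_top[of 1] by eventually_elim (rule Ex)
    show "summable (\<lambda>k. C * (1 / real k ^ 2))"
      using inverse_power_summable[of 2, where 'a = real] by (intro summable_mult) (simp add: inverse_eq_divide)
  qed (use xm x0 C in auto)
  then have "AE \<kappa> in BGW p. summable (\<lambda>k. miss_prob mu lam \<kappa> (L k) (n k) [])"
    using AE_BGW_leafless[OF p0]
  proof eventually_elim
    case (elim \<kappa>)
    have "summable (\<lambda>k. x k \<kappa> + exp (- (1 / (1 + lam))) ^ k)"
      using elim(1) lam by (intro summable_add summable_geometric) auto
    then show ?case
    proof (rule summable_comparison_test_ev[rotated])
      show "\<forall>\<^sub>F k in sequentially. norm (miss_prob mu lam \<kappa> (L k) (n k) []) \<le> x k \<kappa> + exp (- (1 / (1 + lam))) ^ k"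
        using bound by eventually_elim (use elim(2) miss_prob_bounds[OF lam elim(2) mu(1,3)] in auto)
    qed
  qed
  then show ?thesis using that[of N] N(1) unfolding L_def n_def by auto
qed

text \<open>For v = 0 the rate may be linear near 0, and then a itself violates the strict
  inequality on which \<open>early_hits\<close> rests. The last point whose cost per level does not
  exceed that of a satisfies it; compactness provides this point.\<close>

lemma extremal_slope:
  assumes "v < a" "a \<le> 1"
  obtains \<alpha> where "a \<le> \<alpha>" "\<alpha> \<le> 1" "I \<alpha> / \<alpha> \<le> I a / a" "\<And>x. \<lbrakk>\<alpha> < x; x \<le> 1\<rbrakk> \<Longrightarrow> I \<alpha> / \<alpha> < I x / x"
proof -
  let ?S = "{x \<in> {a..1}. I x / x \<in> {..I a / a}}"
  have a0: "0 < a" using assms v by linarith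
  have "continuous_on {a..1} I" by (rule continuous_on_subset[OF I_cont]) (use assms in auto)
  then have "continuous_on {a..1} (\<lambda>x. I x / x)" using a0 by (intro continuous_on_divide continuous_on_id) auto
  then have "closed ({a..1} \<inter> (\<lambda>x. I x / x) -` {..I a / a})" by (rule continuous_closed_preimage) auto
  moreover have "{a..1} \<inter> (\<lambda>x. I x / x) -` {..I a / a} = ?S" by auto
  ultimately have "closed ?S" by simp
  moreover have "bounded ?S" by (rule bounded_subset[of "{a..1}"]) auto
  ultimately have "compact ?S" by (simp add: compact_eq_bounded_closed)
  moreover have "?S \<noteq> {}" using assms by auto
  ultimately have "\<exists>\<alpha>\<in>?S. \<forall>x\<in>?S. x \<le> \<alpha>" by (intro compact_attains_sup)
  then obtain \<alpha> where \<alpha>: "\<alpha> \<in> ?S" "\<forall>x\<in>?S. x \<le> \<alpha>" by (elim bexE)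
  show ?thesis
  proof
    show "a \<le> \<alpha>" "\<alpha> \<le> 1" "I \<alpha> / \<alpha> \<le> I a / a" using \<alpha>(1) by auto
    fix x assume x: "\<alpha> < x" "x \<le> 1"
    then have "x \<notin> ?S" using \<alpha>(2) by auto
    then have "I a / a < I x / x" using x \<alpha>(1) by auto
    then show "I \<alpha> / \<alpha> < I x / x" using \<alpha>(1) by auto
  qed
qed

text \<open>If v = 0, it may be optimal to stay close to the root for a positive fraction of the time, where
the population grows, and to climb afterwards at the speed \<alpha> that minimises the cost per level.\<close>
lemma miss_prob_summable_speed_zero:
  assumes v0: "v = 0" and a: "v < a" "a \<le> 1" "I a < ln (measure_pmf.expectation mu real)"
    and mu: "pmf mu 0 = 0" "pmf mu 1 < 1" "integrable (measure_pmf mu) real"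
    and m: "1 < measure_pmf.expectation mu real" and a': "0 \<le> a'" "a' < a"
    and pmean: "integrable (measure_pmf p) real"
  shows "AE \<kappa> in BGW p. summable (\<lambda>n. miss_prob mu lam \<kappa> (nat \<lceil>a' * real n\<rceil>) n [])"
proof -
  let ?m = "measure_pmf.expectation mu real"
  have a0: "0 < a" using a v by linarith
  obtain \<alpha> where \<alpha>: "a \<le> \<alpha>" "\<alpha> \<le> 1" "I \<alpha> / \<alpha> \<le> I a / a" and ext: "\<And>x. \<lbrakk>\<alpha> < x; x \<le> 1\<rbrakk> \<Longrightarrow> I \<alpha> / \<alpha> < I x / x"
    using extremal_slope[OF a(1,2)] by metis
  have v\<alpha>: "v < \<alpha>" and \<alpha>0: "0 < \<alpha>" using a \<alpha> a0 by auto
  define a2 where "a2 = (a' + a) / 2"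
  have a2: "0 < a2" "a' < a2" "a2 < a" using a' a0 by (auto simp: a2_def)
  obtain g where g: "I a < g" "g < ln ?m" using dense[OF a(3)] by blast
  have g0: "0 < g" using I_pos[OF a(1,2)] g by linarith
  have eg: "1 < exp g" "exp g < ?m" using g0 g m exp_less_mono[of g "ln ?m"] by auto
  \<comment> \<open>The climb at speed \<alpha> takes the fraction a2 / \<alpha> of the time and
    loses G - g per generation. Growth at rate g during the rest outweighs this exactly when G < g *
    \<alpha> / a2. There is room for such a G above I \<alpha> because I \<alpha> / \<alpha> \<le> I
    a / a < g / a2.\<close>
  have "max g (I \<alpha>) < g * \<alpha> / a2"
  proof -
    have 1: "g < g * \<alpha> / a2" using g0 a2 \<alpha> by (simp add: field_simps)
    have "I \<alpha> \<le> I a * (\<alpha> / a)" using \<alpha>(3) \<alpha>0 a0 by (simp add: field_simps)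
    also have "\<dots> < g * (\<alpha> / a)" using g(1) \<alpha>0 a0 by (intro mult_strict_right_mono) auto
    also have "\<dots> \<le> g * (\<alpha> / a2)" using g0 a2 \<alpha>0 by (intro mult_left_mono divide_left_mono) auto
    finally show ?thesis using 1 by simp
  qed
  then obtain G where G: "max g (I \<alpha>) < G" "G < g * \<alpha> / a2" using dense by blast
  have G': "I \<alpha> < G" "g \<le> G" "0 < G" using G(1) g0 by auto
  obtain \<theta>0 where \<theta>0: "0 < \<theta>0"
    "\<And>\<theta> j q. \<lbrakk>0 < \<theta>; \<theta> \<le> \<theta>0; 0 < q; q \<le> 1\<rbrakk> \<Longrightarrow> (pgf mu ^^ j) (1 - q) \<le> (exp g powr - \<theta>) ^ j * q powr - \<theta>"
    using pgf_iterate_decay[OF mu eg] by blast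
  obtain Q B \<theta> C where \<theta>: "0 < \<theta>" "\<theta> \<le> \<theta>0" and C: "0 \<le> C"
    and Qm: "\<And>n. Q n \<in> borel_measurable (BGW p)"
    and Qpos: "\<And>n \<kappa>. leafless \<kappa> \<Longrightarrow> 0 < Q n \<kappa>"
    and Q: "\<And>n \<kappa> L y. \<lbrakk>leafless \<kappa>; real L + B \<le> real (length y) + \<alpha> * real n\<rbrakk>
       \<Longrightarrow> exp (g - G) ^ n * Q n (subtree y \<kappa>) \<le> 1 - miss_prob mu lam \<kappa> L n y"
    and EQ: "\<And>n. (\<integral>\<^sup>+\<kappa>. ennreal (Q n \<kappa> powr - \<theta>) \<partial>BGW p) \<le> ennreal C"
    apply (rule climb_bound[OF v\<alpha> \<alpha>(2) ext G'(1,2) mu(1,3) eg(2) \<theta>0(1)])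
     apply assumption+
    subgoal premises prems by (rule prems(1)[OF prems(2-8)])
    done
  \<comment> \<open>The net exponential gain per generation after paying for the climb.\<close>
  define \<xi> where "\<xi> = g - G * (a2 / \<alpha>)"
  have \<xi>: "0 < \<xi>" using G(2) a2 \<alpha>0 by (simp add: \<xi>_def field_simps)
  define mB where "mB = max 1 (measure_pmf.expectation p real)"
  have mB: "1 \<le> mB" "measure_pmf.expectation p real \<le> mB" by (auto simp: mB_def)
  have mB0: "0 \<le> measure_pmf.expectation p real" by (rule integral_nonneg_AE) auto
  define \<beta> where "\<beta> = ln mB"
  have \<beta>: "0 \<le> \<beta>" using mB by (simp add: \<beta>_def)
  \<comment> \<open>During the growth phase the walk may use levels up to about \<delta> * n. The
    expected number of vertices there is of order mB^(\<delta> * n), up to a linear factor; this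
    consumes at most half of the gain \<theta> * \<xi>.\<close>
  define \<delta> where "\<delta> = min 1 (\<theta> * \<xi> / (2 * (\<beta> + 1)))"
  have \<delta>: "0 < \<delta>" "\<delta> \<le> 1" using \<theta> \<xi> \<beta> by (auto simp: \<delta>_def)
  have \<beta>\<delta>: "\<beta> * \<delta> \<le> \<theta> * \<xi> / 2"
  proof -
    have "(\<beta> + 1) * \<delta> \<le> (\<beta> + 1) * (\<theta> * \<xi> / (2 * (\<beta> + 1)))" using \<beta> by (intro mult_left_mono) (auto simp: \<delta>_def)
    also have "\<dots> = \<theta> * \<xi> / 2"
    proof -
      have "b * (x / (2 * b)) = x / 2" if "0 < b" for b x :: real using that by simp
      from this[of "\<beta> + 1"] show ?thesis using \<beta> by simp
    qed
    finally show ?thesis using \<delta> by (simp add: algebra_simps)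
  qed
  define r where "r n = nat \<lceil>a2 / \<alpha> * real n\<rceil>" for n :: nat
  define j where "j n = n - r n" for n
  define l where "l n = nat \<lceil>\<delta> * real n\<rceil> + 1" for n :: nat
  have ratio: "0 < a2 / \<alpha>" "a2 / \<alpha> < 1" using a2 \<alpha> \<alpha>0 by auto
  have r: "a2 / \<alpha> * real n \<le> real (r n)" "real (r n) \<le> a2 / \<alpha> * real n + 1" "r n \<le> n" for n
  proof -
    have "0 \<le> a2 / \<alpha> * real n" using ratio by (intro mult_nonneg_nonneg) auto
    then show "a2 / \<alpha> * real n \<le> real (r n)" "real (r n) \<le> a2 / \<alpha> * real n + 1" unfolding r_def by linarith+
    have "a2 / \<alpha> * real n \<le> 1 * real n" using ratio by (intro mult_right_mono) auto
    then show "r n \<le> n" by (simp add: r_def nat_le_iff ceiling_le_iff)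
  qed
  have jr: "j n + r n = n" "real (j n) = real n - real (r n)" for n using r(3)[of n] by (auto simp: j_def of_nat_diff)
  have l: "real (l n) \<le> \<delta> * real n + 2" "\<delta> * real n \<le> real (l n)" for n
  proof -
    have "0 \<le> \<delta> * real n" using \<delta> by simp
    then show "real (l n) \<le> \<delta> * real n + 2" "\<delta> * real n \<le> real (l n)" unfolding l_def by linarith+
  qed
  define \<rho> where "\<rho> = exp g powr - \<theta>"
  define h where "h n \<kappa> = \<rho> ^ j n * (exp (g - G) ^ r n) powr - \<theta> * Q (r n) \<kappa> powr - \<theta>" for n \<kappa>
  \<comment> \<open>The position after the growth phase depends on the environment, including the
    subtree of that position, which may have been visited before. Independence is replaced by a sum
    over all vertices at levels below \<open>l n\<close>, whose mean is controlled by the mean of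
    p.\<close>
  define S where "S n \<kappa> = (\<Sum>k<l n. level_sum k (h n) \<kappa>)" for n \<kappa>
  have h0: "0 \<le> h n \<kappa>" for n \<kappa> by (simp add: h_def \<rho>_def)
  have hm: "h n \<in> borel_measurable (BGW p)" for n
    unfolding h_def using Qm[of "r n"] by measurable
  have Sm: "S n \<in> borel_measurable (BGW p)" for n
    unfolding S_def by (intro borel_measurable_sum measurable_level_sum hm)
  have S0: "0 \<le> S n \<kappa>" for n \<kappa>
    unfolding S_def by (intro sum_nonneg level_sum_nonneg h0)
  have "\<forall>\<^sub>F n in sequentially. (1 + B) / (a2 - a') \<le> real n"
    by (rule filterlim_at_top[THEN iffD1, OF filterlim_real_sequentially, rule_format])
  then have bound: "\<forall>\<^sub>F n in sequentially. \<forall>\<kappa>. leafless \<kappa> \<longrightarrow>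
      miss_prob mu lam \<kappa> (nat \<lceil>a' * real n\<rceil>) n [] \<le> dev lam \<kappa> (j n) \<delta> + S n \<kappa>"
  proof eventually_elim
    case (elim n)
    let ?L = "nat \<lceil>a' * real n\<rceil>"
    have "0 \<le> a' * real n" using a' by simp
    then have "real ?L \<le> a' * real n + 1" by linarith
    moreover have "1 + B \<le> (a2 - a') * real n" using elim a2 by (simp add: field_simps)
    moreover have "a2 * real n \<le> \<alpha> * real (r n)" using r(1)[of n] \<alpha>0 by (simp add: field_simps)
    ultimately have cond: "real ?L + B \<le> \<alpha> * real (r n)" by (simp add: algebra_simps)
    show ?case
    proof (intro allI impI)
      fix \<kappa> :: "nat list \<Rightarrow> nat" assume \<kappa>: "leafless \<kappa>"
      have "miss_prob mu lam \<kappa> ?L (j n + r n) [] \<le>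
          walk_mean lam \<kappa> (j n) (\<lambda>y. (pgf mu ^^ j n) (miss_prob mu lam \<kappa> ?L (r n) y)) []"
        by (rule miss_prob_le_walk_mean[OF lam \<kappa> mu(1,3)])
      \<comment> \<open>Walks at height \<delta> * j n or more are given up: for v = 0 they are
        exponentially rare.\<close>
      also have "\<dots> \<le> walk_mean lam \<kappa> (j n) (\<lambda>y. 1 * (if \<delta> * real (j n) \<le> real (length y) then 1 else 0) + 1 * S n \<kappa>) []"
      proof (rule walk_mean_mono_tree[OF lam \<kappa>])
        show "in_tree \<kappa> []" by (simp add: in_tree_def)
        fix y assume y: "in_tree \<kappa> y"
        have mp: "0 \<le> miss_prob mu lam \<kappa> ?L (r n) y" "miss_prob mu lam \<kappa> ?L (r n) y \<le> 1"
          by (rule miss_prob_bounds[OF lam \<kappa> mu(1,3)])+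
        show "(pgf mu ^^ j n) (miss_prob mu lam \<kappa> ?L (r n) y) \<le>
            1 * (if \<delta> * real (j n) \<le> real (length y) then 1 else 0) + 1 * S n \<kappa>"
        proof (cases "\<delta> * real (j n) \<le> real (length y)")
          case True
          then show ?thesis using funpow_pgf_in_01[OF mp, of "j n" mu] S0[of n \<kappa>] by simp
        next
          case False
          let ?q = "exp (g - G) ^ r n * Q (r n) (subtree y \<kappa>)"
          have "real ?L + B \<le> real (length y) + \<alpha> * real (r n)" using cond by linarith
          from Q[OF \<kappa> this] have q: "?q \<le> 1 - miss_prob mu lam \<kappa> ?L (r n) y" .
          have q0: "0 < ?q" using Qpos[OF leafless_subtree[OF \<kappa>]] by simp
          have "(pgf mu ^^ j n) (miss_prob mu lam \<kappa> ?L (r n) y) \<le> (pgf mu ^^ j n) (1 - ?q)"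
            using q q0 mp by (intro funpow_pgf_mono) auto
          also have "\<dots> \<le> \<rho> ^ j n * ?q powr - \<theta>" unfolding \<rho>_def using q q0 mp by (intro \<theta>0(2) \<theta>) auto
          also have "\<dots> = h n (subtree y \<kappa>)"
            using Qpos[OF leafless_subtree[OF \<kappa>], of "r n" y] by (simp add: h_def powr_mult)
          also have "\<dots> \<le> level_sum (length y) (h n) \<kappa>" by (rule level_sum_ge[OF h0 y])
          also have "\<dots> \<le> S n \<kappa>"
          proof -
            have "\<delta> * real (j n) \<le> \<delta> * real n" using \<delta> by (intro mult_left_mono) (auto simp: j_def)
            then have "length y < l n" using False l(2)[of n] by linarith
            then show ?thesis unfolding S_def by (intro member_le_sum level_sum_nonneg h0) auto
          qed
          finally show ?thesis using False by simp
        qed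
      qed
      also have "\<dots> = dev lam \<kappa> (j n) \<delta> + S n \<kappa>"
        unfolding walk_mean_add[OF lam \<kappa>] walk_mean_const[OF lam \<kappa>] by (simp add: dev_def)
      finally show "miss_prob mu lam \<kappa> ?L n [] \<le> dev lam \<kappa> (j n) \<delta> + S n \<kappa>" by (simp add: jr)
    qed
  qed
  define y where "y n = C * exp (\<theta> * G + 2 * \<beta>) * ((real n + 2) * exp (- (\<theta> * \<xi> / 2) * real n))" for n :: nat
  have ES: "(\<integral>\<^sup>+\<kappa>. ennreal (S n \<kappa>) \<partial>BGW p) \<le> ennreal (y n)" for n
  proof -
    let ?c = "\<rho> ^ j n * (exp (g - G) ^ r n) powr - \<theta>"
    have c: "0 \<le> ?c" by (simp add: \<rho>_def)
    have Eh: "(\<integral>\<^sup>+\<kappa>. ennreal (h n \<kappa>) \<partial>BGW p) \<le> ennreal (?c * C)"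
    proof -
      note [measurable] = Qm
      have "(\<integral>\<^sup>+\<kappa>. ennreal (h n \<kappa>) \<partial>BGW p) = ennreal ?c * (\<integral>\<^sup>+\<kappa>. ennreal (Q (r n) \<kappa> powr - \<theta>) \<partial>BGW p)"
        unfolding h_def using c by (subst nn_integral_cmult[symmetric]) (simp_all add: ennreal_mult)
      also have "\<dots> \<le> ennreal ?c * ennreal C" by (intro mult_left_mono EQ) simp
      finally show ?thesis using c C by (simp add: ennreal_mult)
    qed
    have "(\<integral>\<^sup>+\<kappa>. ennreal (S n \<kappa>) \<partial>BGW p) = (\<integral>\<^sup>+\<kappa>. (\<Sum>k<l n. ennreal (level_sum k (h n) \<kappa>)) \<partial>BGW p)"
      unfolding S_def using level_sum_nonneg[of "h n"] h0 by (simp add: sum_ennreal)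
    also have "\<dots> = (\<Sum>k<l n. \<integral>\<^sup>+\<kappa>. ennreal (level_sum k (h n) \<kappa>) \<partial>BGW p)"
      by (rule nn_integral_sum) (intro measurable_compose[OF measurable_level_sum[OF hm] measurable_ennreal])
    also have "\<dots> = (\<Sum>k<l n. ennreal (measure_pmf.expectation p real) ^ k * (\<integral>\<^sup>+\<kappa>. ennreal (h n \<kappa>) \<partial>BGW p))"
      by (intro sum.cong refl nn_integral_level_sum hm h0 pmean)
    also have "\<dots> \<le> (\<Sum>k<l n. ennreal (mB ^ l n) * ennreal (?c * C))"
    proof (intro sum_mono mult_mono Eh)
      fix k assume k: "k \<in> {..<l n}"
      have "measure_pmf.expectation p real ^ k \<le> mB ^ k" using mB mB0 by (intro power_mono)
      also have "\<dots> \<le> mB ^ l n" using mB k by (intro power_increasing) auto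
      finally show "ennreal (measure_pmf.expectation p real) ^ k \<le> ennreal (mB ^ l n)"
        using mB0 by (simp add: ennreal_power ennreal_leI)
    qed auto
    also have "\<dots> = ennreal (real (l n) * (mB ^ l n * (?c * C)))"
      using mB c C by (simp add: ennreal_mult ennreal_of_nat_eq_real_of_nat)
    also have "real (l n) * (mB ^ l n * (?c * C)) \<le> y n"
    proof -
      have 1: "real (l n) \<le> real n + 2" using l(1)[of n] \<delta> mult_right_mono[of \<delta> 1 "real n"] by simp
      have 2: "mB ^ l n \<le> exp (\<theta> * \<xi> / 2 * real n + 2 * \<beta>)"
      proof -
        have "mB ^ l n = exp (real (l n) * \<beta>)" using mB by (simp add: \<beta>_def exp_of_nat_mult)
        also have "real (l n) * \<beta> \<le> (\<delta> * real n + 2) * \<beta>" using l(1) \<beta> by (intro mult_right_mono)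
        also have "\<dots> = \<beta> * \<delta> * real n + 2 * \<beta>" by (simp add: algebra_simps)
        also have "\<beta> * \<delta> * real n \<le> \<theta> * \<xi> / 2 * real n" using \<beta>\<delta> by (intro mult_right_mono) auto
        finally show ?thesis by simp
      qed
      have 3: "?c \<le> exp (\<theta> * G - \<theta> * \<xi> * real n)"
      proof -
        have "?c = exp (- \<theta> * g * real (j n)) * exp (- \<theta> * (g - G) * real (r n))"
        proof -
          have "\<rho> = exp (- (\<theta> * g))" by (simp add: \<rho>_def exp_powr_real mult.commute)
          then have "\<rho> ^ j n = exp (real (j n) * (- (\<theta> * g)))" by (simp only: exp_of_nat_mult)
          moreover have "(exp (g - G) ^ r n) powr - \<theta> = exp (real (r n) * (g - G) * - \<theta>)"
            by (simp only: exp_of_nat_mult[symmetric] exp_powr_real)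
          ultimately show ?thesis by (simp add: algebra_simps)
        qed
        also have "\<dots> = exp (- \<theta> * (g * real n - G * real (r n)))"
          by (simp add: jr exp_add[symmetric] algebra_simps)
        also have "\<dots> \<le> exp (\<theta> * G - \<theta> * \<xi> * real n)"
        proof -
          have "G * real (r n) \<le> G * (a2 / \<alpha> * real n + 1)" using r(2) G' by (intro mult_left_mono) auto
          then have "\<xi> * real n - G \<le> g * real n - G * real (r n)" by (simp add: \<xi>_def algebra_simps)
          from mult_left_mono[OF this, of \<theta>] show ?thesis using \<theta> by (simp add: algebra_simps)
        qed
        finally show ?thesis .
      qed
      have "real (l n) * (mB ^ l n * (?c * C)) \<le> (real n + 2) * (exp (\<theta> * \<xi> / 2 * real n + 2 * \<beta>) * (exp (\<theta> * G - \<theta> * \<xi> * real n) * C))"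
        using 1 2 3 c C mB by (intro mult_mono) auto
      also have "\<dots> = y n"
      proof -
        have "exp (\<theta> * \<xi> / 2 * real n + 2 * \<beta>) * exp (\<theta> * G - \<theta> * \<xi> * real n) =
            exp (\<theta> * G + 2 * \<beta>) * exp (- (\<theta> * \<xi> / 2) * real n)"
          by (simp add: exp_add[symmetric] algebra_simps)
        then show ?thesis by (simp add: y_def ac_simps)
      qed
      finally show ?thesis .
    qed
    finally show ?thesis by (simp add: ennreal_leI)
  qed
  have y0: "0 \<le> y n" for n using C by (simp add: y_def)
  have ysum: "summable y"
  proof -
    define c where "c = \<theta> * \<xi> / 2"
    have c: "0 < c" using \<theta> \<xi> by (simp add: c_def)
    have "\<forall>\<^sub>F x :: real in at_top. (x + 2) * exp (- c * x) \<le> 1 / x ^ 2" using c by real_asymp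
    then have "\<forall>\<^sub>F n in sequentially. (real n + 2) * exp (- c * real n) \<le> 1 / real n ^ 2"
      by (rule eventually_compose_filterlim[OF _ filterlim_real_sequentially])
    then have "\<forall>\<^sub>F n in sequentially. norm ((real n + 2) * exp (- c * real n)) \<le> inverse (real n ^ 2)"
      by eventually_elim (simp add: inverse_eq_divide abs_mult)
    then have "summable (\<lambda>n. (real n + 2) * exp (- c * real n))"
      by (rule summable_comparison_test_ev) (rule inverse_power_summable, simp)
    then show ?thesis unfolding y_def[abs_def] c_def by (rule summable_mult)
  qed
  have Ssum: "AE \<kappa> in BGW p. summable (\<lambda>n. S n \<kappa>)"
    by (rule AE_summable[OF Sm _ _ ysum y0]) (use S0 ES in auto)
  define \<epsilon> where "\<epsilon> = I \<delta> / 2"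
  have \<epsilon>: "0 < \<epsilon>" using I_pos[of \<delta>] \<delta> v0 by (simp add: \<epsilon>_def)
  have dv: "AE \<kappa> in BGW p. \<forall>\<^sub>F n in sequentially.
    exp (- (I \<delta> + \<epsilon>) * real n) \<le> dev lam \<kappa> n \<delta> \<and> dev lam \<kappa> n \<delta> \<le> exp (- (I \<delta> - \<epsilon>) * real n)"
    using \<delta> v0 \<epsilon> by (intro dev_bounds) auto
  define s where "s = 1 - a2 / \<alpha>"
  have s: "0 < s" using ratio by (simp add: s_def)
  have js: "s * real n - 1 \<le> real (j n)" for n using r(2)[of n] by (simp add: jr s_def algebra_simps)
  have jlim: "filterlim j at_top sequentially"
  proof -
    have "filterlim (\<lambda>n. s * real n - 1) at_top sequentially"
      using s by real_asymp
    then have "filterlim (\<lambda>n. real (j n)) at_top sequentially"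
      by (rule filterlim_at_top_mono) (use js in auto)
    then show ?thesis by (simp add: filterlim_sequentially_iff_filterlim_real)
  qed
  show ?thesis
    using AE_BGW_leafless[OF p0] Ssum dv
  proof eventually_elim
    case (elim \<kappa>)
    have "\<forall>\<^sub>F n in sequentially. dev lam \<kappa> (j n) \<delta> \<le> exp (- (I \<delta> - \<epsilon>) * real (j n))"
      using eventually_compose_filterlim[OF elim(3) jlim] by eventually_elim auto
    with bound have ev: "\<forall>\<^sub>F n in sequentially. norm (miss_prob mu lam \<kappa> (nat \<lceil>a' * real n\<rceil>) n []) \<le>
        exp \<epsilon> * exp (- (\<epsilon> * s)) ^ n + S n \<kappa>"
    proof eventually_elim
      case (elim n)
      have "exp (- (I \<delta> - \<epsilon>) * real (j n)) \<le> exp (- \<epsilon> * (s * real n - 1))"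
        using js[of n] \<epsilon> mult_left_mono[OF js[of n], of \<epsilon>] by (simp add: \<epsilon>_def)
      also have "\<dots> = exp \<epsilon> * exp (- (\<epsilon> * s)) ^ n" by (simp add: exp_of_nat_mult[symmetric] exp_add[symmetric] algebra_simps)
      finally show ?case
        using elim \<open>leafless \<kappa>\<close> miss_prob_bounds[OF lam \<open>leafless \<kappa>\<close> mu(1,3), of "nat \<lceil>a' * real n\<rceil>" n "[]"] by fastforce
    qed
    have "summable (\<lambda>n. exp \<epsilon> * exp (- (\<epsilon> * s)) ^ n + S n \<kappa>)"
      using elim(2) \<epsilon> s by (intro summable_add summable_mult summable_geometric) auto
    then show ?case by (rule summable_comparison_test_ev[OF ev])
  qed
qed

end

section \<open>The maximal displacement\<close>

lemma AE_pair_fst: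
  assumes "prob_space M" "prob_space N" "AE x in M. P x"
  shows "AE \<omega> in M \<Otimes>\<^sub>M N. P (fst \<omega>)"
proof -
  interpret N: prob_space N by fact
  obtain Z where Z: "{x \<in> space M. \<not> P x} \<subseteq> Z" "emeasure M Z = 0" "Z \<in> sets M" using AE_E[OF assms(3)] by blast
  have "emeasure (M \<Otimes>\<^sub>M N) (Z \<times> space N) = 0" using Z by (simp add: N.emeasure_pair_measure_Times)
  then show ?thesis
    by (intro AE_I[where N = "Z \<times> space N"]) (use Z in \<open>auto simp: space_pair_measure\<close>)
qed

lemma AE_pair_snd:
  assumes "prob_space M" "prob_space N" "AE y in N. P y"
  shows "AE \<omega> in M \<Otimes>\<^sub>M N. P (snd \<omega>)"
proof -
  interpret N: prob_space N by fact
  obtain Z where Z: "{x \<in> space N. \<not> P x} \<subseteq> Z" "emeasure N Z = 0" "Z \<in> sets N" using AE_E[OF assms(3)] by blast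
  have "emeasure (M \<Otimes>\<^sub>M N) (space M \<times> Z) = 0" using Z by (simp add: N.emeasure_pair_measure_Times)
  then show ?thesis
    by (intro AE_I[where N = "space M \<times> Z"]) (use Z in \<open>auto simp: space_pair_measure\<close>)
qed

lemma brw_from_snoc: "brw_from ch x (u @ [i]) = ch (u @ [i]) (brw_from ch x u)"
  by (induction u arbitrary: ch x) simp_all

lemma in_tree_snoc: "in_tree \<nu> (u @ [i]) \<longleftrightarrow> in_tree \<nu> u \<and> i < \<nu> u"
  by (auto simp: in_tree_def nth_append less_Suc_eq)

lemma finite_generation: "finite (generation \<nu> n)"
proof (induction n)
  case 0
  have "generation \<nu> 0 \<subseteq> {[]}" by (auto simp: generation_def)
  then show ?case by (rule finite_subset) simp
next
  case (Suc n)
  have "generation \<nu> (Suc n) \<subseteq> (\<Union>u\<in>generation \<nu> n. (\<lambda>i. u @ [i]) ` {..<\<nu> u})"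
  proof
    fix w assume w: "w \<in> generation \<nu> (Suc n)"
    then obtain u i where "w = u @ [i]" by (cases w rule: rev_cases) (auto simp: generation_def)
    then show "w \<in> (\<Union>u\<in>generation \<nu> n. (\<lambda>i. u @ [i]) ` {..<\<nu> u})"
      using w by (auto simp: generation_def in_tree_snoc)
  qed
  then show ?case by (rule finite_subset) (use Suc in auto)
qed

lemma replicate_in_generation: "leafless \<nu> \<Longrightarrow> replicate n 0 \<in> generation \<nu> n"
  by (auto simp: generation_def in_tree_def leafless_def Suc_le_eq)

text \<open>Demanded for all individuals and positions, occupied or not; these are countably many,
  and the estimates for the maximum become pathwise.\<close>

definition nearest_nbr :: "(nat list \<Rightarrow> nat list \<Rightarrow> nat list) \<Rightarrow> bool" where
  "nearest_nbr ch \<longleftrightarrow> (\<forall>u x. length (ch u x) \<le> length x + 1 \<and> length x \<le> length (ch u x) + 1)"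

context
  fixes \<nu> :: "nat list \<Rightarrow> nat" and ch :: "nat list \<Rightarrow> nat list \<Rightarrow> nat list"
  assumes \<nu>: "leafless \<nu>"
begin

lemma max_disp_ge: "u \<in> generation \<nu> n \<Longrightarrow> real (length (brw_from ch [] u)) \<le> max_disp \<nu> ch n"
  unfolding max_disp_def brw_pos_eq using finite_generation[of \<nu> n] by (auto intro!: Max_ge)

lemma max_disp_attained:
  obtains u where "u \<in> generation \<nu> n" "max_disp \<nu> ch n = real (length (brw_from ch [] u))"
proof -
  have "Max ((\<lambda>u. length (brw_pos ch u)) ` generation \<nu> n) \<in> (\<lambda>u. length (brw_pos ch u)) ` generation \<nu> n"
    using finite_generation[of \<nu> n] replicate_in_generation[OF \<nu>, of n] by (intro Max_in) auto
  then show ?thesis using that by (auto simp: max_disp_def brw_pos_eq)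
qed

lemma all_below_iff: "all_below L n [] \<nu> ch \<longleftrightarrow> max_disp \<nu> ch n < real L"
proof
  assume "all_below L n [] \<nu> ch"
  moreover obtain u where "u \<in> generation \<nu> n" "max_disp \<nu> ch n = real (length (brw_from ch [] u))"
    by (rule max_disp_attained)
  ultimately show "max_disp \<nu> ch n < real L" by (auto simp: all_below_def generation_def)
next
  assume *: "max_disp \<nu> ch n < real L"
  show "all_below L n [] \<nu> ch"
    unfolding all_below_def
  proof (intro allI impI)
    fix u assume "length u = n \<and> in_tree \<nu> u"
    then show "length (brw_from ch [] u) < L" using max_disp_ge[of u n] * by (simp add: generation_def)
  qed
qed

text \<open>A particle attaining the maximum has a first child, which loses at most one
  level.\<close>

lemma max_disp_Suc:
  assumes "nearest_nbr ch" shows "max_disp \<nu> ch n - 1 \<le> max_disp \<nu> ch (Suc n)"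
proof -
  obtain u where u: "u \<in> generation \<nu> n" "max_disp \<nu> ch n = real (length (brw_from ch [] u))"
    by (rule max_disp_attained)
  have "u @ [0] \<in> generation \<nu> (Suc n)" using u(1) \<nu> by (simp add: generation_def in_tree_snoc leafless_def Suc_le_eq)
  then have "real (length (ch (u @ [0]) (brw_from ch [] u))) \<le> max_disp \<nu> ch (Suc n)"
    using max_disp_ge by (simp add: brw_from_snoc flip: brw_from_snoc)
  moreover have "length (brw_from ch [] u) \<le> length (ch (u @ [0]) (brw_from ch [] u)) + 1"
    using assms by (simp add: nearest_nbr_def)
  ultimately show ?thesis using u(2) by linarith
qed

lemma max_disp_add:
  assumes "nearest_nbr ch" shows "max_disp \<nu> ch n - real k \<le> max_disp \<nu> ch (n + k)"
proof (induction k)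
  case (Suc k)
  then show ?case using max_disp_Suc[OF assms, of "n + k"] by simp
qed simp

lemma max_disp_le:
  assumes "nearest_nbr ch" shows "max_disp \<nu> ch n \<le> real n"
proof -
  have "length (brw_from ch [] u) \<le> length u" for u
  proof (induction u rule: rev_induct)
    case (snoc i u)
    then show ?case using assms[unfolded nearest_nbr_def, rule_format, of "u @ [i]" "brw_from ch [] u"]
      by (simp add: brw_from_snoc)
  qed simp
  moreover obtain u where "u \<in> generation \<nu> n" "max_disp \<nu> ch n = real (length (brw_from ch [] u))"
    by (rule max_disp_attained)
  ultimately show ?thesis by (metis (mono_tags) generation_def mem_Collect_eq of_nat_le_iff)
qed

end

lemma set_step_pmf_nbr:
  assumes "leafless \<kappa>" "y \<in> set_pmf (step_pmf lam \<kappa> x)"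
  shows "length y \<le> length x + 1 \<and> length x \<le> length y + 1"
proof -
  have "{..<\<kappa> x} \<noteq> {}" using assms(1) by (auto simp: leafless_def Suc_le_eq)
  then show ?thesis using assms(2) by (auto simp: step_pmf_def split: if_splits)
qed

lemma AE_nearest_nbr:
  assumes "leafless \<kappa>" shows "AE ch in field_space lam \<kappa>. nearest_nbr ch"
proof -
  have "AE ch in field_space lam \<kappa>. length (ch u x) \<le> length x + 1 \<and> length x \<le> length (ch u x) + 1" for u x :: "nat list"
    unfolding field_space_def
  proof (rule AE_PiM_component)
    show "AE s in step_field lam \<kappa>. length (s x) \<le> length x + 1 \<and> length x \<le> length (s x) + 1"
      unfolding step_field_def
      by (rule AE_PiM_component) (use set_step_pmf_nbr[OF assms] in \<open>auto intro: prob_space_measure_pmf AE_pmfI\<close>)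
  qed (auto intro: prob_space_step_field)
  then show ?thesis unfolding nearest_nbr_def by (simp add: AE_all_countable)
qed

text \<open>The first children of first children form a line of descent that moves as the
  \<lambda>-biased walk. Step n uses the choice of the individual in generation n + 1, hence
  \<open>Suc n\<close>.\<close>

lemma AE_walk_along_ray:
  assumes "AE c in walk_space lam \<kappa>. P c"
  shows "AE ch in field_space lam \<kappa>. P (\<lambda>n. ch (replicate (Suc n) (0::nat)))"
proof -
  let ?f = "\<lambda>ch n. ch (replicate (Suc n) (0::nat)) :: nat list \<Rightarrow> nat list"
  have meas: "?f \<in> field_space lam \<kappa> \<rightarrow>\<^sub>M field_space lam \<kappa>"
    unfolding field_space_def
  proof (rule measurable_PiM_single')
    show "(\<lambda>ch. ch (replicate (Suc n) 0)) \<in> PiM UNIV (\<lambda>_. step_field lam \<kappa>) \<rightarrow>\<^sub>M step_field lam \<kappa>" for n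
      by (rule measurable_component_singleton) simp
    show "?f \<in> space (PiM UNIV (\<lambda>_. step_field lam \<kappa>)) \<rightarrow> (\<Pi>\<^sub>E n\<in>UNIV. space (step_field lam \<kappa>))"
      by (auto simp: step_field_def space_PiM PiE_def)
  qed
  have "distr (PiM UNIV (\<lambda>_. step_field lam \<kappa>)) (PiM UNIV (\<lambda>_. step_field lam \<kappa>)) (\<lambda>ch. \<lambda>n\<in>UNIV. ch (replicate (Suc n) (0::nat))) =
      PiM UNIV (\<lambda>_. step_field lam \<kappa>)"
  proof (rule distr_PiM_reindex)
    show "inj_on (\<lambda>n. replicate (Suc n) (0::nat)) UNIV"
      by (rule injI) (metis length_replicate nat.inject)
  qed (auto intro: prob_space_step_field)
  then have eq: "distr (field_space lam \<kappa>) (field_space lam \<kappa>) ?f = walk_space lam \<kappa>"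
    unfolding walk_space_eq field_space_def by (simp add: restrict_UNIV)
  have "AE c in distr (field_space lam \<kappa>) (field_space lam \<kappa>) ?f. P c"
    unfolding eq by (rule assms)
  then show ?thesis by (rule AE_distrD[OF meas])
qed

lemma walk_pos_along_ray: "walk_pos (\<lambda>n. ch (replicate (Suc n) 0)) n = brw_from ch [] (replicate n 0)"
proof (induction n)
  case (Suc n)
  have "brw_from ch [] (replicate (Suc n) 0) = brw_from ch [] (replicate n 0 @ [0])"
    by (simp add: replicate_append_same)
  also have "\<dots> = ch (replicate n 0 @ [0]) (brw_from ch [] (replicate n 0))" by (rule brw_from_snoc)
  finally show ?case using Suc by (simp add: replicate_append_same)
qed simp

section \<open>Almost sure bounds for the maximum\<close>

context walk_with_rate
begin

context
  fixes mu :: "nat pmf"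
  assumes mu: "pmf mu 0 = 0" "pmf mu 1 < 1" "integrable (measure_pmf mu) real"
    and m: "1 < measure_pmf.expectation mu real"
begin

lemma prob_space_BRW: "prob_space (BRW_quenched lam mu \<kappa>)"
proof -
  interpret pair_prob_space "BGW mu" "field_space lam \<kappa> :: (nat list \<Rightarrow> _) measure"
    by (intro pair_prob_space.intro pair_sigma_finite.intro prob_space_imp_sigma_finite prob_space_BGW prob_space_field_space)
  show ?thesis unfolding BRW_quenched_eq by (rule P.prob_space_axioms)
qed

lemma AE_BRW:
  assumes "leafless \<kappa>"
  shows "AE \<omega> in BRW_quenched lam mu \<kappa>. leafless (fst \<omega>) \<and> nearest_nbr (snd \<omega>)"
  unfolding BRW_quenched_eq
  by (intro AE_conjI AE_pair_fst AE_pair_snd AE_BGW_leafless AE_nearest_nbr prob_space_BGW prob_space_field_space mu assms)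

lemma sets_all_below: "{\<omega>. all_below L n [] (fst \<omega>) (snd \<omega>)} \<in> sets (BRW_quenched lam mu \<kappa>)"
  and space_BRW: "space (BRW_quenched lam mu \<kappa>) = UNIV"
proof -
  show sp: "space (BRW_quenched lam mu \<kappa>) = UNIV"
    unfolding BRW_quenched_eq by (simp only: space_pair_measure space_BGW space_field_space UNIV_Times_UNIV)
  have "{\<omega> \<in> space (BRW_quenched lam mu \<kappa>). all_below L n [] (fst \<omega>) (snd \<omega>)} \<in> sets (BRW_quenched lam mu \<kappa>)"
    unfolding BRW_quenched_eq by (rule predE[OF measurable_all_below])
  then show "{\<omega>. all_below L n [] (fst \<omega>) (snd \<omega>)} \<in> sets (BRW_quenched lam mu \<kappa>)"
    by (simp only: sp UNIV_I simp_thms)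
qed

lemma measure_all_below:
  "leafless \<kappa> \<Longrightarrow> measure (BRW_quenched lam mu \<kappa>) {\<omega>. all_below L n [] (fst \<omega>) (snd \<omega>)} = miss_prob mu lam \<kappa> L n []"
  using emeasure_all_below[OF lam _ mu(1,3), of \<kappa> L n] miss_prob_bounds[OF lam _ mu(1,3), of \<kappa> L n "[]"]
  by (simp add: measure_def)

lemma AE_eventually_not_below:
  assumes \<kappa>: "leafless \<kappa>" and "summable (\<lambda>k. miss_prob mu lam \<kappa> (L k) (n k) [])"
  shows "AE \<omega> in BRW_quenched lam mu \<kappa>. \<forall>\<^sub>F k in sequentially. \<not> all_below (L k) (n k) [] (fst \<omega>) (snd \<omega>)"
proof -
  interpret prob_space "BRW_quenched lam mu \<kappa>" by (rule prob_space_BRW)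
  have "AE \<omega> in BRW_quenched lam mu \<kappa>. \<forall>\<^sub>F k in sequentially.
      \<omega> \<in> space (BRW_quenched lam mu \<kappa>) - {\<omega>. all_below (L k) (n k) [] (fst \<omega>) (snd \<omega>)}"
    by (rule borel_cantelli_AE1)
      (use assms(2) sets_all_below in \<open>auto simp: measure_all_below[OF \<kappa>] emeasure_eq_measure\<close>)
  then show ?thesis by simp
qed

lemma AE_eventually_below:
  assumes \<kappa>: "leafless \<kappa>" and "summable (\<lambda>k. 1 - miss_prob mu lam \<kappa> (L k) (n k) [])"
  shows "AE \<omega> in BRW_quenched lam mu \<kappa>. \<forall>\<^sub>F k in sequentially. all_below (L k) (n k) [] (fst \<omega>) (snd \<omega>)"
proof -
  interpret prob_space "BRW_quenched lam mu \<kappa>" by (rule prob_space_BRW)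
  let ?B = "\<lambda>k. space (BRW_quenched lam mu \<kappa>) - {\<omega>. all_below (L k) (n k) [] (fst \<omega>) (snd \<omega>)}"
  have meas: "measure (BRW_quenched lam mu \<kappa>) (?B k) = 1 - miss_prob mu lam \<kappa> (L k) (n k) []" for k
    using prob_compl[OF sets_all_below] by (simp add: measure_all_below[OF \<kappa>])
  have "AE \<omega> in BRW_quenched lam mu \<kappa>. \<forall>\<^sub>F k in sequentially. \<omega> \<in> space (BRW_quenched lam mu \<kappa>) - ?B k"
    by (rule borel_cantelli_AE1) (use assms(2) sets_all_below in \<open>auto simp: meas emeasure_eq_measure\<close>)
  then show ?thesis by (simp add: space_BRW)
qed

lemma max_disp_upper:
  assumes a: "v < a" "a \<le> 1" "ln (measure_pmf.expectation mu real) < I a"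
  shows "AE \<kappa> in BGW p. AE \<omega> in BRW_quenched lam mu \<kappa>. \<forall>\<^sub>F n in sequentially. max_disp (fst \<omega>) (snd \<omega>) n \<le> a * real n"
proof -
  let ?m = "measure_pmf.expectation mu real"
  \<comment> \<open>Half of the gap, so that m^n exp (- (I a - \<epsilon>) n) = exp (- \<epsilon>
    n).\<close>
  define \<epsilon> where "\<epsilon> = (I a - ln ?m) / 2"
  have \<epsilon>: "0 < \<epsilon>" using a by (simp add: \<epsilon>_def)
  show ?thesis using AE_BGW_leafless[OF p0] dev_bounds[OF a(1,2) \<epsilon>]
  proof eventually_elim
    case (elim \<kappa>)
    let ?L = "\<lambda>n. nat \<lceil>a * real n\<rceil>"
    have "\<forall>\<^sub>F n in sequentially. norm (1 - miss_prob mu lam \<kappa> (?L n) n []) \<le> exp (- \<epsilon>) ^ n"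
      using elim(2)
    proof eventually_elim
      case (elim n)
      have "1 - miss_prob mu lam \<kappa> (?L n) n [] \<le> ?m ^ n * walk_mean lam \<kappa> n (\<lambda>y. if ?L n \<le> length y then 1 else 0) []"
        by (rule one_minus_miss_prob_le[OF lam \<open>leafless \<kappa>\<close> mu(1,3)])
      also have "walk_mean lam \<kappa> n (\<lambda>y. if ?L n \<le> length y then 1 else 0) [] = dev lam \<kappa> n a"
        unfolding dev_def by (simp add: nat_le_iff ceiling_le_iff)
      also have "?m ^ n * dev lam \<kappa> n a \<le> ?m ^ n * exp (- (I a - \<epsilon>) * real n)"
        using elim m by (intro mult_left_mono) auto
      also have "?m ^ n = exp (real n * ln ?m)" using m by (simp add: exp_of_nat_mult)
      also have "exp (real n * ln ?m) * exp (- (I a - \<epsilon>) * real n) = exp (real n * - \<epsilon>)"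
        by (simp add: exp_add[symmetric] \<epsilon>_def field_simps)
      also have "\<dots> = exp (- \<epsilon>) ^ n" by (rule exp_of_nat_mult)
      finally show ?case using miss_prob_bounds(2)[OF lam \<open>leafless \<kappa>\<close> mu(1,3), of "?L n" n "[]"] by simp
    qed
    then have "summable (\<lambda>n. 1 - miss_prob mu lam \<kappa> (?L n) n [])"
      by (rule summable_comparison_test_ev) (use \<epsilon> in \<open>simp add: summable_geometric\<close>)
    from AE_eventually_below[OF elim(1) this] AE_BRW[OF elim(1)] show ?case
    proof eventually_elim
      case (elim \<omega>)
      show ?case using elim(1)
      proof eventually_elim
        case (elim n)
        then have "max_disp (fst \<omega>) (snd \<omega>) n < real (?L n)" using \<open>leafless (fst \<omega>) \<and> _\<close> all_below_iff by blast
        then show ?case unfolding max_disp_def by (simp add: zless_nat_eq_int_zless less_ceiling_iff)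
      qed
    qed
  qed
qed

text \<open>Between the times k^N and (k+1)^N the maximum falls by at most one per generation, and
  the gap is of smaller order than k^N. The wanted inequality b k^N - (n - k^N) \<ge> a n reads (1 +
  a) n \<le> (1 + b) k^N, whence the ratio in the proof.\<close>

lemma max_disp_lower_of_subsequence:
  assumes \<nu>: "leafless \<nu>" "nearest_nbr ch" and N: "1 \<le> N" and a: "0 \<le> a" "a < b"
    and sub: "\<forall>\<^sub>F k in sequentially. b * real (k ^ N) \<le> max_disp \<nu> ch (k ^ N)"
  shows "\<forall>\<^sub>F n in sequentially. a * real n \<le> max_disp \<nu> ch n"
proof -
  have "(\<lambda>k. (1 + 1 / real k) ^ N) \<longlonglongrightarrow> (1 + 0) ^ N"
    by (intro tendsto_intros lim_1_over_n)
  then have "\<forall>\<^sub>F k in sequentially. (1 + 1 / real k) ^ N < (1 + b) / (1 + a)"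
    by (rule order_tendstoD(2)) (use a in simp)
  with sub have "\<forall>\<^sub>F k in sequentially. b * real (k ^ N) \<le> max_disp \<nu> ch (k ^ N) \<and> (1 + a) * real (Suc k ^ N) \<le> (1 + b) * real (k ^ N)"
    using eventually_gt_at_top[of 0]
  proof eventually_elim
    case (elim k)
    have "real (Suc k ^ N) = (1 + 1 / real k) ^ N * real (k ^ N)"
      using elim(3) by (simp add: power_mult_distrib[symmetric] distrib_right add.commute)
    also have "\<dots> \<le> (1 + b) / (1 + a) * real (k ^ N)" using elim(2) by (intro mult_right_mono) auto
    finally have "real (Suc k ^ N) \<le> (1 + b) / (1 + a) * real (k ^ N)" .
    from mult_left_mono[OF this, of "1 + a"] have "(1 + a) * real (Suc k ^ N) \<le> (1 + b) * real (k ^ N)" using a by simp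
    then show ?case using elim(1) by blast
  qed
  then obtain k0 where k0: "\<And>k. k0 \<le> k \<Longrightarrow> b * real (k ^ N) \<le> max_disp \<nu> ch (k ^ N)"
    "\<And>k. k0 \<le> k \<Longrightarrow> (1 + a) * real (Suc k ^ N) \<le> (1 + b) * real (k ^ N)"
    unfolding eventually_sequentially by blast
  show ?thesis using eventually_ge_at_top[of "k0 ^ N"]
  proof eventually_elim
    case (elim n)
    let ?S = "{k. k ^ N \<le> n}"
    have "k \<le> k ^ N" for k :: nat using N by (cases "k = 0") (auto intro: self_le_power)
    then have fin: "finite ?S" by (intro finite_subset[of ?S "{..n}"]) (auto intro: order_trans)
    have k0S: "k0 \<in> ?S" using elim by simp
    define k where "k = Max ?S"
    have kS: "k ^ N \<le> n" using Max_in[OF fin] k0S by (auto simp: k_def)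
    have k0k: "k0 \<le> k" unfolding k_def using fin k0S by (rule Max_ge)
    have "Suc k \<notin> ?S" using Max_ge[OF fin, of "Suc k"] by (auto simp: k_def)
    then have nk: "n \<le> Suc k ^ N" by simp
    have "max_disp \<nu> ch (k ^ N) - real (n - k ^ N) \<le> max_disp \<nu> ch n"
      using max_disp_add[OF \<nu>, of "k ^ N" "n - k ^ N"] kS by simp
    moreover have "b * real (k ^ N) \<le> max_disp \<nu> ch (k ^ N)" by (rule k0(1)[OF k0k])
    moreover have "(1 + a) * real n \<le> (1 + b) * real (k ^ N)"
    proof -
      have "(1 + a) * real n \<le> (1 + a) * real (Suc k ^ N)" using nk a by (intro mult_left_mono) (simp_all only: of_nat_le_iff)
      then show ?thesis using k0(2)[OF k0k] by linarith
    qed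
    ultimately show ?case using kS by (simp add: of_nat_diff algebra_simps)
  qed
qed

lemma max_disp_lower:
  assumes pmean: "integrable (measure_pmf p) real"
    and a: "v < a" "a \<le> 1" "I a < ln (measure_pmf.expectation mu real)" and a': "0 \<le> a'" "a' < a"
  shows "AE \<kappa> in BGW p. AE \<omega> in BRW_quenched lam mu \<kappa>. \<forall>\<^sub>F n in sequentially. a' * real n \<le> max_disp (fst \<omega>) (snd \<omega>) n"
proof -
  define b where "b = (a' + a) / 2"
  have b: "0 \<le> b" "a' < b" "b < a" using a' by (auto simp: b_def)
  obtain N where N: "1 \<le> N" "AE \<kappa> in BGW p. summable (\<lambda>k. miss_prob mu lam \<kappa> (nat \<lceil>b * real (k ^ N)\<rceil>) (k ^ N) [])"
  proof (cases "v = 0")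
    case True
    from miss_prob_summable_speed_zero[OF True a mu m b(1,3) pmean] show ?thesis using that[of 1] by simp
  next
    case False
    then have "0 < v" using v by simp
    from miss_prob_summable_transient[OF this a mu m b(1,3)] show ?thesis using that by blast
  qed
  from AE_BGW_leafless[OF p0] N(2) show ?thesis
  proof eventually_elim
    case (elim \<kappa>)
    from AE_eventually_not_below[OF elim] AE_BRW[OF elim(1)] show ?case
    proof eventually_elim
      case (elim \<omega>)
      have "\<forall>\<^sub>F k in sequentially. b * real (k ^ N) \<le> max_disp (fst \<omega>) (snd \<omega>) (k ^ N)"
        using elim(1)
      proof eventually_elim
        case (elim k)
        then have "\<not> max_disp (fst \<omega>) (snd \<omega>) (k ^ N) < real (nat \<lceil>b * real (k ^ N)\<rceil>)"
          using \<open>leafless (fst \<omega>) \<and> _\<close> all_below_iff by blast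
        then show ?case by linarith
      qed
      then show ?case
        using elim(2) N(1) a'(1) b(2) by (intro max_disp_lower_of_subsequence[where b = b and N = N]) auto
    qed
  qed
qed

text \<open>The deviation estimates concern speeds above v only; speed v itself is supplied by a
  single line of descent.\<close>

lemma max_disp_lower_speed:
  assumes "AE \<kappa> in BGW p. AE c in walk_space lam \<kappa>. (\<lambda>n. real (length (walk_pos c n)) / real n) \<longlonglongrightarrow> v" and a: "a < v"
  shows "AE \<kappa> in BGW p. AE \<omega> in BRW_quenched lam mu \<kappa>. \<forall>\<^sub>F n in sequentially. a * real n \<le> max_disp (fst \<omega>) (snd \<omega>) n"
  using assms(1) AE_BGW_leafless[OF p0]
proof eventually_elim
  case (elim \<kappa>)
  have "AE ch in field_space lam \<kappa>. (\<lambda>n. real (length (brw_from ch [] (replicate n 0))) / real n) \<longlonglongrightarrow> v"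
    using AE_walk_along_ray[OF elim(1)] by (simp only: walk_pos_along_ray)
  from AE_pair_snd[OF prob_space_BGW prob_space_field_space this]
  have "AE \<omega> in BRW_quenched lam mu \<kappa>. (\<lambda>n. real (length (brw_from (snd \<omega>) [] (replicate n 0))) / real n) \<longlonglongrightarrow> v"
    unfolding BRW_quenched_eq .
  with AE_BRW[OF elim(2)] show ?case
  proof eventually_elim
    case (elim \<omega>)
    show ?case using order_tendstoD(1)[OF elim(2) a] eventually_gt_at_top[of 0]
    proof eventually_elim
      case (elim n)
      have "a * real n \<le> real (length (brw_from (snd \<omega>) [] (replicate n 0)))" using elim by (simp add: field_simps)
      also have "\<dots> \<le> max_disp (fst \<omega>) (snd \<omega>) n"
        using \<open>leafless (fst \<omega>) \<and> _\<close> by (intro max_disp_ge replicate_in_generation) auto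
      finally show ?case .
    qed
  qed
qed

end

end

theorem theorem1p1:
  fixes p mu :: "nat pmf" and lam v :: real and I :: "real \<Rightarrow> real"
  assumes p0: "pmf p 0 = 0" and p1: "pmf p 1 < 1"
    and pmean: "integrable (measure_pmf p) real"
    and lam: "lam > 0"
    and mu0: "pmf mu 0 = 0" and mu1: "pmf mu 1 < 1"
    and mumean: "integrable (measure_pmf mu) real"
    and m_gt: "measure_pmf.expectation mu real > 1"
    and speed: "is_speed p lam v"
    and rate: "is_rate_fn p lam v I"
  shows "AE \<kappa> in BGW p. AE \<omega> in BRW_quenched lam mu \<kappa>.
           (\<lambda>n. max_disp (fst \<omega>) (snd \<omega>) n / real n) \<longlonglongrightarrow>
             Sup {a \<in> {v..1}. I a \<le> ln (measure_pmf.expectation mu real)}"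
proof -
  interpret walk_with_rate p lam v I
    using p0 lam speed rate by unfold_locales (auto simp: is_speed_def)
  let ?m = "measure_pmf.expectation mu real"
  define A where "A = {a \<in> {v..1}. I a \<le> ln ?m}"
  define V where "V = Sup A"
  have vA: "v \<in> A" using v I_v m_gt by (simp add: A_def)
  have bdd: "bdd_above A" by (rule bdd_aboveI[of _ 1]) (auto simp: A_def)
  have V: "v \<le> V" "V \<le> 1"
    unfolding V_def using cSup_upper[OF vA bdd] vA by (auto intro!: cSup_least simp: A_def)
  note mu = mu0 mu1 mumean m_gt
  \<comment> \<open>Restricted to q \<le> 1, as the rate function is controlled on [v, 1] only; if V
    = 1, the trivial bound by n takes over.\<close>
  have upper: "AE \<kappa> in BGW p. AE \<omega> in BRW_quenched lam mu \<kappa>. \<forall>\<^sub>F n in sequentially. max_disp (fst \<omega>) (snd \<omega>) n \<le> q * real n"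
    if q: "V < q" "q \<le> 1" for q
  proof (rule max_disp_upper[OF mu])
    show "v < q" "q \<le> 1" using q V by auto
    have "q \<notin> A" using q cSup_upper[OF _ bdd, of q] by (auto simp: V_def)
    then show "ln ?m < I q" using q V by (auto simp: A_def)
  qed
  have lower: "AE \<kappa> in BGW p. AE \<omega> in BRW_quenched lam mu \<kappa>. \<forall>\<^sub>F n in sequentially. q * real n \<le> max_disp (fst \<omega>) (snd \<omega>) n"
    if q: "q < V" for q
  proof (cases "V = v")
    case True
    have "AE \<kappa> in BGW p. AE c in walk_space lam \<kappa>. (\<lambda>n. real (length (walk_pos c n)) / real n) \<longlonglongrightarrow> v"
      using speed by (simp add: is_speed_def)
    from max_disp_lower_speed[OF mu this] show ?thesis using q True by simp
  next
    case False
    then have "v < V" using V by simp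
    \<comment> \<open>Passing to a < b with b in A makes I a < ln m strict, as the lower bound
      requires.\<close>
    then obtain a where a: "max v (max q 0) < a" "a < V" using dense[of "max v (max q 0)" V] q v by auto
    obtain b where b: "b \<in> A" "a < b" using less_cSupD[of A a] vA a(2) unfolding V_def by auto
    have "I a < I b" using strict_mono_onD[OF I_mono, of a b] a b by (auto simp: A_def)
    then have "I a < ln ?m" using b by (simp add: A_def)
    then have "AE \<kappa> in BGW p. AE \<omega> in BRW_quenched lam mu \<kappa>. \<forall>\<^sub>F n in sequentially. max q 0 * real n \<le> max_disp (fst \<omega>) (snd \<omega>) n"
      using a V by (intro max_disp_lower[OF mu pmean, of a]) auto
    then show ?thesis
    proof eventually_elim
      case (elim \<kappa>)
      then show ?case
      proof eventually_elim
        case (elim \<omega>)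
        then show ?case
        proof eventually_elim
          case (elim n)
          have "q * real n \<le> max q 0 * real n" by (intro mult_right_mono) auto
          with elim show ?case by linarith
        qed
      qed
    qed
  qed
  \<comment> \<open>Rational q suffice, and they keep the exceptional null sets countable in number,
    for the environment and then for the branching random walk.\<close>
  have upper': "AE \<kappa> in BGW p. \<forall>q\<in>{q\<in>\<rat>. V < q \<and> q \<le> 1}. AE \<omega> in BRW_quenched lam mu \<kappa>. \<forall>\<^sub>F n in sequentially. max_disp (fst \<omega>) (snd \<omega>) n \<le> q * real n"
    using upper by (subst AE_ball_countable) (auto intro: countable_subset[OF _ countable_rat])
  have lower': "AE \<kappa> in BGW p. \<forall>q\<in>{q\<in>\<rat>. q < V}. AE \<omega> in BRW_quenched lam mu \<kappa>. \<forall>\<^sub>F n in sequentially. q * real n \<le> max_disp (fst \<omega>) (snd \<omega>) n"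
    using lower by (subst AE_ball_countable) (auto intro: countable_subset[OF _ countable_rat])
  show ?thesis
    unfolding A_def[symmetric] V_def[symmetric]
    using AE_BGW_leafless[OF p0] upper' lower'
  proof eventually_elim
    case (elim \<kappa>)
    have "AE \<omega> in BRW_quenched lam mu \<kappa>. \<forall>q\<in>{q\<in>\<rat>. V < q \<and> q \<le> 1}. \<forall>\<^sub>F n in sequentially. max_disp (fst \<omega>) (snd \<omega>) n \<le> q * real n"
      using elim(2) by (subst AE_ball_countable) (auto intro: countable_subset[OF _ countable_rat])
    moreover have "AE \<omega> in BRW_quenched lam mu \<kappa>. \<forall>q\<in>{q\<in>\<rat>. q < V}. \<forall>\<^sub>F n in sequentially. q * real n \<le> max_disp (fst \<omega>) (snd \<omega>) n"
      using elim(3) by (subst AE_ball_countable) (auto intro: countable_subset[OF _ countable_rat])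
    ultimately show ?case using AE_BRW[OF mu elim(1)]
    proof eventually_elim
      case (elim \<omega>)
      show ?case
      proof (rule order_tendstoI)
        fix x assume "x < V"
        then obtain q where q: "q \<in> \<rat>" "x < q" "q < V" using Rats_dense_in_real by blast
        then have "\<forall>\<^sub>F n in sequentially. q * real n \<le> max_disp (fst \<omega>) (snd \<omega>) n" using elim(2) by blast
        then show "\<forall>\<^sub>F n in sequentially. x < max_disp (fst \<omega>) (snd \<omega>) n / real n"
          using eventually_gt_at_top[of 0]
        proof eventually_elim
          case (elim n)
          then have "q \<le> max_disp (fst \<omega>) (snd \<omega>) n / real n" by (simp add: field_simps)
          then show ?case using q by linarith
        qed
      next
        fix x assume x: "V < x"
        show "\<forall>\<^sub>F n in sequentially. max_disp (fst \<omega>) (snd \<omega>) n / real n < x"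
        proof (cases "V = 1")
          case True
          show ?thesis using eventually_gt_at_top[of 0]
          proof eventually_elim
            case (elim n)
            have "max_disp (fst \<omega>) (snd \<omega>) n \<le> real n"
              using \<open>leafless (fst \<omega>) \<and> nearest_nbr (snd \<omega>)\<close> by (intro max_disp_le) auto
            then have "max_disp (fst \<omega>) (snd \<omega>) n / real n \<le> 1" using elim by (simp add: field_simps)
            then show ?case using x True by linarith
          qed
        next
          case False
          then have "V < min x 1" using x V by simp
          then obtain q where q: "q \<in> \<rat>" "V < q" "q < min x 1" using Rats_dense_in_real by blast
          then have "\<forall>\<^sub>F n in sequentially. max_disp (fst \<omega>) (snd \<omega>) n \<le> q * real n" using elim(1) by auto
          then show ?thesis using eventually_gt_at_top[of 0]
          proof eventually_elim
            case (elim n)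
            then have "max_disp (fst \<omega>) (snd \<omega>) n / real n \<le> q" by (simp add: field_simps)
            then show ?case using q by linarith
          qed
        qed
      qed
    qed
  qed
qed

end
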